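(* Let $(X,\infty)$ be a Weierstrass curve and $\tilde h_{R_X}\in R_X\otimes_{R_{\mathbb P}}R_X$ the element of the context; primes denote elements of the second tensor factor. Then $\tilde h_{R_X}$ is expressed, as an element of the $R_{\mathbb P}$-module, by $$\tilde h_{R_X}(x,y_\bullet,y_\bullet')=\hat\Upsilon_0\cdot1+\hat\Upsilon_1\mathfrak y'_{\mathfrak e_1}+\dots+\hat\Upsilon_{r-1}\mathfrak y'_{\mathfrak e_{r-1}}=1\cdot\hat\Upsilon_0'+\mathfrak y_{\mathfrak e_1}\hat\Upsilon_1'+\dots+\mathfrak y_{\mathfrak e_{r-1}}\hat\Upsilon_{r-1}'$$ $$=\mathring{\mathfrak y}_{\mathfrak e_0}\mathfrak y'_{\mathfrak e_0}+\mathring{\mathfrak y}_{\mathfrak e_1}\mathfrak y'_{\mathfrak e_1}+\dots+\mathring{\mathfrak y}_{\mathfrak e_{r-1}}\mathfrak y'_{\mathfrak e_{r-1}}+\text{lower weight terms with respect to }-\mathrm{wt},$$ where $\mathfrak y'_{\mathfrak e_0}=1$ and each $\hat\Upsilon_i\in R_X$ has the following properties: (1) $\hat\Upsilon_i=\sum_{j=0}^{r-1}\mathfrak b_{i,j}\mathfrak y_{\mathfrak e_j}$ with certain $\mathfrak b_{i,j}\in\mathbb C[x]$; (2) $\hat\Upsilon_i=\mathring{\mathfrak y}_{\mathfrak e_i}+$ lower weight terms with respect to $-\mathrm{wt}$, where $\mathring{\mathfrak y}_{\mathfrak e_i}=\tilde\delta_i(x)\mathfrak y_{\mathfrak e_{\ell,i}^*}$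 with a monic polynomial $\tilde\delta_i(x)\in\mathbb C[x]$ of weight $-\delta_ir$ (in particular $\mathring{\mathfrak y}_{\mathfrak e_0}=\tilde\delta_0(x)\mathfrak y_{\mathfrak e_{\ell,0}^*}=\tilde\delta_0(x)\mathfrak y_{\mathfrak e_\ell}$), such that for every $i\in\{0,\dots,r-1\}$ $$\mathring{\mathfrak y}_{\mathfrak e_0}=\mathring{\mathfrak y}_{\mathfrak e_i}\mathfrak y_{\mathfrak e_i}+\text{lower weight terms with respect to }-\mathrm{wt},\qquad \mathrm{wt}(\mathring{\mathfrak y}_{\mathfrak e_i})=-\hat{\mathfrak e}_i=-(d_h-\mathfrak e_i).$$
   Context: Weierstrass curve. $(X,\infty)$ is a pointed compact Riemann surface (smooth complex projective curve); $R_X=H^0(X,\mathcal O_X( *\infty))$ is the ring of meromorphic functions on $X$ holomorphic on $X\setminus\{\infty\}$; $H_X=\{n\ge 0: \exists f \text{ meromorphic on } X \text{ with polar divisor } n\infty\}$ is the Weierstrass semigroup and $r$ its smallest positive element. The standard basis $\mathfrak e_0=0<\mathfrak e_1<\dots<\mathfrak e_{r-1}$ consists of the elements $\min\{h\in H_X: h\equiv i \bmod r\}$, $i=0,\dots,r-1$, in increasing order. It is assumed that $H_X$ has a minimal generating set $\{r_1=r,r_2=s,r_3,\dots,r_{m_X}\}$ with $s=\min\{\mathfrak e_i: i\geq 1,\gcd(\mathfrak e_i,r)=1\}$, and $X$ is the normalization of the plane curve given by an irreducible $f_X(x,y)=y^r+A_1(x)y^{r-1}+\dots+A_r(x)$ with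 $A_i\in\mathbb C[x]$, $\deg A_i\le is/r$, $A_r$ having $x^s$-coefficient $-1$; then $R_X=\mathbb C[x,y_{r_2},\dots,y_{r_{m_X}}]$ (a quotient of the polynomial ring), where $x$ and $y_{r_i}$ have their only pole at $\infty$, of order $r$ and $r_i$, $y_s=y_{r_2}=y$. Choosing positive integers with $i_s s-i_r r=1$, $t=x^{i_r}/y_s^{i_s}$ is a local parameter at $\infty$, and $y_{r_i}=t^{-r_i}(1+\text{higher order in }t)$. Write $y_\bullet=(y_{r_2},\dots,y_{r_{m_X}})$. The weight $\mathrm{wt}(f)$ is the order of vanishing of $f$ at $\infty$ ($\mathrm{wt}(x)=-r$, $\mathrm{wt}(y_{r_i})=-r_i$). $R_{\mathbb P}=\mathbb C[x]$ and $\varpi_r:X\to\mathbb P$ is the projection given by $x$. $R_X$ is a free $R_{\mathbb P}$-module with basis $\mathfrak y_{\mathfrak e_0}=1,\mathfrak y_{\mathfrak e_1},\dots,\mathfrak y_{\mathfrak e_{r-1}}$, $\mathfrak y_{\mathfrak e_i}$ a monic monomial of weight $-\mathfrak e_i$ in the $y_{r_j}$. The element $\tilde h_{R_X}$. For $j=2,\dots,m_X$ let $f_X^{(j)}(x,y)\in\mathbb C[x,y]$ be the irreducible polynomial, monic in $y$, with $f_X^{(j)}(x,y_{r_j})=0$ in $R_X$. View elements of $R_X\otimes_{R_{\mathbb P}}R_X$ as functions of pairs $(x,y_\bullet),(x,y_\bullet')$ of points of $X\times_{\mathbb P}X$. In its total quotient ring put $p_X^{(j)}(x,y,y')=\frac{(f_X^{(j)}(x,y)-f_X^{(j)}(x,y'))/(y-y')}{\partial_yf_X^{(j)}(x,y)}$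 (the divided difference being taken as a polynomial) and $p_{R_X}=\prod_{j=2}^{m_X}p_X^{(j)}(x,y_{r_j},y_{r_j}')$. Then $\tilde h_{R_X}(x,y_\bullet,y'_\bullet)\in R_X\otimes_{R_{\mathbb P}}R_X$ denotes an element such that: $\tilde h_{R_X}(x,y_\bullet,y_\bullet)$ (identified with $\tilde h_{R_X}(x,y_\bullet,y_\bullet)\otimes1$) and $\tilde h_{R_X}(x,y_\bullet,y'_\bullet)$ are coprime; $\tilde h_{R_X}(x,y_\bullet,y_\bullet')/\tilde h_{R_X}(x,y_\bullet,y_\bullet)=p_{R_X}$ (this ratio is invariant under the finite group acting on the fiber $\varpi_r^{-1}(x)$); and, for some integer $d_h$ with $d_h-\mathfrak e_i\in H_X$ for all $i$, the leading homogeneous part of $\tilde h_{R_X}$ for $-\mathrm{wt}$ (both $y_\bullet$ and $y'_\bullet$ being weighted) is $\sum_{i=0}^{r-1}z^{d_h-\mathfrak e_i}z'^{\,\mathfrak e_i}$ under $x\mapsto z^r=z'^r$, $y_{r_j}\mapsto z^{r_j}$, $y_{r_j}'\mapsto z'^{\,r_j}$. Put $\hat{\mathfrak e}_i=d_h-\mathfrak e_i$. Let $\ell\in\{0,\dots,r-1\}$ be determined by $d_h\equiv\mathfrak e_\ell\bmod r$, let $\mathfrak e_{\ell,i}^*$ be the standard basis element congruent to $\mathfrak e_\ell-\mathfrak e_i$ mod $r$ (so $\mathfrak e_{\ell,0}^*=\mathfrak e_\ell$), and let $\delta_i\ge0$ be the integers with $\hat{\mathfrak e}_i=\mathfrak e_{\ell,i}^*+\delta_ir$.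 *)

theory Defs
  imports
    "HOL-Algebra.Free_Abelian_Groups"
    "HOL-Algebra.Generated_Groups"
    "HOL-Algebra.Divisibility"
    "HOL-Algebra.Ring"
    "HOL-Complex_Analysis.Complex_Analysis"
    "HOL-Computational_Algebra.Polynomial_Factorial"
begin

section \<open>Pointed compact Riemann surfaces\<close>

type_synonym 'p atlas = "('p set \<times> ('p \<Rightarrow> complex)) set"

definition compact_riemann_surface :: "'p topology \<Rightarrow> 'p atlas \<Rightarrow> bool" where
  "compact_riemann_surface X \<A> \<longleftrightarrow>
     Hausdorff_space X \<and> connected_space X \<and> compact_space X \<and>
     (\<Union>(U, \<phi>)\<in>\<A>. U) = topspace X \<and>
     (\<forall>(U, \<phi>)\<in>\<A>. openin X U \<and> open (\<phi> ` U) \<and>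
        homeomorphic_map (subtopology X U) (top_of_set (\<phi> ` U)) \<phi>) \<and>
     (\<forall>(U, \<phi>)\<in>\<A>. \<forall>(V, \<psi>)\<in>\<A>. (\<lambda>z. \<psi> (inv_into U \<phi> z)) holomorphic_on \<phi> ` (U \<inter> V))"

text \<open>Functions on the affine part \<open>X - {P}\<close> are extensional, so that their equality is
  equality on \<open>X - {P}\<close>.\<close>

definition affine_part :: "'p topology \<Rightarrow> 'p \<Rightarrow> 'p set" where
  "affine_part X P = topspace X - {P}"

definition coordinate_functions ::
  "'p topology \<Rightarrow> 'p atlas \<Rightarrow> 'p \<Rightarrow> ('p \<Rightarrow> complex) set" where
  "coordinate_functions X \<A> P =
     {f \<in> extensional (affine_part X P).
        (\<forall>(U, \<phi>)\<in>\<A>. (\<lambda>z. f (inv_into U \<phi> z)) holomorphic_on \<phi> ` (U \<inter> affine_part X P)) \<and>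
        (\<forall>(U, \<phi>)\<in>\<A>. P \<in> U \<longrightarrow> (\<lambda>z. f (inv_into U \<phi> z)) meromorphic_on {\<phi> P})}"

definition coordinate_ring ::
  "'p topology \<Rightarrow> 'p atlas \<Rightarrow> 'p \<Rightarrow> ('p \<Rightarrow> complex) ring" where
  "coordinate_ring X \<A> P =
     \<lparr>carrier = coordinate_functions X \<A> P,
      monoid.mult = (\<lambda>f g. \<lambda>p\<in>affine_part X P. f p * g p),
      one = (\<lambda>p\<in>affine_part X P. 1),
      zero = (\<lambda>p\<in>affine_part X P. 0),
      add = (\<lambda>f g. \<lambda>p\<in>affine_part X P. f p + g p)\<rparr>"

text \<open>The order of vanishing at \<open>P\<close>; it does not depend on the chart. It is unspecified for the
  zero function, which is treated separately wherever it can occur.\<close>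

definition wt :: "'p atlas \<Rightarrow> 'p \<Rightarrow> ('p \<Rightarrow> complex) \<Rightarrow> int" where
  "wt \<A> P f = (let (U, \<phi>) = (SOME c. c \<in> \<A> \<and> P \<in> fst c)
               in zorder (\<lambda>z. f (inv_into U \<phi> z)) (\<phi> P))"

definition weierstrass_semigroup :: "'p topology \<Rightarrow> 'p atlas \<Rightarrow> 'p \<Rightarrow> nat set" where
  "weierstrass_semigroup X \<A> P =
     {n. \<exists>f\<in>carrier (coordinate_ring X \<A> P).
           f \<noteq> \<zero>\<^bsub>coordinate_ring X \<A> P\<^esub> \<and> wt \<A> P f = - int n}"

section \<open>Numerical semigroups\<close>

definition semigroup_span :: "nat set \<Rightarrow> nat set" where
  "semigroup_span G = {n. \<exists>a. n = (\<Sum>g\<in>G. a g * g)}"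

definition minimal_generating_set :: "nat set \<Rightarrow> nat set \<Rightarrow> bool" where
  "minimal_generating_set H G \<longleftrightarrow>
     finite G \<and> semigroup_span G = H \<and> (\<forall>G'. G' \<subset> G \<longrightarrow> semigroup_span G' \<noteq> H)"

definition standard_basis :: "nat set \<Rightarrow> nat \<Rightarrow> (nat \<Rightarrow> nat) \<Rightarrow> bool" where
  "standard_basis H r e \<longleftrightarrow>
     strict_mono_on {..<r} e \<and>
     e ` {..<r} = {h \<in> H. \<forall>h'\<in>H. h' mod r = h mod r \<longrightarrow> h \<le> h'}"

section \<open>Weierstrass curves\<close>

text \<open>A bivariate polynomial is a polynomial in \<open>y\<close> (outer variable) over polynomials in
  \<open>x\<close> (inner variable).\<close>

definition eval2 :: "complex poly poly \<Rightarrow> complex \<Rightarrow> complex \<Rightarrow> complex" where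
  "eval2 f a b = poly (poly f [:b:]) a"

definition plane_curve :: "complex poly poly \<Rightarrow> (complex \<times> complex) set" where
  "plane_curve f = {(a, b). eval2 f a b = 0}"

definition singular_points :: "complex poly poly \<Rightarrow> (complex \<times> complex) set" where
  "singular_points f =
     {(a, b) \<in> plane_curve f. eval2 (map_poly pderiv f) a b = 0 \<and> eval2 (pderiv f) a b = 0}"

text \<open>The map \<open>(x, y)\<close> on \<open>S\<close> is the normalization of the affine curve \<open>f = 0\<close>: it is onto the
  curve, only finitely many points lie over singular points, and it is injective on the rest.
  Below, \<open>S\<close> is a compact Riemann surface minus the one point at which \<open>x\<close> and \<open>y\<close> have their
  poles, so this is the usual definition for the curve completed by one point at infinity.\<close>

definition normalization_map ::
  "'p set \<Rightarrow> ('p \<Rightarrow> complex) \<Rightarrow> ('p \<Rightarrow> complex) \<Rightarrow> complex poly poly \<Rightarrow> bool" where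
  "normalization_map S x y f \<longleftrightarrow>
     (\<lambda>p. (x p, y p)) ` S = plane_curve f \<and>
     finite {p \<in> S. (x p, y p) \<in> singular_points f} \<and>
     inj_on (\<lambda>p. (x p, y p)) {p \<in> S. (x p, y p) \<notin> singular_points f}"

text \<open>The generators of the semigroup are \<open>\<rho> 1, \<dots>, \<rho> m\<close>, and \<open>y j\<close> is the function with pole
  order \<open>\<rho> j\<close>, for \<open>j \<in> {2..m}\<close>. The last condition says \<open>y j = t powi (- \<rho> j) * (1 + \<dots>)\<close> for
  the local parameter \<open>t = x ^ i_r / y 2 ^ i_s\<close>.\<close>

definition weierstrass_curve ::
  "'p topology \<Rightarrow> 'p atlas \<Rightarrow> 'p \<Rightarrow> nat \<Rightarrow> (nat \<Rightarrow> nat) \<Rightarrow> nat \<Rightarrow> (nat \<Rightarrow> nat) \<Rightarrow>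
   complex poly poly \<Rightarrow> nat \<Rightarrow> nat \<Rightarrow> ('p \<Rightarrow> complex) \<Rightarrow> (nat \<Rightarrow> 'p \<Rightarrow> complex) \<Rightarrow> bool" where
  "weierstrass_curve X \<A> P r e m \<rho> f\<^sub>X i_s i_r x y \<longleftrightarrow>
     (let H = weierstrass_semigroup X \<A> P; R = coordinate_ring X \<A> P;
          s = \<rho> 2; S = {e i | i. 1 \<le> i \<and> i < r \<and> coprime (e i) r} in
      compact_riemann_surface X \<A> \<and> P \<in> topspace X \<and>
      r \<in> H \<and> 0 < r \<and> (\<forall>n\<in>H. 0 < n \<longrightarrow> r \<le> n) \<and>
      standard_basis H r e \<and>
      2 \<le> m \<and> inj_on \<rho> {1..m} \<and> minimal_generating_set H (\<rho> ` {1..m}) \<and>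
      \<rho> 1 = r \<and> s \<in> S \<and> (\<forall>n\<in>S. s \<le> n) \<and>
      irreducible f\<^sub>X \<and> degree f\<^sub>X = r \<and> lead_coeff f\<^sub>X = 1 \<and>
      (\<forall>i\<in>{1..r}. r * degree (coeff f\<^sub>X (r - i)) \<le> i * s) \<and>
      coeff (coeff f\<^sub>X 0) s = -1 \<and>
      normalization_map (affine_part X P) x (y 2) f\<^sub>X \<and>
      x \<in> carrier R \<and> wt \<A> P x = - int r \<and>
      (\<forall>j\<in>{2..m}. y j \<in> carrier R \<and> wt \<A> P (y j) = - int (\<rho> j)) \<and>
      0 < i_s \<and> 0 < i_r \<and> i_s * s = i_r * r + 1 \<and>
      (\<forall>j\<in>{2..m}. ((\<lambda>p. y j p * (x p ^ i_r / y 2 p ^ i_s) ^ \<rho> j) \<longlongrightarrow> 1) (atin X P)))"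

definition poly_in_x ::
  "'p topology \<Rightarrow> 'p \<Rightarrow> ('p \<Rightarrow> complex) \<Rightarrow> complex poly \<Rightarrow> ('p \<Rightarrow> complex)" where
  "poly_in_x X P x q = (\<lambda>p\<in>affine_part X P. poly q (x p))"

definition y_monomial ::
  "'p topology \<Rightarrow> 'p \<Rightarrow> nat \<Rightarrow> (nat \<Rightarrow> 'p \<Rightarrow> complex) \<Rightarrow> (nat \<Rightarrow> nat) \<Rightarrow> ('p \<Rightarrow> complex)" where
  "y_monomial X P m y \<alpha> = (\<lambda>p\<in>affine_part X P. \<Prod>j=2..m. y j p ^ \<alpha> j)"

text \<open>\<open>g\<close> consists of terms of \<open>-wt\<close> less than \<open>n\<close>.\<close>

definition lower_weight ::
  "'p topology \<Rightarrow> 'p atlas \<Rightarrow> 'p \<Rightarrow> int \<Rightarrow> ('p \<Rightarrow> complex) \<Rightarrow> bool" where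
  "lower_weight X \<A> P n g \<longleftrightarrow>
     g \<in> carrier (coordinate_ring X \<A> P) \<and>
     (g = \<zero>\<^bsub>coordinate_ring X \<A> P\<^esub> \<or> - wt \<A> P g < n)"

section \<open>The tensor product of a commutative ring with itself over a subring\<close>

text \<open>For a commutative ring \<open>A\<close> and a subring with carrier \<open>K\<close>: the free abelian group on
  \<open>A \<times> A\<close> modulo the subgroup generated by the biadditivity and \<open>K\<close>-balancedness relations.\<close>

definition tensor_relations :: "('a, 'b) ring_scheme \<Rightarrow> 'a set \<Rightarrow> ('a \<times> 'a \<Rightarrow>\<^sub>0 int) set" where
  "tensor_relations A K =
     {frag_of (a \<oplus>\<^bsub>A\<^esub> a', b) - frag_of (a, b) - frag_of (a', b) | a a' b.
        a \<in> carrier A \<and> a' \<in> carrier A \<and> b \<in> carrier A} \<union>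
     {frag_of (a, b \<oplus>\<^bsub>A\<^esub> b') - frag_of (a, b) - frag_of (a, b') | a b b'.
        a \<in> carrier A \<and> b \<in> carrier A \<and> b' \<in> carrier A} \<union>
     {frag_of (k \<otimes>\<^bsub>A\<^esub> a, b) - frag_of (a, k \<otimes>\<^bsub>A\<^esub> b) | k a b.
        k \<in> K \<and> a \<in> carrier A \<and> b \<in> carrier A}"

definition pairs_group :: "('a, 'b) ring_scheme \<Rightarrow> ('a \<times> 'a \<Rightarrow>\<^sub>0 int) monoid" where
  "pairs_group A = free_Abelian_group (carrier A \<times> carrier A)"

definition tensor_null :: "('a, 'b) ring_scheme \<Rightarrow> 'a set \<Rightarrow> ('a \<times> 'a \<Rightarrow>\<^sub>0 int) set" where
  "tensor_null A K = generate (pairs_group A) (tensor_relations A K)"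

definition pairs_mult ::
  "('a, 'b) ring_scheme \<Rightarrow> ('a \<times> 'a \<Rightarrow>\<^sub>0 int) \<Rightarrow> ('a \<times> 'a \<Rightarrow>\<^sub>0 int) \<Rightarrow> ('a \<times> 'a \<Rightarrow>\<^sub>0 int)" where
  "pairs_mult A u v =
     frag_extend (\<lambda>(a, b). frag_extend (\<lambda>(c, d). frag_of (a \<otimes>\<^bsub>A\<^esub> c, b \<otimes>\<^bsub>A\<^esub> d)) v) u"

definition pure_tensor ::
  "('a, 'b) ring_scheme \<Rightarrow> 'a set \<Rightarrow> 'a \<Rightarrow> 'a \<Rightarrow> ('a \<times> 'a \<Rightarrow>\<^sub>0 int) set" where
  "pure_tensor A K a b = tensor_null A K #>\<^bsub>pairs_group A\<^esub> frag_of (a, b)"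

definition tensor_square :: "('a, 'b) ring_scheme \<Rightarrow> 'a set \<Rightarrow> ('a \<times> 'a \<Rightarrow>\<^sub>0 int) set ring" where
  "tensor_square A K =
     (let G = pairs_group A; N = tensor_null A K in
      \<lparr>carrier = carrier (G Mod N),
       monoid.mult = (\<lambda>U V. \<Union>u\<in>U. \<Union>v\<in>V. N #>\<^bsub>G\<^esub> pairs_mult A u v),
       one = pure_tensor A K \<one>\<^bsub>A\<^esub> \<one>\<^bsub>A\<^esub>,
       zero = \<one>\<^bsub>G Mod N\<^esub>,
       add = (\<otimes>\<^bsub>G Mod N\<^esub>)\<rparr>)"

text \<open>The map \<open>a \<otimes> b \<mapsto> a b\<close>, i.e. restriction to the diagonal. The value on a coset is computed
  on any of its elements.\<close>

definition tensor_diagonal :: "('a, 'b) ring_scheme \<Rightarrow> ('a \<times> 'a \<Rightarrow>\<^sub>0 int) set \<Rightarrow> 'a" where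
  "tensor_diagonal A U =
     the_elem ((\<lambda>u. \<Oplus>\<^bsub>A\<^esub>c\<in>Poly_Mapping.keys u.
                       [Poly_Mapping.lookup u c] \<cdot>\<^bsub>A\<^esub> (fst c \<otimes>\<^bsub>A\<^esub> snd c)) ` U)"

definition regular_element :: "('a, 'b) ring_scheme \<Rightarrow> 'a \<Rightarrow> bool" where
  "regular_element A a \<longleftrightarrow> a \<in> carrier A \<and>
     (\<forall>c\<in>carrier A. a \<otimes>\<^bsub>A\<^esub> c = \<zero>\<^bsub>A\<^esub> \<longrightarrow> c = \<zero>\<^bsub>A\<^esub>)"

text \<open>\<open>a / b = c / d\<close> in the total quotient ring of \<open>A\<close>\<close>

definition total_quotient_eq :: "('a, 'b) ring_scheme \<Rightarrow> 'a \<Rightarrow> 'a \<Rightarrow> 'a \<Rightarrow> 'a \<Rightarrow> bool" where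
  "total_quotient_eq A a b c d \<longleftrightarrow>
     a \<in> carrier A \<and> c \<in> carrier A \<and> regular_element A b \<and> regular_element A d \<and>
     a \<otimes>\<^bsub>A\<^esub> d = c \<otimes>\<^bsub>A\<^esub> b"

section \<open>The element \<open>\<tilde>h\<close> of \<open>R\<^sub>X \<otimes> R\<^sub>X\<close>\<close>

definition base_ring :: "'p topology \<Rightarrow> 'p \<Rightarrow> ('p \<Rightarrow> complex) \<Rightarrow> ('p \<Rightarrow> complex) set" where
  "base_ring X P x = range (poly_in_x X P x)"

definition curve_tensor ::
  "'p topology \<Rightarrow> 'p atlas \<Rightarrow> 'p \<Rightarrow> ('p \<Rightarrow> complex) \<Rightarrow>
   (('p \<Rightarrow> complex) \<times> ('p \<Rightarrow> complex) \<Rightarrow>\<^sub>0 int) set ring" where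
  "curve_tensor X \<A> P x = tensor_square (coordinate_ring X \<A> P) (base_ring X P x)"

definition curve_pure ::
  "'p topology \<Rightarrow> 'p atlas \<Rightarrow> 'p \<Rightarrow> ('p \<Rightarrow> complex) \<Rightarrow> ('p \<Rightarrow> complex) \<Rightarrow> ('p \<Rightarrow> complex) \<Rightarrow>
   (('p \<Rightarrow> complex) \<times> ('p \<Rightarrow> complex) \<Rightarrow>\<^sub>0 int) set" where
  "curve_pure X \<A> P x = pure_tensor (coordinate_ring X \<A> P) (base_ring X P x)"

text \<open>\<open>(F(x, y) - F(x, y')) / (y - y')\<close>, using
  \<open>(y ^ k - y' ^ k) / (y - y') = (\<Sum>i<k. y ^ i * y' ^ (k - 1 - i))\<close>\<close>

definition divided_difference ::
  "'p topology \<Rightarrow> 'p atlas \<Rightarrow> 'p \<Rightarrow> ('p \<Rightarrow> complex) \<Rightarrow> complex poly poly \<Rightarrow> ('p \<Rightarrow> complex) \<Rightarrow>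
   (('p \<Rightarrow> complex) \<times> ('p \<Rightarrow> complex) \<Rightarrow>\<^sub>0 int) set" where
  "divided_difference X \<A> P x F y =
     (\<Oplus>\<^bsub>curve_tensor X \<A> P x\<^esub>k\<in>{..degree F}. \<Oplus>\<^bsub>curve_tensor X \<A> P x\<^esub>i\<in>{..<k}.
        curve_pure X \<A> P x (\<lambda>p\<in>affine_part X P. poly (coeff F k) (x p) * y p ^ i)
                           (\<lambda>p\<in>affine_part X P. y p ^ (k - 1 - i)))"

definition y_derivative ::
  "'p topology \<Rightarrow> 'p \<Rightarrow> ('p \<Rightarrow> complex) \<Rightarrow> complex poly poly \<Rightarrow> ('p \<Rightarrow> complex) \<Rightarrow>
   ('p \<Rightarrow> complex)" where
  "y_derivative X P x F y = (\<lambda>p\<in>affine_part X P. eval2 (pderiv F) (x p) (y p))"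

text \<open>\<open>F j\<close> is \<open>f\<^sub>X\<^sup>(\<^sup>j\<^sup>)\<close>.\<close>

definition minimal_equations ::
  "'p topology \<Rightarrow> 'p \<Rightarrow> nat \<Rightarrow> ('p \<Rightarrow> complex) \<Rightarrow> (nat \<Rightarrow> 'p \<Rightarrow> complex) \<Rightarrow>
   (nat \<Rightarrow> complex poly poly) \<Rightarrow> bool" where
  "minimal_equations X P m x y F \<longleftrightarrow>
     (\<forall>j\<in>{2..m}. irreducible (F j) \<and> lead_coeff (F j) = 1 \<and>
        (\<forall>p\<in>affine_part X P. eval2 (F j) (x p) (y j p) = 0))"

text \<open>The elements of the tensor product of weight less than \<open>n\<close>, both factors being weighted.\<close>

definition tensor_lower_weight ::
  "'p topology \<Rightarrow> 'p atlas \<Rightarrow> 'p \<Rightarrow> ('p \<Rightarrow> complex) \<Rightarrow> int \<Rightarrow>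
   (('p \<Rightarrow> complex) \<times> ('p \<Rightarrow> complex) \<Rightarrow>\<^sub>0 int) set \<Rightarrow> bool" where
  "tensor_lower_weight X \<A> P x n t \<longleftrightarrow>
     (let R = coordinate_ring X \<A> P; T = curve_tensor X \<A> P x in
      \<exists>N f g. (\<forall>k<N. f k \<in> carrier R - {\<zero>\<^bsub>R\<^esub>} \<and> g k \<in> carrier R - {\<zero>\<^bsub>R\<^esub>} \<and>
                     - wt \<A> P (f k) - wt \<A> P (g k) < n) \<and>
              t = (\<Oplus>\<^bsub>T\<^esub>k\<in>{..<N::nat}. curve_pure X \<A> P x (f k) (g k)))"

text \<open>The leading homogeneous part of \<open>t\<close> has weight \<open>d\<close> and is
  \<open>\<Sum>k<N. c k * x ^ a k * y ^ \<alpha> k * y' ^ \<beta> k\<close> (multi-indices \<open>\<alpha> k\<close>, \<open>\<beta> k\<close>), whose image under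
  \<open>x \<mapsto> z ^ r = z' ^ r\<close>, \<open>y j \<mapsto> z ^ \<rho> j\<close>, \<open>y' j \<mapsto> z' ^ \<rho> j\<close> is \<open>\<Phi>\<close>. Polynomials in \<open>z, z'\<close> have
  \<open>z'\<close> as outer and \<open>z\<close> as inner variable and are compared modulo \<open>z' ^ r - z ^ r\<close>.\<close>

definition has_leading_part ::
  "'p topology \<Rightarrow> 'p atlas \<Rightarrow> 'p \<Rightarrow> nat \<Rightarrow> nat \<Rightarrow> (nat \<Rightarrow> nat) \<Rightarrow> ('p \<Rightarrow> complex) \<Rightarrow>
   (nat \<Rightarrow> 'p \<Rightarrow> complex) \<Rightarrow> (('p \<Rightarrow> complex) \<times> ('p \<Rightarrow> complex) \<Rightarrow>\<^sub>0 int) set \<Rightarrow> nat \<Rightarrow>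
   complex poly poly \<Rightarrow> bool" where
  "has_leading_part X \<A> P r m \<rho> x y t d \<Phi> \<longleftrightarrow>
     (let R = coordinate_ring X \<A> P; T = curve_tensor X \<A> P x in
      \<exists>(N::nat) c a \<alpha> \<beta>.
        (\<forall>k<N. r * a k + (\<Sum>j=2..m. \<alpha> k j * \<rho> j) + (\<Sum>j=2..m. \<beta> k j * \<rho> j) = d) \<and>
        tensor_lower_weight X \<A> P x (int d)
          (t \<ominus>\<^bsub>T\<^esub> (\<Oplus>\<^bsub>T\<^esub>k\<in>{..<N}.
             curve_pure X \<A> P x
               (poly_in_x X P x (monom (c k) (a k)) \<otimes>\<^bsub>R\<^esub> y_monomial X P m y (\<alpha> k))
               (y_monomial X P m y (\<beta> k)))) \<and>
        (monom 1 r - [:monom 1 r:]) dvd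
          ((\<Sum>k<N. monom (monom (c k) (r * a k + (\<Sum>j=2..m. \<alpha> k j * \<rho> j)))
                         (\<Sum>j=2..m. \<beta> k j * \<rho> j)) - \<Phi>))"

definition is_h_tilde ::
  "'p topology \<Rightarrow> 'p atlas \<Rightarrow> 'p \<Rightarrow> nat \<Rightarrow> (nat \<Rightarrow> nat) \<Rightarrow> nat \<Rightarrow> (nat \<Rightarrow> nat) \<Rightarrow>
   ('p \<Rightarrow> complex) \<Rightarrow> (nat \<Rightarrow> 'p \<Rightarrow> complex) \<Rightarrow> (nat \<Rightarrow> complex poly poly) \<Rightarrow> nat \<Rightarrow>
   (('p \<Rightarrow> complex) \<times> ('p \<Rightarrow> complex) \<Rightarrow>\<^sub>0 int) set \<Rightarrow> bool" where
  "is_h_tilde X \<A> P r e m \<rho> x y F d h \<longleftrightarrow>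
     (let R = coordinate_ring X \<A> P; T = curve_tensor X \<A> P x;
          h\<^sub>\<Delta> = curve_pure X \<A> P x (tensor_diagonal R h) \<one>\<^bsub>R\<^esub> in
      h \<in> carrier T \<and>
      isgcd T \<one>\<^bsub>T\<^esub> h\<^sub>\<Delta> h \<and>
      total_quotient_eq T h h\<^sub>\<Delta>
        (\<Otimes>\<^bsub>T\<^esub>j\<in>{2..m}. divided_difference X \<A> P x (F j) (y j))
        (\<Otimes>\<^bsub>T\<^esub>j\<in>{2..m}. curve_pure X \<A> P x (y_derivative X P x (F j) (y j)) \<one>\<^bsub>R\<^esub>) \<and>
      (\<forall>i<r. e i \<le> d \<and> d - e i \<in> weierstrass_semigroup X \<A> P) \<and>
      has_leading_part X \<A> P r m \<rho> x y h d (\<Sum>i<r. monom (monom 1 (d - e i)) (e i)))"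

end

theory Submission
  imports Defs "HOL-Algebra.QuotRing"
begin

text \<open>
  Three facts carry the proof. Write \<open>R\<close> for the ring of functions with poles only at \<open>P\<close>, and call
  the limit of \<open>f * t ^ n\<close> at \<open>P\<close> the leading coefficient of \<open>f\<close> at pole order \<open>n\<close>, where
  \<open>t = x ^ i_r / y 2 ^ i_s\<close>.

  \<^bold>\<open>Weights are limits.\<close> A function in \<open>R\<close> that tends to \<open>0\<close> at \<open>P\<close> is zero, by the maximum
  principle on the compact connected surface. So every nonzero element of \<open>R\<close> has a pole order
  \<open>n \<ge> 0\<close> and a nonzero leading coefficient, and lower weight means a vanishing limit. The functions
  \<open>y j\<close> have leading coefficient \<open>1\<close> by assumption. For \<open>x\<close> this has to be proved: comparing leading
  terms in \<open>f\<^sub>X (x, y) = 0\<close> shows that its leading coefficient \<open>\<mu>\<close> satisfies \<open>\<mu> ^ s = 1\<close>, the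
  definition of \<open>t\<close> gives \<open>\<mu> ^ i_r = 1\<close>, and \<open>i_s * s - i_r * r = 1\<close> leaves \<open>\<mu> = 1\<close>
  (\<open>lead_x\<close>).

  \<^bold>\<open>Expansion in the second factor.\<close> The pole orders \<open>e i\<close> of the basis functions \<open>\<yy> i\<close> represent
  the residue classes modulo \<open>r\<close>, so subtracting multiples of \<open>x ^ k * \<yy> i\<close> lowers the pole order
  step by step, and \<open>R\<close> is spanned by the \<open>\<yy> i\<close> over the polynomials in \<open>x\<close>, without cancellation of
  pole orders (\<open>basis_expansion\<close>). Expanding the second tensor factors of \<open>h\<close> and moving the
  coefficients to the first factor gives \<open>h = \<Sum>i. \<Upsilon> i \<otimes> \<yy> i\<close>. Terms of \<open>h\<close> below weight \<open>d\<close>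
  contribute to \<open>\<Upsilon> i\<close> only below \<open>d - e i\<close>; a monomial \<open>c * x ^ a * y ^ \<alpha> \<otimes> y ^ \<beta>\<close> of weight \<open>d\<close>
  contributes \<open>c\<close> to the leading coefficient of the one \<open>\<Upsilon> i\<close> for which \<open>e i\<close> is congruent to the
  weight of \<open>y ^ \<beta>\<close>. That the leading part of \<open>h\<close> is \<open>\<Sum>i. z ^ (d - e i) * z' ^ e i\<close> modulo
  \<open>z' ^ r - z ^ r\<close> says that these contributions add up to \<open>1\<close> (\<open>leading_class_sums\<close>). So \<open>\<Upsilon> i\<close> has
  the same leading term as \<open>x ^ \<delta> i * \<yy> (star i)\<close>.

  \<^bold>\<open>Symmetry.\<close> The second expansion of \<open>h\<close> is the image of the first under exchange of the tensor
  factors, so the claim is that \<open>h\<close> is symmetric. Let \<open>q\<close> be the product of the divided differences.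
  Since \<open>y j\<close> is a root of \<open>F j\<close>, the \<open>j\<close>-th divided difference annihilates
  \<open>y j \<otimes> 1 - 1 \<otimes> y j\<close>; hence \<open>q\<close> annihilates \<open>u \<otimes> 1 - 1 \<otimes> u\<close> for all \<open>u\<close> in \<open>R\<close>: it lives on the
  diagonal. The defining equation \<open>h * (D \<otimes> 1) = q * (a \<otimes> 1)\<close>, where \<open>a\<close> is the restriction of \<open>h\<close> to
  the diagonal, and its mirror image therefore have the same right-hand side, and the regular
  elements \<open>D \<otimes> 1\<close> and \<open>1 \<otimes> D\<close> can be cancelled (\<open>casimir_symmetric\<close>).
\<close>

section \<open>The tensor square as a quotient ring\<close>

text \<open>The integral monoid ring of the multiplicative monoid \<open>A \<times> A\<close>. Its quotient by the ideal \<open>tensor_null A K\<close> is the tensor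
  square, which makes the ring laws of the latter available.\<close>

definition pairs_ring :: "('a, 'b) ring_scheme \<Rightarrow> ('a \<times> 'a \<Rightarrow>\<^sub>0 int) ring" where
  "pairs_ring A =
     \<lparr>carrier = carrier (pairs_group A), monoid.mult = pairs_mult A,
      one = frag_of (\<one>\<^bsub>A\<^esub>, \<one>\<^bsub>A\<^esub>), zero = 0, add = (+)\<rparr>"

definition pairs_swap :: "('a \<times> 'a \<Rightarrow>\<^sub>0 int) \<Rightarrow> ('a \<times> 'a \<Rightarrow>\<^sub>0 int)" where
  "pairs_swap = frag_extend (\<lambda>(a, b). frag_of (b, a))"

definition tensor_swap :: "('a \<times> 'a \<Rightarrow>\<^sub>0 int) set \<Rightarrow> ('a \<times> 'a \<Rightarrow>\<^sub>0 int) set" where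
  "tensor_swap U = pairs_swap ` U"

text \<open>Multiplying a balancedness relation over \<open>K\<close> by a pure tensor gives another such relation. So the
  relations span an ideal for any subset \<open>K\<close> of \<open>A\<close>, and the theory is developed at this generality.\<close>

locale subset_algebra = cring A for A (structure) + fixes K
  assumes K_subset: "K \<subseteq> carrier A"
begin

abbreviation "Z \<equiv> pairs_ring A"
abbreviation "N \<equiv> tensor_null A K"
abbreviation "T \<equiv> tensor_square A K"
abbreviation pure (infixl "\<odot>" 75) where "a \<odot> b \<equiv> pure_tensor A K a b"

lemma carrier_pairs: "carrier Z = {u. Poly_Mapping.keys u \<subseteq> carrier A \<times> carrier A}"
  by (auto simp: pairs_ring_def pairs_group_def)

lemma pairs_mult_of: "pairs_mult A (frag_of (a, b)) (frag_of (c, d)) = frag_of (a \<otimes> c, b \<otimes> d)"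
  by (simp add: pairs_mult_def)

lemma pairs_mult_diff_left: "pairs_mult A (u - u') v = pairs_mult A u v - pairs_mult A u' v"
  by (simp add: pairs_mult_def frag_extend_diff)

lemma pairs_mult_0_left: "pairs_mult A 0 v = 0"
  by (simp add: pairs_mult_def)

lemma pairs_mult_diff_right: "pairs_mult A u (v - v') = pairs_mult A u v - pairs_mult A u v'"
proof -
  have "Poly_Mapping.keys u \<subseteq> UNIV" by simp
  then show ?thesis
  proof (induction u rule: frag_induction)
    case zero then show ?case by (simp add: pairs_mult_0_left)
  next
    case (one z) then show ?case by (cases z) (simp add: pairs_mult_def frag_extend_diff)
  next
    case (diff a b) then show ?case by (simp add: pairs_mult_diff_left)
  qed
qed

lemma pairs_mult_0_right: "pairs_mult A u 0 = 0"
  using pairs_mult_diff_right[of u 0 0] by simp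

lemma pairs_mult_add_left: "pairs_mult A (u + u') v = pairs_mult A u v + pairs_mult A u' v"
  by (simp add: pairs_mult_def frag_extend_add)

lemma keys_diff_subset:
  "Poly_Mapping.keys u \<subseteq> S \<Longrightarrow> Poly_Mapping.keys v \<subseteq> S \<Longrightarrow>
     Poly_Mapping.keys (u - v :: 'c \<Rightarrow>\<^sub>0 int) \<subseteq> S"
  using keys_diff[of u v] by blast

lemma pairs_carrier_induct [consumes 1, case_names zero one diff]:
  assumes "u \<in> carrier Z" and "Q 0"
    and "\<And>a b. a \<in> carrier A \<Longrightarrow> b \<in> carrier A \<Longrightarrow> Q (frag_of (a, b))"
    and "\<And>u v. u \<in> carrier Z \<Longrightarrow> v \<in> carrier Z \<Longrightarrow> Q u \<Longrightarrow> Q v \<Longrightarrow> Q (u - v)"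
  shows "Q u"
proof -
  have "Poly_Mapping.keys u \<subseteq> carrier A \<times> carrier A" using assms(1) by (simp add: carrier_pairs)
  then have "u \<in> carrier Z \<and> Q u"
    by (induction u rule: frag_induction)
      (use assms(2-4) in \<open>auto simp: carrier_pairs keys_frag_of dest: keys_diff_subset\<close>)
  then show ?thesis ..
qed

lemma pairs_mult_closed:
  assumes "u \<in> carrier Z" "v \<in> carrier Z" shows "pairs_mult A u v \<in> carrier Z"
  using assms(1)
proof (induction u rule: pairs_carrier_induct)
  case zero then show ?case by (simp add: pairs_mult_0_left carrier_pairs)
next
  case (one a b)
  from assms(2) show ?case
  proof (induction v rule: pairs_carrier_induct)
    case zero then show ?case by (simp add: pairs_mult_0_right carrier_pairs)
  next
    case (one c d)
    then show ?case using \<open>a \<in> carrier A\<close> \<open>b \<in> carrier A\<close>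
      by (simp add: pairs_mult_of carrier_pairs keys_frag_of)
  next
    case (diff u v)
    then show ?case by (simp add: pairs_mult_diff_right carrier_pairs keys_diff_subset)
  qed
next
  case (diff u v)
  then show ?case by (simp add: pairs_mult_diff_left carrier_pairs keys_diff_subset)
qed

lemma pairs_mult_commute:
  assumes "u \<in> carrier Z" "v \<in> carrier Z" shows "pairs_mult A u v = pairs_mult A v u"
  using assms(1)
proof (induction u rule: pairs_carrier_induct)
  case zero then show ?case by (simp add: pairs_mult_0_left pairs_mult_0_right)
next
  case (one a b)
  from assms(2) show ?case
    by (induction v rule: pairs_carrier_induct)
      (simp_all add: pairs_mult_0_left pairs_mult_0_right pairs_mult_diff_left pairs_mult_diff_right
        pairs_mult_of m_comm one)
next
  case (diff u v)
  then show ?case by (simp add: pairs_mult_diff_left pairs_mult_diff_right)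
qed

lemma pairs_mult_assoc:
  assumes "u \<in> carrier Z" "v \<in> carrier Z" "w \<in> carrier Z"
  shows "pairs_mult A (pairs_mult A u v) w = pairs_mult A u (pairs_mult A v w)"
  using assms(1)
proof (induction u rule: pairs_carrier_induct)
  case zero then show ?case by (simp add: pairs_mult_0_left)
next
  case (one a b)
  note ab = this
  from assms(2) show ?case
  proof (induction v rule: pairs_carrier_induct)
    case zero then show ?case by (simp add: pairs_mult_0_left pairs_mult_0_right)
  next
    case (one c d)
    from assms(3) show ?case
      by (induction w rule: pairs_carrier_induct)
        (simp_all add: pairs_mult_0_right pairs_mult_diff_right pairs_mult_of m_assoc one ab)
  next
    case (diff u v)
    then show ?case by (simp add: pairs_mult_diff_left pairs_mult_diff_right)
  qed
next
  case (diff u v)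
  then show ?case by (simp add: pairs_mult_diff_left)
qed

lemma pairs_one_mult:
  assumes "u \<in> carrier Z" shows "pairs_mult A (frag_of (\<one>, \<one>)) u = u"
  using assms
  by (induction u rule: pairs_carrier_induct)
    (simp_all add: pairs_mult_0_right pairs_mult_diff_right pairs_mult_of)

lemma cring_pairs_ring: "cring Z"
proof (rule cringI)
  show "abelian_group Z"
  proof (rule abelian_groupI)
    show "\<exists>v\<in>carrier Z. v \<oplus>\<^bsub>Z\<^esub> u = \<zero>\<^bsub>Z\<^esub>" if "u \<in> carrier Z" for u
      using that by (intro bexI[of _ "- u"]) (simp_all add: carrier_pairs, simp add: pairs_ring_def)
  qed (use keys_add in \<open>fastforce simp: carrier_pairs pairs_ring_def pairs_group_def\<close>)+
  have one: "\<one>\<^bsub>Z\<^esub> = frag_of (\<one>, \<one>)" and mult: "\<And>u v. u \<otimes>\<^bsub>Z\<^esub> v = pairs_mult A u v"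
    by (simp_all add: pairs_ring_def)
  show "Group.comm_monoid Z"
    by (rule comm_monoidI)
      (simp_all add: one mult pairs_mult_closed pairs_mult_assoc pairs_one_mult,
        simp add: carrier_pairs keys_frag_of, rule pairs_mult_commute)
  show "(u \<oplus>\<^bsub>Z\<^esub> v) \<otimes>\<^bsub>Z\<^esub> w = u \<otimes>\<^bsub>Z\<^esub> w \<oplus>\<^bsub>Z\<^esub> v \<otimes>\<^bsub>Z\<^esub> w"
    if "u \<in> carrier Z" "v \<in> carrier Z" "w \<in> carrier Z" for u v w
    using that by (simp add: pairs_ring_def pairs_mult_add_left)
qed

lemma frag_of_carrier: "frag_of (a, b) \<in> carrier Z \<longleftrightarrow> a \<in> carrier A \<and> b \<in> carrier A"
  by (simp add: carrier_pairs keys_frag_of)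

lemma carrier_pairs_diff: "u \<in> carrier Z \<Longrightarrow> v \<in> carrier Z \<Longrightarrow> u - v \<in> carrier Z"
  by (simp add: carrier_pairs keys_diff_subset)

lemma tensor_relations_subset: "tensor_relations A K \<subseteq> carrier Z"
  using K_subset
  by (auto simp: tensor_relations_def frag_of_carrier carrier_pairs_diff)

lemma group_pairs_group: "group (pairs_group A)"
  by (simp add: pairs_group_def)

lemma tensor_relations_subset': "tensor_relations A K \<subseteq> carrier (pairs_group A)"
  using tensor_relations_subset by (simp add: pairs_ring_def)

lemma null_subgroup: "subgroup N (pairs_group A)"
  unfolding tensor_null_def
  by (rule group.generate_is_subgroup[OF group_pairs_group tensor_relations_subset'])

lemma null_subset: "N \<subseteq> carrier Z"
  using subgroup.subset[OF null_subgroup] by (simp add: pairs_ring_def)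

lemma null_zero: "0 \<in> N"
  using subgroup.one_closed[OF null_subgroup] by (simp add: pairs_group_def)

lemma null_uminus: "u \<in> N \<Longrightarrow> - u \<in> N"
  using subgroup.m_inv_closed[OF null_subgroup] null_subset
  by (fastforce simp: pairs_group_def carrier_pairs)

lemma null_add: "u \<in> N \<Longrightarrow> v \<in> N \<Longrightarrow> u + v \<in> N"
  using subgroup.m_closed[OF null_subgroup] by (simp add: pairs_group_def)

lemma null_diff: "u \<in> N \<Longrightarrow> v \<in> N \<Longrightarrow> u - v \<in> N"
  using null_add[OF _ null_uminus] by fastforce

lemma null_relation: "u \<in> tensor_relations A K \<Longrightarrow> u \<in> N"
  unfolding tensor_null_def by (rule generate.incl)

text \<open>A subgroup that is generated by a set can be reached from \<open>0\<close> and the generators by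
  subtraction alone.\<close>

lemma null_induct [consumes 1, case_names zero relation diff]:
  assumes "u \<in> N" and "Q 0" and "\<And>u. u \<in> tensor_relations A K \<Longrightarrow> Q u"
    and diff: "\<And>u v. Q u \<Longrightarrow> Q v \<Longrightarrow> Q (u - v)"
  shows "Q u"
  using assms(1) unfolding tensor_null_def
proof (induction u rule: generate.induct)
  case one then show ?case using assms(2) by (simp add: pairs_group_def)
next
  case (incl u) then show ?case by (rule assms(3))
next
  case (inv u)
  then have "inv\<^bsub>pairs_group A\<^esub> u = 0 - u"
    using tensor_relations_subset by (auto simp: pairs_group_def carrier_pairs)
  then show ?case using diff[OF assms(2) assms(3)[OF inv]] by simp
next
  case (eng u v)
  have "Q (u - (0 - v))" using eng by (intro diff assms(2))
  then show ?case by (simp add: pairs_group_def)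
qed

text \<open>Each of the three families of relations is stable under multiplication by a pure tensor. This is
  why the subgroup \<open>N\<close> that they generate is an ideal.\<close>

lemma relation_mult:
  assumes "c \<in> carrier A" "d \<in> carrier A" "n \<in> tensor_relations A K"
  shows "pairs_mult A (frag_of (c, d)) n \<in> tensor_relations A K"
proof -
  from assms(3) consider
      (left) a a' b where "n = frag_of (a \<oplus> a', b) - frag_of (a, b) - frag_of (a', b)"
        "a \<in> carrier A" "a' \<in> carrier A" "b \<in> carrier A"
    | (right) a b b' where "n = frag_of (a, b \<oplus> b') - frag_of (a, b) - frag_of (a, b')"
        "a \<in> carrier A" "b \<in> carrier A" "b' \<in> carrier A"
    | (balanced) k a b where "n = frag_of (k \<otimes> a, b) - frag_of (a, k \<otimes> b)"
        "k \<in> K" "a \<in> carrier A" "b \<in> carrier A"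
    unfolding tensor_relations_def by blast
  then show ?thesis
  proof cases
    case left
    have "pairs_mult A (frag_of (c, d)) n =
        frag_of (c \<otimes> a \<oplus> c \<otimes> a', d \<otimes> b) - frag_of (c \<otimes> a, d \<otimes> b) - frag_of (c \<otimes> a', d \<otimes> b)"
      using left assms by (simp add: pairs_mult_diff_right pairs_mult_of r_distr)
    then show ?thesis using left assms unfolding tensor_relations_def by blast
  next
    case right
    have "pairs_mult A (frag_of (c, d)) n =
        frag_of (c \<otimes> a, d \<otimes> b \<oplus> d \<otimes> b') - frag_of (c \<otimes> a, d \<otimes> b) - frag_of (c \<otimes> a, d \<otimes> b')"
      using right assms by (simp add: pairs_mult_diff_right pairs_mult_of r_distr)
    then show ?thesis using right assms unfolding tensor_relations_def by blast
  next
    case balanced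
    have "k \<in> carrier A" using balanced K_subset by blast
    then have "pairs_mult A (frag_of (c, d)) n =
        frag_of (k \<otimes> (c \<otimes> a), d \<otimes> b) - frag_of (c \<otimes> a, k \<otimes> (d \<otimes> b))"
      using balanced assms by (simp add: pairs_mult_diff_right pairs_mult_of m_lcomm)
    then show ?thesis using balanced assms unfolding tensor_relations_def by blast
  qed
qed

lemma null_ideal_left:
  assumes "u \<in> carrier Z" "n \<in> N" shows "pairs_mult A u n \<in> N"
  using assms(2)
proof (induction n rule: null_induct)
  case zero then show ?case by (simp add: pairs_mult_0_right null_zero)
next
  case (relation n)
  from assms(1) show ?case
    by (induction u rule: pairs_carrier_induct)
      (use relation in \<open>auto simp: pairs_mult_0_left null_zero null_relation relation_mult
        pairs_mult_diff_left null_diff\<close>)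
next
  case (diff u v) then show ?case by (simp add: pairs_mult_diff_right null_diff)
qed

lemma null_ideal: "ideal N Z"
proof -
  interpret Z: cring Z by (rule cring_pairs_ring)
  show ?thesis
  proof (rule idealI)
    show "ring Z" by (rule Z.ring_axioms)
    show "subgroup N (add_monoid Z)"
    proof (rule Z.add.subgroupI)
      show "N \<subseteq> carrier Z" by (rule null_subset)
      show "N \<noteq> {}" using null_zero by blast
      fix u assume u: "u \<in> N"
      have "\<ominus>\<^bsub>Z\<^esub> u = - u"
        by (rule Z.minus_equality)
          (use u null_subset null_uminus[OF u] in \<open>auto simp: pairs_ring_def\<close>)
      then show "\<ominus>\<^bsub>Z\<^esub> u \<in> N" using u null_uminus by simp
    next
      fix u v assume "u \<in> N" "v \<in> N"
      then show "u \<oplus>\<^bsub>Z\<^esub> v \<in> N" using null_add by (simp add: pairs_ring_def)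
    qed
    fix n u assume n: "n \<in> N" and u: "u \<in> carrier Z"
    show "u \<otimes>\<^bsub>Z\<^esub> n \<in> N" using null_ideal_left[OF u n] by (simp add: pairs_ring_def)
    then show "n \<otimes>\<^bsub>Z\<^esub> u \<in> N" using Z.m_comm[OF u] n null_subset by auto
  qed
qed

lemma coset_eq: "N #>\<^bsub>pairs_group A\<^esub> u = N +>\<^bsub>Z\<^esub> u"
  by (simp add: r_coset_def a_r_coset_def pairs_group_def pairs_ring_def)

lemma coset_image: "N +>\<^bsub>Z\<^esub> u = (\<lambda>n. n + u) ` N"
  by (auto simp: r_coset_def a_r_coset_def pairs_ring_def)

lemma tensor_square_quotient: "T = Z Quot N"
proof -
  have "rcosets\<^bsub>pairs_group A\<^esub> N = a_rcosets\<^bsub>Z\<^esub> N"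
    by (simp add: RCOSETS_def A_RCOSETS_def r_coset_def pairs_group_def pairs_ring_def)
  moreover have "(<#>\<^bsub>pairs_group A\<^esub>) = (<+>\<^bsub>Z\<^esub>)"
    by (intro ext) (simp add: set_mult_def set_add_def pairs_group_def pairs_ring_def)
  ultimately show ?thesis
    by (simp add: tensor_square_def FactRing_def FactGroup_def Let_def coset_eq pure_tensor_def
        rcoset_mult_def[abs_def]) (simp add: pairs_ring_def)
qed

lemma cring_tensor_square: "cring T"
  unfolding tensor_square_quotient
  by (rule ideal.quotient_is_cring[OF null_ideal cring_pairs_ring])

lemma pure_coset: "a \<odot> b = N +>\<^bsub>Z\<^esub> frag_of (a, b)"
  by (simp add: pure_tensor_def coset_eq)

lemma carrier_tensor: "carrier T = (\<lambda>u. N +>\<^bsub>Z\<^esub> u) ` carrier Z"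
  by (auto simp: tensor_square_quotient FactRing_def A_RCOSETS_def RCOSETS_def a_r_coset_def)

lemma coset_add:
  assumes "u \<in> carrier Z" "v \<in> carrier Z"
  shows "(N +>\<^bsub>Z\<^esub> u) \<oplus>\<^bsub>T\<^esub> (N +>\<^bsub>Z\<^esub> v) = N +>\<^bsub>Z\<^esub> (u + v)"
proof -
  interpret I: ideal N Z by (rule null_ideal)
  show ?thesis using I.a_rcos_sum[OF assms]
    by (simp add: tensor_square_quotient FactRing_def) (simp add: pairs_ring_def)
qed

lemma coset_mult:
  assumes "u \<in> carrier Z" "v \<in> carrier Z"
  shows "(N +>\<^bsub>Z\<^esub> u) \<otimes>\<^bsub>T\<^esub> (N +>\<^bsub>Z\<^esub> v) = N +>\<^bsub>Z\<^esub> (pairs_mult A u v)"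
proof -
  interpret I: ideal N Z by (rule null_ideal)
  show ?thesis using I.rcoset_mult_add[OF assms]
    by (simp add: tensor_square_quotient FactRing_def) (simp add: pairs_ring_def)
qed

lemma coset_eqI:
  assumes "u \<in> carrier Z" "v \<in> carrier Z" "u - v \<in> N"
  shows "N +>\<^bsub>Z\<^esub> u = N +>\<^bsub>Z\<^esub> v"
proof -
  have "n + u \<in> (\<lambda>n. n + v) ` N" if "n \<in> N" for n
    using null_add[OF that assms(3)] by (intro image_eqI[of _ _ "n + (u - v)"]) simp_all
  moreover have "n + v \<in> (\<lambda>n. n + u) ` N" if "n \<in> N" for n
    using null_diff[OF that assms(3)] by (intro image_eqI[of _ _ "n - (u - v)"]) simp_all
  ultimately show ?thesis unfolding coset_image by auto
qed

lemma carrier_pairs_add: "u \<in> carrier Z \<Longrightarrow> v \<in> carrier Z \<Longrightarrow> u + v \<in> carrier Z"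
  using keys_add[of u v] by (auto simp: carrier_pairs)

lemma pure_closed [simp, intro]: "a \<in> carrier A \<Longrightarrow> b \<in> carrier A \<Longrightarrow> a \<odot> b \<in> carrier T"
  by (auto simp: pure_coset carrier_tensor frag_of_carrier)

text \<open>A coset lies in the free group on \<open>carrier A \<times> carrier A\<close> as soon as one of its elements does,
  so membership of a pure tensor gives back membership of its factors. This yields
  that the diagonal restriction of \<open>h\<close> lies in \<open>R\<close> without examining \<open>tensor_diagonal\<close>.\<close>

lemma pure_closed_left:
  assumes "a \<odot> b \<in> carrier T" shows "a \<in> carrier A"
proof -
  from assms obtain u where u: "u \<in> carrier Z" "N +>\<^bsub>Z\<^esub> frag_of (a, b) = N +>\<^bsub>Z\<^esub> u"
    by (auto simp: pure_coset carrier_tensor)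
  have "0 + frag_of (a, b) \<in> N +>\<^bsub>Z\<^esub> frag_of (a, b)"
    unfolding coset_image using null_zero by blast
  from this[unfolded u(2)] obtain n where n: "n \<in> N" "frag_of (a, b) = n + u"
    by (auto simp: coset_image)
  then have "frag_of (a, b) \<in> carrier Z"
    using null_subset u(1) carrier_pairs_add by auto
  then show ?thesis by (simp add: frag_of_carrier)
qed

lemma pure_add_left:
  assumes "a \<in> carrier A" "a' \<in> carrier A" "b \<in> carrier A"
  shows "(a \<oplus> a') \<odot> b = a \<odot> b \<oplus>\<^bsub>T\<^esub> a' \<odot> b"
proof -
  have "frag_of (a \<oplus> a', b) - frag_of (a, b) - frag_of (a', b) \<in> N"
    using assms by (intro null_relation) (auto simp: tensor_relations_def)
  then have "frag_of (a \<oplus> a', b) - (frag_of (a, b) + frag_of (a', b)) \<in> N"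
    by (simp add: algebra_simps)
  then show ?thesis using assms
    by (simp add: pure_coset coset_add frag_of_carrier coset_eqI carrier_pairs_add)
qed

lemma pure_add_right:
  assumes "a \<in> carrier A" "b \<in> carrier A" "b' \<in> carrier A"
  shows "a \<odot> (b \<oplus> b') = a \<odot> b \<oplus>\<^bsub>T\<^esub> a \<odot> b'"
proof -
  have "frag_of (a, b \<oplus> b') - frag_of (a, b) - frag_of (a, b') \<in> N"
    using assms by (intro null_relation) (auto simp: tensor_relations_def)
  then have "frag_of (a, b \<oplus> b') - (frag_of (a, b) + frag_of (a, b')) \<in> N"
    by (simp add: algebra_simps)
  then show ?thesis using assms
    by (simp add: pure_coset coset_add frag_of_carrier coset_eqI carrier_pairs_add)
qed

lemma pure_balanced:
  assumes "k \<in> K" "a \<in> carrier A" "b \<in> carrier A"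
  shows "(k \<otimes> a) \<odot> b = a \<odot> (k \<otimes> b)"
proof -
  have "k \<in> carrier A" using assms K_subset by blast
  moreover have "frag_of (k \<otimes> a, b) - frag_of (a, k \<otimes> b) \<in> N"
    using assms by (intro null_relation) (auto simp: tensor_relations_def)
  ultimately show ?thesis using assms by (simp add: pure_coset frag_of_carrier coset_eqI)
qed

lemma pure_mult:
  assumes "a \<in> carrier A" "b \<in> carrier A" "c \<in> carrier A" "d \<in> carrier A"
  shows "(a \<odot> b) \<otimes>\<^bsub>T\<^esub> (c \<odot> d) = (a \<otimes> c) \<odot> (b \<otimes> d)"
  using assms by (simp add: pure_coset coset_mult frag_of_carrier pairs_mult_of)

lemma pure_one: "\<one> \<odot> \<one> = \<one>\<^bsub>T\<^esub>"
  by (simp add: tensor_square_def Let_def)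

sublocale T: cring T by (rule cring_tensor_square)

lemma pure_zero_left: "b \<in> carrier A \<Longrightarrow> \<zero> \<odot> b = \<zero>\<^bsub>T\<^esub>"
  using pure_add_left[of \<zero> \<zero> b] T.add.l_cancel_one'[of "\<zero> \<odot> b" "\<zero> \<odot> b"] by simp

lemma pure_zero_right: "a \<in> carrier A \<Longrightarrow> a \<odot> \<zero> = \<zero>\<^bsub>T\<^esub>"
  using pure_add_right[of a \<zero> \<zero>] T.add.l_cancel_one'[of "a \<odot> \<zero>" "a \<odot> \<zero>"] by simp

lemma pure_finsum_left:
  assumes "finite I" "b \<in> carrier A" "\<And>i. i \<in> I \<Longrightarrow> f i \<in> carrier A"
  shows "(\<Oplus>i\<in>I. f i) \<odot> b = (\<Oplus>\<^bsub>T\<^esub>i\<in>I. f i \<odot> b)"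
  using assms(1,3)
proof (induction I rule: finite_induct)
  case empty then show ?case by (simp add: pure_zero_left assms(2))
next
  case (insert i I)
  then show ?case using assms(2) by (simp add: pure_add_left Pi_def finsum_closed)
qed

lemma pure_finsum_right:
  assumes "finite I" "a \<in> carrier A" "\<And>i. i \<in> I \<Longrightarrow> f i \<in> carrier A"
  shows "a \<odot> (\<Oplus>i\<in>I. f i) = (\<Oplus>\<^bsub>T\<^esub>i\<in>I. a \<odot> f i)"
  using assms(1,3)
proof (induction I rule: finite_induct)
  case empty then show ?case by (simp add: pure_zero_right assms(2))
next
  case (insert i I)
  then show ?case using assms(2) by (simp add: pure_add_right Pi_def finsum_closed)
qed

lemma pure_finprod_left:
  assumes "finite I" "\<And>i. i \<in> I \<Longrightarrow> f i \<in> carrier A"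
  shows "(\<Otimes>i\<in>I. f i) \<odot> \<one> = (\<Otimes>\<^bsub>T\<^esub>i\<in>I. f i \<odot> \<one>)"
  using assms
proof (induction I rule: finite_induct)
  case empty then show ?case by (simp add: pure_one)
next
  case (insert i I)
  have "(f i \<otimes> (\<Otimes>i\<in>I. f i)) \<odot> (\<one> \<otimes> \<one>) = (f i \<odot> \<one>) \<otimes>\<^bsub>T\<^esub> ((\<Otimes>i\<in>I. f i) \<odot> \<one>)"
    by (rule pure_mult[symmetric]) (use insert in \<open>auto intro!: finprod_closed\<close>)
  then show ?case using insert by (simp add: Pi_def)
qed

lemma pairs_swap_of: "pairs_swap (frag_of (a, b)) = frag_of (b, a)"
  by (simp add: pairs_swap_def)

lemma pairs_swap_diff: "pairs_swap (u - v) = pairs_swap u - pairs_swap v"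
  by (simp add: pairs_swap_def frag_extend_diff)

lemma pairs_swap_0: "pairs_swap 0 = 0"
  by (simp add: pairs_swap_def)

lemma pairs_swap_add: "pairs_swap (u + v) = pairs_swap u + pairs_swap v"
  by (simp add: pairs_swap_def frag_extend_add)

lemma pairs_swap_swap: "pairs_swap (pairs_swap u) = u"
proof -
  have "Poly_Mapping.keys u \<subseteq> UNIV" by simp
  then show ?thesis
    by (induction u rule: frag_induction)
      (auto simp: pairs_swap_of pairs_swap_diff pairs_swap_0)
qed

lemma pairs_swap_closed: "u \<in> carrier Z \<Longrightarrow> pairs_swap u \<in> carrier Z"
  by (induction u rule: pairs_carrier_induct)
    (simp_all add: pairs_swap_of pairs_swap_diff pairs_swap_0 carrier_pairs keys_diff_subset
      keys_frag_of)

lemma pairs_swap_mult: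
  assumes "u \<in> carrier Z" "v \<in> carrier Z"
  shows "pairs_swap (pairs_mult A u v) = pairs_mult A (pairs_swap u) (pairs_swap v)"
  using assms(1)
proof (induction u rule: pairs_carrier_induct)
  case zero then show ?case by (simp add: pairs_mult_0_left pairs_swap_0)
next
  case (one a b)
  from assms(2) show ?case
    by (induction v rule: pairs_carrier_induct)
      (simp_all add: pairs_mult_0_right pairs_swap_0 pairs_swap_of pairs_mult_of
        pairs_swap_diff pairs_mult_diff_right)
next
  case (diff u v)
  then show ?case by (simp add: pairs_mult_diff_left pairs_swap_diff)
qed

lemma pairs_swap_null: "u \<in> N \<Longrightarrow> pairs_swap u \<in> N"
proof (induction u rule: null_induct)
  case zero then show ?case by (simp add: pairs_swap_0 null_zero)
next
  case (relation n)
  then consider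
      (left) a a' b where "n = frag_of (a \<oplus> a', b) - frag_of (a, b) - frag_of (a', b)"
        "a \<in> carrier A" "a' \<in> carrier A" "b \<in> carrier A"
    | (right) a b b' where "n = frag_of (a, b \<oplus> b') - frag_of (a, b) - frag_of (a, b')"
        "a \<in> carrier A" "b \<in> carrier A" "b' \<in> carrier A"
    | (balanced) k a b where "n = frag_of (k \<otimes> a, b) - frag_of (a, k \<otimes> b)"
        "k \<in> K" "a \<in> carrier A" "b \<in> carrier A"
    unfolding tensor_relations_def by blast
  then show ?case
  proof cases
    case left
    then have "pairs_swap n \<in> tensor_relations A K"
      by (auto simp: pairs_swap_diff pairs_swap_of tensor_relations_def)
    then show ?thesis by (rule null_relation)
  next
    case right
    then have "pairs_swap n \<in> tensor_relations A K"
      by (auto simp: pairs_swap_diff pairs_swap_of tensor_relations_def)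
    then show ?thesis by (rule null_relation)
  next
    case balanced
    have "frag_of (k \<otimes> b, a) - frag_of (b, k \<otimes> a) \<in> N"
      using balanced by (intro null_relation) (auto simp: tensor_relations_def)
    from null_uminus[OF this] show ?thesis
      by (simp add: balanced(1) pairs_swap_diff pairs_swap_of)
  qed
next
  case (diff u v) then show ?case by (simp add: pairs_swap_diff null_diff)
qed

lemma tensor_swap_coset: "tensor_swap (N +>\<^bsub>Z\<^esub> u) = N +>\<^bsub>Z\<^esub> pairs_swap u"
proof -
  have "n + pairs_swap u \<in> pairs_swap ` (\<lambda>n. n + u) ` N" if "n \<in> N" for n
    using pairs_swap_null[OF that] pairs_swap_swap[of n]
    by (auto simp: image_image pairs_swap_add intro!: image_eqI[of _ _ "pairs_swap n"])
  then show ?thesis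
    by (auto simp: tensor_swap_def coset_image pairs_swap_add pairs_swap_null)
qed

lemma tensor_swap_pure: "tensor_swap (a \<odot> b) = b \<odot> a"
  by (simp add: pure_coset tensor_swap_coset pairs_swap_of)

lemma tensor_swap_swap: "tensor_swap (tensor_swap U) = U"
  by (simp add: tensor_swap_def image_image pairs_swap_swap)

text \<open>The exchange of factors maps each family of relations to relations up to sign, so it descends
  to the quotient.\<close>

lemma tensor_swap_hom: "ring_hom_cring T T tensor_swap"
proof (intro ring_hom_cring.intro ring_hom_cring_axioms.intro)
  show "cring T" "cring T" by (rule cring_tensor_square)+
  show "tensor_swap \<in> ring_hom T T"
  proof (rule ring_hom_memI)
    show "tensor_swap \<one>\<^bsub>T\<^esub> = \<one>\<^bsub>T\<^esub>" unfolding pure_one[symmetric] by (rule tensor_swap_pure)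
  qed (auto simp: carrier_tensor tensor_swap_coset pairs_swap_closed coset_mult coset_add
      pairs_swap_mult pairs_swap_add pairs_mult_closed carrier_pairs_add)
qed

sublocale swap: ring_hom_cring T T tensor_swap by (rule tensor_swap_hom)

section \<open>Elements supported on the diagonal\<close>

text \<open>Elements \<open>q\<close> with \<open>q * (u \<otimes> 1) = q * (1 \<otimes> u)\<close> for all \<open>u\<close> are known as Casimir elements;
  geometrically they are the functions on the fibre product that vanish off the diagonal. The property
  is stated for one \<open>u\<close> at a time, since for fixed \<open>q\<close> the set of such \<open>u\<close> is a subring that
  contains \<open>K\<close>, and so it is enough to check generators.\<close>

definition casimir :: "('a \<times> 'a \<Rightarrow>\<^sub>0 int) set \<Rightarrow> 'a \<Rightarrow> bool" where
  "casimir q u \<longleftrightarrow> u \<in> carrier A \<and> q \<otimes>\<^bsub>T\<^esub> (u \<odot> \<one>) = q \<otimes>\<^bsub>T\<^esub> (\<one> \<odot> u)"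

lemma casimir_K:
  assumes "q \<in> carrier T" "k \<in> K" shows "casimir q k"
proof -
  have "k \<in> carrier A" using assms K_subset by blast
  then show ?thesis using pure_balanced[OF assms(2), of \<one> \<one>] by (simp add: casimir_def)
qed

lemma casimir_add:
  assumes q: "q \<in> carrier T" and "casimir q u" "casimir q v" shows "casimir q (u \<oplus> v)"
proof -
  have "u \<in> carrier A" "v \<in> carrier A" using assms by (simp_all add: casimir_def)
  then show ?thesis using assms
    by (simp add: casimir_def pure_add_left pure_add_right T.r_distr)
qed

lemma casimir_mult:
  assumes q: "q \<in> carrier T" and u: "casimir q u" and v: "casimir q v"
  shows "casimir q (u \<otimes> v)"
proof -
  have [simp]: "u \<in> carrier A" "v \<in> carrier A" using u v by (simp_all add: casimir_def)
  have "q \<otimes>\<^bsub>T\<^esub> ((u \<otimes> v) \<odot> \<one>) = (q \<otimes>\<^bsub>T\<^esub> (u \<odot> \<one>)) \<otimes>\<^bsub>T\<^esub> (v \<odot> \<one>)"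
    using q by (simp add: T.m_assoc pure_mult)
  also have "\<dots> = (q \<otimes>\<^bsub>T\<^esub> (\<one> \<odot> u)) \<otimes>\<^bsub>T\<^esub> (v \<odot> \<one>)" using u by (simp add: casimir_def)
  also have "\<dots> = (q \<otimes>\<^bsub>T\<^esub> (v \<odot> \<one>)) \<otimes>\<^bsub>T\<^esub> (\<one> \<odot> u)"
    using q by (simp add: T.m_assoc pure_mult)
  also have "\<dots> = (q \<otimes>\<^bsub>T\<^esub> (\<one> \<odot> v)) \<otimes>\<^bsub>T\<^esub> (\<one> \<odot> u)" using v by (simp add: casimir_def)
  also have "\<dots> = q \<otimes>\<^bsub>T\<^esub> (\<one> \<odot> (u \<otimes> v))"
    using q by (simp add: T.m_assoc pure_mult m_comm)
  finally show ?thesis by (simp add: casimir_def)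
qed

lemma casimir_one: "q \<in> carrier T \<Longrightarrow> casimir q \<one>"
  by (simp add: casimir_def)

lemma casimir_pow: "q \<in> carrier T \<Longrightarrow> casimir q u \<Longrightarrow> casimir q (u [^] n)" for n :: nat
  by (induction n) (auto simp: casimir_one casimir_mult)

lemma casimir_finprod:
  assumes "q \<in> carrier T" "finite I" "\<And>i. i \<in> I \<Longrightarrow> casimir q (f i)"
  shows "casimir q (\<Otimes>i\<in>I. f i)"
  using assms(2,3)
proof (induction I rule: finite_induct)
  case empty then show ?case by (simp add: casimir_one assms(1))
next
  case (insert i I)
  then have "f \<in> insert i I \<rightarrow> carrier A" by (auto simp: casimir_def)
  then show ?case using insert by (simp add: casimir_mult assms(1))
qed

lemma casimir_finsum:
  assumes "q \<in> carrier T" "finite I" "\<And>i. i \<in> I \<Longrightarrow> casimir q (f i)"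
  shows "casimir q (\<Oplus>i\<in>I. f i)"
  using assms(2,3)
proof (induction I rule: finite_induct)
  case empty
  show ?case by (simp add: casimir_def assms(1) pure_zero_left pure_zero_right)
next
  case (insert i I)
  then have "f \<in> insert i I \<rightarrow> carrier A" by (auto simp: casimir_def)
  then show ?case using insert by (simp add: casimir_add assms(1))
qed

lemma casimir_product:
  assumes I: "finite I" "\<And>i. i \<in> I \<Longrightarrow> q i \<in> carrier T" and j: "j \<in> I" "casimir (q j) u"
  shows "casimir (\<Otimes>\<^bsub>T\<^esub>i\<in>I. q i) u"
proof -
  define w where "w = (\<Otimes>\<^bsub>T\<^esub>i\<in>I - {j}. q i)"
  have [simp]: "w \<in> carrier T" unfolding w_def using I by (intro T.finprod_closed) auto
  have [simp]: "u \<in> carrier A" "q j \<in> carrier T" using j I by (simp_all add: casimir_def)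
  have "(\<Otimes>\<^bsub>T\<^esub>i\<in>I. q i) = (\<Otimes>\<^bsub>T\<^esub>i\<in>insert j (I - {j}). q i)" using j by (simp add: insert_absorb)
  also have "\<dots> = q j \<otimes>\<^bsub>T\<^esub> w" unfolding w_def using I j by (intro T.finprod_insert) auto
  finally have *: "(\<Otimes>\<^bsub>T\<^esub>i\<in>I. q i) = w \<otimes>\<^bsub>T\<^esub> q j" by (simp add: T.m_comm)
  show ?thesis using j(2) by (simp add: casimir_def * T.m_assoc)
qed

text \<open>The equation for \<open>h\<close> and its mirror image have the same right-hand side \<open>q * (a \<otimes> 1) =
  q * (1 \<otimes> a)\<close>, and \<open>q * (D \<otimes> 1) = q * (1 \<otimes> D)\<close>. Hence \<open>h\<close> and its mirror image agree after
  multiplication by \<open>(D \<otimes> 1) * (1 \<otimes> D)\<close>. The second factor is regular because it is the mirror image of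
  the first.\<close>

lemma casimir_symmetric:
  assumes h: "h \<in> carrier T" and q: "q \<in> carrier T" and D: "D \<in> carrier A" and a: "a \<in> carrier A"
    and regular: "regular_element T (D \<odot> \<one>)"
    and eq: "h \<otimes>\<^bsub>T\<^esub> (D \<odot> \<one>) = q \<otimes>\<^bsub>T\<^esub> (a \<odot> \<one>)"
    and q_swap: "tensor_swap q = q"
    and casimir: "\<And>u. u \<in> carrier A \<Longrightarrow> casimir q u"
  shows "tensor_swap h = h"
proof -
  have q_casimir: "q \<otimes>\<^bsub>T\<^esub> (u \<odot> \<one>) = q \<otimes>\<^bsub>T\<^esub> (\<one> \<odot> u)" if "u \<in> carrier A" for u
    using casimir[OF that] by (simp add: casimir_def)
  define h' d d' c where "h' = tensor_swap h" and "d = D \<odot> \<one>" and "d' = \<one> \<odot> D" and "c = a \<odot> \<one>"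
  have [simp]: "h' \<in> carrier T" "d \<in> carrier T" "d' \<in> carrier T" "c \<in> carrier T"
    using h D a by (simp_all add: h'_def d_def d'_def c_def)
  note [simp] = h q
  have "h' \<otimes>\<^bsub>T\<^esub> d' = tensor_swap (h \<otimes>\<^bsub>T\<^esub> d)"
    by (simp add: h'_def d'_def d_def tensor_swap_pure D)
  also have "\<dots> = tensor_swap (q \<otimes>\<^bsub>T\<^esub> (a \<odot> \<one>))" by (simp add: d_def eq)
  also have "\<dots> = q \<otimes>\<^bsub>T\<^esub> (\<one> \<odot> a)" using a by (simp add: tensor_swap_pure q_swap)
  also have "\<dots> = q \<otimes>\<^bsub>T\<^esub> c" using q_casimir[OF a] by (simp add: c_def)
  finally have eq': "h' \<otimes>\<^bsub>T\<^esub> d' = q \<otimes>\<^bsub>T\<^esub> c" .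
  have qd: "q \<otimes>\<^bsub>T\<^esub> d = q \<otimes>\<^bsub>T\<^esub> d'" using q_casimir[OF D] by (simp add: d_def d'_def)
  have cancel: "w = \<zero>\<^bsub>T\<^esub>" if "d \<otimes>\<^bsub>T\<^esub> w = \<zero>\<^bsub>T\<^esub>" "w \<in> carrier T" for w
    using regular that by (auto simp: regular_element_def d_def)
  have cancel': "w = \<zero>\<^bsub>T\<^esub>" if w: "d' \<otimes>\<^bsub>T\<^esub> w = \<zero>\<^bsub>T\<^esub>" "w \<in> carrier T" for w
  proof -
    have "d \<otimes>\<^bsub>T\<^esub> tensor_swap w = tensor_swap (d' \<otimes>\<^bsub>T\<^esub> w)"
      using w(2) by (simp add: tensor_swap_pure d_def d'_def D)
    then have "tensor_swap w = \<zero>\<^bsub>T\<^esub>" using w cancel[of "tensor_swap w"] by simp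
    then show ?thesis using tensor_swap_swap[of w] by simp
  qed
  have "(h \<otimes>\<^bsub>T\<^esub> d) \<otimes>\<^bsub>T\<^esub> d' = (q \<otimes>\<^bsub>T\<^esub> d') \<otimes>\<^bsub>T\<^esub> c"
    unfolding eq[folded d_def c_def] by (simp add: T.m_ac)
  also have "\<dots> = (h' \<otimes>\<^bsub>T\<^esub> d') \<otimes>\<^bsub>T\<^esub> d"
    unfolding eq' qd[symmetric] by (simp add: T.m_ac)
  finally have "d \<otimes>\<^bsub>T\<^esub> (d' \<otimes>\<^bsub>T\<^esub> h) = d \<otimes>\<^bsub>T\<^esub> (d' \<otimes>\<^bsub>T\<^esub> h')" by (simp add: T.m_ac)
  moreover have dist: "u \<otimes>\<^bsub>T\<^esub> (v \<ominus>\<^bsub>T\<^esub> w) = u \<otimes>\<^bsub>T\<^esub> v \<ominus>\<^bsub>T\<^esub> u \<otimes>\<^bsub>T\<^esub> w"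
    if "u \<in> carrier T" "v \<in> carrier T" "w \<in> carrier T" for u v w
    using that by (simp only: T.minus_eq T.r_distr T.r_minus T.a_inv_closed)
  ultimately have "d \<otimes>\<^bsub>T\<^esub> (d' \<otimes>\<^bsub>T\<^esub> (h' \<ominus>\<^bsub>T\<^esub> h)) = \<zero>\<^bsub>T\<^esub>"
    by (simp only: dist T.m_closed \<open>h' \<in> carrier T\<close> \<open>d \<in> carrier T\<close> \<open>d' \<in> carrier T\<close> h)
      (simp add: T.minus_eq T.r_neg)
  then have "d' \<otimes>\<^bsub>T\<^esub> (h' \<ominus>\<^bsub>T\<^esub> h) = \<zero>\<^bsub>T\<^esub>" by (rule cancel) simp
  then have zero: "h' \<ominus>\<^bsub>T\<^esub> h = \<zero>\<^bsub>T\<^esub>" by (rule cancel') simp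
  have "h' = (h' \<ominus>\<^bsub>T\<^esub> h) \<oplus>\<^bsub>T\<^esub> h" by (simp add: T.minus_eq T.a_assoc T.l_neg)
  also have "\<dots> = h" by (simp add: zero)
  finally show ?thesis by (simp add: h'_def)
qed

lemma finsum_shift:
  fixes g :: "nat \<Rightarrow> ('a \<times> 'a \<Rightarrow>\<^sub>0 int) set"
  assumes "\<And>i. i \<le> k \<Longrightarrow> g i \<in> carrier T"
  shows "(\<Oplus>\<^bsub>T\<^esub>i\<in>{..<k}. g (Suc i)) \<oplus>\<^bsub>T\<^esub> g 0 = (\<Oplus>\<^bsub>T\<^esub>i\<in>{..<k}. g i) \<oplus>\<^bsub>T\<^esub> g k"
  using assms
proof (induction k)
  case 0 then show ?case by simp
next
  case (Suc k)
  have [simp]: "g i \<in> carrier T" if "i \<le> Suc k" for i using Suc.prems that by simp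
  have [simp]: "(\<Oplus>\<^bsub>T\<^esub>i\<in>{..<k}. g (Suc i)) \<in> carrier T" "(\<Oplus>\<^bsub>T\<^esub>i\<in>{..<k}. g i) \<in> carrier T"
    by (auto intro!: T.finsum_closed)
  have IH: "(\<Oplus>\<^bsub>T\<^esub>i\<in>{..<k}. g (Suc i)) \<oplus>\<^bsub>T\<^esub> g 0 = (\<Oplus>\<^bsub>T\<^esub>i\<in>{..<k}. g i) \<oplus>\<^bsub>T\<^esub> g k"
    by (rule Suc.IH) simp
  have "(\<Oplus>\<^bsub>T\<^esub>i\<in>{..<Suc k}. g (Suc i)) \<oplus>\<^bsub>T\<^esub> g 0
      = g (Suc k) \<oplus>\<^bsub>T\<^esub> ((\<Oplus>\<^bsub>T\<^esub>i\<in>{..<k}. g (Suc i)) \<oplus>\<^bsub>T\<^esub> g 0)"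
    by (simp add: lessThan_Suc T.a_assoc)
  also have "\<dots> = (\<Oplus>\<^bsub>T\<^esub>i\<in>{..<Suc k}. g i) \<oplus>\<^bsub>T\<^esub> g (Suc k)"
    unfolding IH by (simp add: lessThan_Suc T.a_ac)
  finally show ?case .
qed

definition tensor_divided_difference :: "nat \<Rightarrow> (nat \<Rightarrow> 'a) \<Rightarrow> 'a \<Rightarrow> ('a \<times> 'a \<Rightarrow>\<^sub>0 int) set" where
  "tensor_divided_difference n c y =
     (\<Oplus>\<^bsub>T\<^esub>k\<in>{..n}. \<Oplus>\<^bsub>T\<^esub>i\<in>{..<k}. (c k \<otimes> y [^] i) \<odot> (y [^] (k - 1 - i)))"

context
  fixes n :: nat and c :: "nat \<Rightarrow> 'a" and y :: 'a
  assumes c: "\<And>k. c k \<in> K" and y: "y \<in> carrier A"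
begin

lemma c_carrier [simp]: "c k \<in> carrier A" using c K_subset by blast

lemma divided_difference_closed: "tensor_divided_difference n c y \<in> carrier T"
  unfolding tensor_divided_difference_def using y by (auto intro!: T.finsum_closed)

text \<open>Reversing the order of summation exchanges \<open>y ^ i\<close> and \<open>y' ^ (k - 1 - i)\<close>; the coefficient
  \<open>c k\<close> may stand in either factor because it lies in \<open>K\<close>.\<close>

lemma divided_difference_swap:
  "tensor_swap (tensor_divided_difference n c y) = tensor_divided_difference n c y"
proof -
  have inner: "(\<Oplus>\<^bsub>T\<^esub>i\<in>{..<k}. (y [^] (k - 1 - i)) \<odot> (c k \<otimes> y [^] i)) =
      (\<Oplus>\<^bsub>T\<^esub>i\<in>{..<k}. (c k \<otimes> y [^] i) \<odot> (y [^] (k - 1 - i)))" for k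
  proof -
    have reflect: "(\<lambda>i. k - 1 - i) ` {..<k} = {..<k}"
    proof (intro equalityI subsetI)
      fix i assume "i \<in> {..<k}"
      then show "i \<in> (\<lambda>i. k - 1 - i) ` {..<k}" by (intro image_eqI[of _ _ "k - 1 - i"]) auto
    qed auto
    have "(\<Oplus>\<^bsub>T\<^esub>i\<in>{..<k}. (y [^] (k - 1 - i)) \<odot> (c k \<otimes> y [^] i)) =
        (\<Oplus>\<^bsub>T\<^esub>i\<in>{..<k}. (c k \<otimes> y [^] (k - 1 - i)) \<odot> (y [^] i))"
      using y c by (intro T.finsum_cong') (auto simp: pure_balanced)
    also have "\<dots> = (\<Oplus>\<^bsub>T\<^esub>i\<in>(\<lambda>i. k - 1 - i) ` {..<k}. (c k \<otimes> y [^] (k - 1 - i)) \<odot> (y [^] i))"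
      unfolding reflect by simp
    also have "\<dots> = (\<Oplus>\<^bsub>T\<^esub>i\<in>{..<k}. (c k \<otimes> y [^] (k - 1 - (k - 1 - i))) \<odot> (y [^] (k - 1 - i)))"
      by (rule T.finsum_reindex) (use y in \<open>auto simp: inj_on_def\<close>)
    also have "\<dots> = (\<Oplus>\<^bsub>T\<^esub>i\<in>{..<k}. (c k \<otimes> y [^] i) \<odot> (y [^] (k - 1 - i)))"
      using y by (intro T.finsum_cong') auto
    finally show ?thesis .
  qed
  have "tensor_swap (tensor_divided_difference n c y) =
      (\<Oplus>\<^bsub>T\<^esub>k\<in>{..n}. tensor_swap (\<Oplus>\<^bsub>T\<^esub>i\<in>{..<k}. (c k \<otimes> y [^] i) \<odot> (y [^] (k - 1 - i))))"
    unfolding tensor_divided_difference_def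
    by (subst swap.hom_finsum) (use y in \<open>auto simp: comp_def intro!: T.finsum_closed\<close>)
  also have "\<dots> = (\<Oplus>\<^bsub>T\<^esub>k\<in>{..n}. \<Oplus>\<^bsub>T\<^esub>i\<in>{..<k}. (y [^] (k - 1 - i)) \<odot> (c k \<otimes> y [^] i))"
    using y by (intro T.finsum_cong') (auto simp: swap.hom_finsum comp_def tensor_swap_pure
        intro!: T.finsum_closed)
  finally show ?thesis by (simp only: inner tensor_divided_difference_def)
qed

text \<open>This is the identity \<open>(F(y) - F(y')) / (y - y') * (y - y') = F(y) - F(y')\<close>, whose right-hand side
  vanishes at a root. The sums are kept on both sides with plus signs to avoid subtraction.\<close>

lemma divided_difference_casimir:
  assumes root: "(\<Oplus>k\<in>{..n}. c k \<otimes> y [^] k) = \<zero>"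
  shows "casimir (tensor_divided_difference n c y) y"
proof -
  define S where "S k = (\<Oplus>\<^bsub>T\<^esub>i\<in>{..<k}. (c k \<otimes> y [^] i) \<odot> (y [^] (k - 1 - i)))" for k
  have S [simp]: "S k \<in> carrier T" for k
    unfolding S_def using y by (auto intro!: T.finsum_closed)
  have tele: "S k \<otimes>\<^bsub>T\<^esub> (y \<odot> \<one>) \<oplus>\<^bsub>T\<^esub> \<one> \<odot> (c k \<otimes> y [^] k) =
      S k \<otimes>\<^bsub>T\<^esub> (\<one> \<odot> y) \<oplus>\<^bsub>T\<^esub> (c k \<otimes> y [^] k) \<odot> \<one>" for k
  proof -
    define g where "g i = (c k \<otimes> y [^] i) \<odot> (y [^] (k - i))" for i
    have [simp]: "g i \<in> carrier T" for i using y by (simp add: g_def)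
    have "S k \<otimes>\<^bsub>T\<^esub> (y \<odot> \<one>) = (\<Oplus>\<^bsub>T\<^esub>i\<in>{..<k}. g (Suc i))"
      unfolding S_def g_def using y
      by (subst T.finsum_ldistr) (auto intro!: T.finsum_cong' simp: pure_mult m_assoc)
    moreover have "S k \<otimes>\<^bsub>T\<^esub> (\<one> \<odot> y) = (\<Oplus>\<^bsub>T\<^esub>i\<in>{..<k}. g i)"
    proof -
      have *: "y [^] (k - Suc i) \<otimes> y = y [^] (k - i)" if "i < k" for i
        using that by (metis Suc_diff_Suc nat_pow_Suc)
      have "S k \<otimes>\<^bsub>T\<^esub> (\<one> \<odot> y) =
          (\<Oplus>\<^bsub>T\<^esub>i\<in>{..<k}. ((c k \<otimes> y [^] i) \<odot> (y [^] (k - 1 - i))) \<otimes>\<^bsub>T\<^esub> (\<one> \<odot> y))"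
        unfolding S_def using y by (subst T.finsum_ldistr) auto
      also have "\<dots> = (\<Oplus>\<^bsub>T\<^esub>i\<in>{..<k}. g i)"
        unfolding g_def using y by (intro T.finsum_cong') (auto simp: pure_mult *)
      finally show ?thesis .
    qed
    moreover have "g 0 = \<one> \<odot> (c k \<otimes> y [^] k)"
      using y pure_balanced[OF c[of k], of \<one> "y [^] k"] by (simp add: g_def)
    moreover have "g k = (c k \<otimes> y [^] k) \<odot> \<one>" by (simp add: g_def)
    ultimately show ?thesis using finsum_shift[of k g] by simp
  qed
  define q where "q = tensor_divided_difference n c y"
  have q: "q = (\<Oplus>\<^bsub>T\<^esub>k\<in>{..n}. S k)" by (simp add: q_def tensor_divided_difference_def S_def)
  have [simp]: "q \<in> carrier T" unfolding q_def by (rule divided_difference_closed)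
  have dist: "q \<otimes>\<^bsub>T\<^esub> u = (\<Oplus>\<^bsub>T\<^esub>k\<in>{..n}. S k \<otimes>\<^bsub>T\<^esub> u)" if "u \<in> carrier T" for u
    unfolding q using that by (subst T.finsum_ldistr) auto
  have zero: "(\<Oplus>\<^bsub>T\<^esub>k\<in>{..n}. (c k \<otimes> y [^] k) \<odot> \<one>) = \<zero>\<^bsub>T\<^esub>"
      "(\<Oplus>\<^bsub>T\<^esub>k\<in>{..n}. \<one> \<odot> (c k \<otimes> y [^] k)) = \<zero>\<^bsub>T\<^esub>"
    using y root pure_finsum_left[of "{..n}" \<one> "\<lambda>k. c k \<otimes> y [^] k"]
      pure_finsum_right[of "{..n}" \<one> "\<lambda>k. c k \<otimes> y [^] k"]
    by (simp_all add: pure_zero_left pure_zero_right)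
  have "q \<otimes>\<^bsub>T\<^esub> (y \<odot> \<one>) = q \<otimes>\<^bsub>T\<^esub> (y \<odot> \<one>) \<oplus>\<^bsub>T\<^esub> (\<Oplus>\<^bsub>T\<^esub>k\<in>{..n}. \<one> \<odot> (c k \<otimes> y [^] k))"
    using y by (simp add: zero)
  also have "\<dots> = (\<Oplus>\<^bsub>T\<^esub>k\<in>{..n}. S k \<otimes>\<^bsub>T\<^esub> (y \<odot> \<one>) \<oplus>\<^bsub>T\<^esub> \<one> \<odot> (c k \<otimes> y [^] k))"
    using y by (subst T.finsum_addf) (auto simp: dist)
  also have "\<dots> = (\<Oplus>\<^bsub>T\<^esub>k\<in>{..n}. S k \<otimes>\<^bsub>T\<^esub> (\<one> \<odot> y) \<oplus>\<^bsub>T\<^esub> (c k \<otimes> y [^] k) \<odot> \<one>)"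
    by (simp only: tele)
  also have "\<dots> = q \<otimes>\<^bsub>T\<^esub> (\<one> \<odot> y) \<oplus>\<^bsub>T\<^esub> (\<Oplus>\<^bsub>T\<^esub>k\<in>{..n}. (c k \<otimes> y [^] k) \<odot> \<one>)"
    using y by (subst T.finsum_addf) (auto simp: dist)
  also have "\<dots> = q \<otimes>\<^bsub>T\<^esub> (\<one> \<odot> y)"
    using y by (simp add: zero)
  finally show ?thesis using y by (simp add: q_def casimir_def)
qed

end

end

section \<open>Functions on a pointed compact Riemann surface\<close>

locale pointed_surface =
  fixes X :: "'p topology" and \<A> :: "'p atlas" and P :: 'p
  assumes surface: "compact_riemann_surface X \<A>" and P_in: "P \<in> topspace X"
begin

abbreviation "R \<equiv> coordinate_ring X \<A> P"
abbreviation "S \<equiv> affine_part X P"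

lemma chart:
  assumes "(U, \<phi>) \<in> \<A>"
  shows "openin X U" and "open (\<phi> ` U)"
    and "homeomorphic_map (subtopology X U) (top_of_set (\<phi> ` U)) \<phi>"
  using surface assms unfolding compact_riemann_surface_def by blast+

lemma chart_at:
  assumes "p \<in> topspace X" obtains U \<phi> where "(U, \<phi>) \<in> \<A>" "p \<in> U"
  using surface assms unfolding compact_riemann_surface_def by blast

lemma chart_inj:
  assumes "(U, \<phi>) \<in> \<A>" shows "inj_on \<phi> U"
proof -
  have "topspace (subtopology X U) = U"
    using openin_subset[OF chart(1)[OF assms]] by auto
  then show ?thesis using homeomorphic_imp_injective_map[OF chart(3)[OF assms]] by simp
qed

lemma chart_inv: "(U, \<phi>) \<in> \<A> \<Longrightarrow> u \<in> U \<Longrightarrow> inv_into U \<phi> (\<phi> u) = u"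
  by (rule inv_into_f_f[OF chart_inj])

lemma chart_image_open:
  assumes "(U, \<phi>) \<in> \<A>" "openin X V" "V \<subseteq> U"
  shows "open (\<phi> ` V)"
proof -
  have "openin (subtopology X U) V"
    using assms chart(1) openin_open_subtopology by blast
  then have "openin (top_of_set (\<phi> ` U)) (\<phi> ` V)"
    using homeomorphic_map_openness[OF chart(3)[OF assms(1)], of V] openin_subset by blast
  then show ?thesis
    using chart(2)[OF assms(1)] openin_open_eq by blast
qed

lemma chart_preimage_open:
  assumes "(U, \<phi>) \<in> \<A>" "open W"
  shows "openin X {u \<in> U. \<phi> u \<in> W}"
proof -
  have top: "topspace (subtopology X U) = U"
    using openin_subset[OF chart(1)[OF assms(1)]] by auto
  have "continuous_map (subtopology X U) (top_of_set (\<phi> ` U)) \<phi>"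
    by (rule homeomorphic_imp_continuous_map[OF chart(3)[OF assms(1)]])
  moreover have "openin (top_of_set (\<phi> ` U)) (\<phi> ` U \<inter> W)"
    using assms(2) by (simp add: openin_open_Int)
  ultimately have "openin (subtopology X U) {u \<in> topspace (subtopology X U). \<phi> u \<in> \<phi> ` U \<inter> W}"
    by (rule openin_continuous_map_preimage)
  moreover have "{u \<in> topspace (subtopology X U). \<phi> u \<in> \<phi> ` U \<inter> W} = {u \<in> U. \<phi> u \<in> W}"
    unfolding top by auto
  ultimately show ?thesis
    using openin_open_subtopology[OF chart(1)[OF assms(1)]] by metis
qed

lemma atin_chart:
  assumes c: "(U, \<phi>) \<in> \<A>" and p: "p \<in> U"
  shows "atin X p = filtermap (inv_into U \<phi>) (at (\<phi> p))"
proof (rule filter_eqI)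
  fix Q
  have p': "p \<in> topspace X" using p openin_subset[OF chart(1)[OF c]] by blast
  have "(\<exists>V. openin X V \<and> p \<in> V \<and> (\<forall>q \<in> V - {p}. Q q)) \<longleftrightarrow>
        (\<exists>W. open W \<and> \<phi> p \<in> W \<and> (\<forall>z\<in>W. z \<noteq> \<phi> p \<longrightarrow> z \<in> UNIV \<longrightarrow> Q (inv_into U \<phi> z)))"
    (is "?l \<longleftrightarrow> ?r")
  proof
    assume ?l
    then obtain V where V: "openin X V" "p \<in> V" "\<forall>q \<in> V - {p}. Q q" by blast
    have "open (\<phi> ` (U \<inter> V))"
      by (rule chart_image_open[OF c]) (use V chart(1)[OF c] in auto)
    moreover have "\<phi> p \<in> \<phi> ` (U \<inter> V)" using p V by blast
    moreover have "Q (inv_into U \<phi> z)" if "z \<in> \<phi> ` (U \<inter> V)" "z \<noteq> \<phi> p" for z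
      using that V(3) chart_inv[OF c] by auto
    ultimately show ?r by blast
  next
    assume ?r
    then obtain W where W: "open W" "\<phi> p \<in> W" "\<forall>z\<in>W. z \<noteq> \<phi> p \<longrightarrow> Q (inv_into U \<phi> z)" by blast
    have "Q q" if "q \<in> {u \<in> U. \<phi> u \<in> W} - {p}" for q
    proof -
      have "\<phi> q \<noteq> \<phi> p" using that p inj_onD[OF chart_inj[OF c]] by blast
      then show ?thesis using that W(3) chart_inv[OF c, of q] by auto
    qed
    then show ?l using chart_preimage_open[OF c W(1)] W(2) p by blast
  qed
  then show "eventually Q (atin X p) \<longleftrightarrow> eventually Q (filtermap (inv_into U \<phi>) (at (\<phi> p)))"
    unfolding eventually_atin eventually_filtermap eventually_at_topological using p' by simp
qed

lemma tendsto_atin_chart: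
  assumes "(U, \<phi>) \<in> \<A>" "p \<in> U"
  shows "(f \<longlongrightarrow> L) (atin X p) \<longleftrightarrow> ((\<lambda>z. f (inv_into U \<phi> z)) \<longlongrightarrow> L) (at (\<phi> p))"
  unfolding atin_chart[OF assms] filterlim_filtermap ..

lemma atin_P_nontrivial: "atin X P \<noteq> bot"
proof -
  obtain U \<phi> where "(U, \<phi>) \<in> \<A>" "P \<in> U" using chart_at[OF P_in] .
  then show ?thesis by (simp add: atin_chart filtermap_bot_iff)
qed

lemma S_subset: "p \<in> S \<Longrightarrow> p \<in> topspace X" "p \<in> S \<Longrightarrow> p \<noteq> P"
  by (auto simp: affine_part_def)

lemma openin_S: "openin X S"
proof -
  have "Hausdorff_space X" using surface unfolding compact_riemann_surface_def by blast
  then have "closedin X {P}" using closedin_Hausdorff_singleton[OF _ P_in] by blast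
  then show ?thesis unfolding affine_part_def by (rule openin_diff[OF openin_topspace])
qed

lemma eventually_S: "eventually (\<lambda>p. p \<in> S) (atin X P)"
  unfolding eventually_atin affine_part_def using openin_subset by fastforce

lemma holomorphic_in_chart:
  assumes "f \<in> carrier R" "(U, \<phi>) \<in> \<A>"
  shows "(\<lambda>z. f (inv_into U \<phi> z)) holomorphic_on \<phi> ` (U \<inter> S)"
  using assms by (auto simp: coordinate_ring_def coordinate_functions_def)

lemma meromorphic_in_chart:
  assumes "f \<in> carrier R" "(U, \<phi>) \<in> \<A>" "P \<in> U"
  shows "(\<lambda>z. f (inv_into U \<phi> z)) meromorphic_on {\<phi> P}"
  using assms by (auto simp: coordinate_ring_def coordinate_functions_def)

lemma open_chart_S: "(U, \<phi>) \<in> \<A> \<Longrightarrow> open (\<phi> ` (U \<inter> S))"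
  by (rule chart_image_open) (use chart(1) openin_S in auto)

lemma tendsto_in_R:
  assumes f: "f \<in> carrier R" and p: "p \<in> S"
  shows "(f \<longlongrightarrow> f p) (atin X p)"
proof -
  obtain U \<phi> where c: "(U, \<phi>) \<in> \<A>" "p \<in> U" using chart_at S_subset p by metis
  have "isCont (\<lambda>z. f (inv_into U \<phi> z)) (\<phi> p)"
  proof (rule continuous_on_interior)
    show "continuous_on (\<phi> ` (U \<inter> S)) (\<lambda>z. f (inv_into U \<phi> z))"
      using holomorphic_in_chart[OF f c(1)] by (rule holomorphic_on_imp_continuous_on)
    show "\<phi> p \<in> interior (\<phi> ` (U \<inter> S))"
      using open_chart_S[OF c(1)] c(2) p by (simp add: interior_open)
  qed
  then show ?thesis
    unfolding tendsto_atin_chart[OF c] by (simp add: isCont_def chart_inv[OF c])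
qed

text \<open>The maximum principle: extended by \<open>0\<close> at \<open>P\<close>, the function is continuous on a compact space, so
  its modulus is attained. If the maximum were positive, it would be attained away from \<open>P\<close>, and
  the set where the function takes the same value would be closed, open by the local maximum modulus
  principle, and hence all of the connected surface, including \<open>P\<close>. The lemma serves twice: it excludes
  nonzero functions that vanish at \<open>P\<close>, and it shows that a function that is zero near \<open>P\<close> is zero.\<close>

lemma vanishes_at_P_imp_zero:
  assumes f: "f \<in> carrier R" and lim: "(f \<longlongrightarrow> 0) (atin X P)" and p: "p \<in> S"
  shows "f p = 0"
proof (rule ccontr)
  assume "f p \<noteq> 0"
  define g where "g q = (if q = P then 0 else f q)" for q
  have near: "eventually (\<lambda>q. g q = f q) (atin X q)" if "q \<in> topspace X" for q
  proof -
    have "eventually (\<lambda>u. u \<in> S) (atin X q)"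
    proof (cases "q = P")
      case True then show ?thesis using eventually_S by simp
    next
      case False
      then have "q \<in> S" using that by (simp add: affine_part_def)
      then show ?thesis unfolding eventually_atin using openin_S by blast
    qed
    then show ?thesis by eventually_elim (auto simp: g_def affine_part_def)
  qed
  have cont: "continuous_map X euclidean g"
    unfolding continuous_map_atin limitin_canonical_iff
  proof
    fix q assume q: "q \<in> topspace X"
    have "(f \<longlongrightarrow> g q) (atin X q)"
      using lim tendsto_in_R[OF f, of q] q by (auto simp: g_def affine_part_def)
    then show "(g \<longlongrightarrow> g q) (atin X q)"
      using tendsto_cong[OF near[OF q]] by blast
  qed
  have "compact (g ` topspace X)"
    using surface image_compactin[OF _ cont, of "topspace X"]
    by (simp add: compact_riemann_surface_def compact_space_def)
  then have "compact (norm ` g ` topspace X)"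
    by (intro compact_continuous_image continuous_intros) auto
  moreover have "norm ` g ` topspace X \<noteq> {}" using P_in by blast
  ultimately obtain q where q: "q \<in> topspace X"
    and max: "\<And>u. u \<in> topspace X \<Longrightarrow> norm (g u) \<le> norm (g q)"
    using compact_attains_sup[of "norm ` g ` topspace X"] by fastforce
  have "0 < norm (g p)" using \<open>f p \<noteq> 0\<close> p by (simp add: g_def affine_part_def)
  then have gq: "g q \<noteq> 0" using max[OF S_subset(1)[OF p]] by auto
  let ?M = "{u \<in> topspace X. g u = g q}"
  have "closedin X {u \<in> topspace X. g u \<in> {g q}}"
    by (rule closedin_continuous_map_preimage[OF cont]) simp
  then have closed: "closedin X ?M" by simp
  have "openin X ?M"
  proof (subst openin_subopen, intro ballI)
    fix u assume u: "u \<in> ?M"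
    then have uS: "u \<in> S" using gq by (auto simp: g_def affine_part_def split: if_splits)
    obtain U \<phi> where c: "(U, \<phi>) \<in> \<A>" "u \<in> U" using chart_at u by blast
    obtain \<epsilon> where \<epsilon>: "0 < \<epsilon>" "ball (\<phi> u) \<epsilon> \<subseteq> \<phi> ` (U \<inter> S)"
    proof -
      have "\<phi> u \<in> \<phi> ` (U \<inter> S)" using c(2) uS by blast
      then show thesis using open_chart_S[OF c(1)] that unfolding open_contains_ball by blast
    qed
    let ?f = "\<lambda>z. f (inv_into U \<phi> z)"
    have in_S: "inv_into U \<phi> z \<in> S" if "z \<in> ball (\<phi> u) \<epsilon>" for z
      using \<epsilon>(2) that chart_inv[OF c(1)] by auto
    have "?f constant_on ball (\<phi> u) \<epsilon>"
    proof (rule maximum_modulus_principle)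
      show "?f holomorphic_on ball (\<phi> u) \<epsilon>"
        using holomorphic_in_chart[OF f c(1)] \<epsilon>(2) by (rule holomorphic_on_subset)
      show "norm (?f z) \<le> norm (?f (\<phi> u))" if "z \<in> ball (\<phi> u) \<epsilon>" for z
      proof -
        have "g (inv_into U \<phi> z) = ?f z" using in_S[OF that] by (simp add: g_def affine_part_def)
        moreover have "g q = f u" using u uS by (simp add: g_def affine_part_def)
        ultimately show ?thesis
          using max[OF S_subset(1)[OF in_S[OF that]]] chart_inv[OF c] by simp
      qed
    qed (use \<epsilon> in auto)
    then have const: "?f z = f u" if "z \<in> ball (\<phi> u) \<epsilon>" for z
      using that \<epsilon>(1) chart_inv[OF c] unfolding constant_on_def by (metis centre_in_ball)
    have "{v \<in> U. \<phi> v \<in> ball (\<phi> u) \<epsilon>} \<subseteq> ?M"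
    proof
      fix v assume v: "v \<in> {v \<in> U. \<phi> v \<in> ball (\<phi> u) \<epsilon>}"
      then have "inv_into U \<phi> (\<phi> v) = v" using chart_inv[OF c(1)] by blast
      then have "f v = f u" "v \<in> S" using const[of "\<phi> v"] in_S[of "\<phi> v"] v by auto
      then show "v \<in> ?M" using u uS by (auto simp: g_def affine_part_def)
    qed
    then show "\<exists>V. openin X V \<and> u \<in> V \<and> V \<subseteq> ?M"
      using chart_preimage_open[OF c(1), of "ball (\<phi> u) \<epsilon>"] c(2) \<epsilon>(1)
      by (intro exI[of _ "{v \<in> U. \<phi> v \<in> ball (\<phi> u) \<epsilon>}"]) auto
  qed
  then have "?M = {} \<or> ?M = topspace X"
    using surface closed unfolding compact_riemann_surface_def connected_space_clopen_in by blast
  then have "P \<in> ?M" using q P_in by blast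
  then show False using gq by (simp add: g_def)
qed

lemma R_simps:
  "f \<oplus>\<^bsub>R\<^esub> g = (\<lambda>p\<in>S. f p + g p)" "f \<otimes>\<^bsub>R\<^esub> g = (\<lambda>p\<in>S. f p * g p)"
  "\<zero>\<^bsub>R\<^esub> = (\<lambda>p\<in>S. 0)" "\<one>\<^bsub>R\<^esub> = (\<lambda>p\<in>S. 1)"
  by (simp_all add: coordinate_ring_def)

lemma R_extensional: "f \<in> carrier R \<Longrightarrow> f \<in> extensional S"
  by (simp add: coordinate_ring_def coordinate_functions_def)

lemma R_eqI: "f \<in> carrier R \<Longrightarrow> g \<in> carrier R \<Longrightarrow> (\<And>p. p \<in> S \<Longrightarrow> f p = g p) \<Longrightarrow> f = g"
  by (rule extensionalityI[of _ S]) (auto dest: R_extensional)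

lemma restrict_in_R:
  assumes "\<And>U \<phi>. (U, \<phi>) \<in> \<A> \<Longrightarrow> (\<lambda>z. f (inv_into U \<phi> z)) holomorphic_on \<phi> ` (U \<inter> S)"
    and "\<And>U \<phi>. (U, \<phi>) \<in> \<A> \<Longrightarrow> P \<in> U \<Longrightarrow> (\<lambda>z. f (inv_into U \<phi> z)) meromorphic_on {\<phi> P}"
  shows "restrict f S \<in> carrier R"
proof -
  have "(\<lambda>z. restrict f S (inv_into U \<phi> z)) holomorphic_on \<phi> ` (U \<inter> S)" if c: "(U, \<phi>) \<in> \<A>" for U \<phi>
    by (rule holomorphic_transform[OF assms(1)[OF c]]) (auto simp: chart_inv[OF c])
  moreover have "(\<lambda>z. restrict f S (inv_into U \<phi> z)) meromorphic_on {\<phi> P}"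
    if c: "(U, \<phi>) \<in> \<A>" "P \<in> U" for U \<phi>
  proof -
    have "eventually (\<lambda>z. inv_into U \<phi> z \<in> S) (at (\<phi> P))"
      using eventually_S by (simp add: atin_chart[OF c] eventually_filtermap)
    then have "eventually (\<lambda>z. f (inv_into U \<phi> z) = restrict f S (inv_into U \<phi> z)) (at (\<phi> P))"
      by eventually_elim simp
    then have "(\<lambda>z. f (inv_into U \<phi> z)) meromorphic_on {\<phi> P} \<longleftrightarrow>
        (\<lambda>z. restrict f S (inv_into U \<phi> z)) meromorphic_on {\<phi> P}"
      by (intro meromorphic_on_cong) auto
    then show ?thesis using assms(2)[OF c] by blast
  qed
  ultimately show ?thesis by (auto simp: coordinate_ring_def coordinate_functions_def)
qed

lemma const_in_R: "(\<lambda>p\<in>S. c) \<in> carrier R"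
  by (rule restrict_in_R) auto

lemma add_in_R: "f \<in> carrier R \<Longrightarrow> g \<in> carrier R \<Longrightarrow> (\<lambda>p\<in>S. f p + g p) \<in> carrier R"
  by (intro restrict_in_R holomorphic_on_add meromorphic_on_add)
    (blast intro: holomorphic_in_chart meromorphic_in_chart)+

lemma mult_in_R: "f \<in> carrier R \<Longrightarrow> g \<in> carrier R \<Longrightarrow> (\<lambda>p\<in>S. f p * g p) \<in> carrier R"
  by (intro restrict_in_R holomorphic_on_mult meromorphic_on_mult)
    (blast intro: holomorphic_in_chart meromorphic_in_chart)+

lemma uminus_in_R: "f \<in> carrier R \<Longrightarrow> (\<lambda>p\<in>S. - f p) \<in> carrier R"
  by (intro restrict_in_R holomorphic_on_minus meromorphic_on_uminus)
    (blast intro: holomorphic_in_chart meromorphic_in_chart)+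

lemma cring_R: "cring R"
proof (rule cringI)
  show "abelian_group R"
  proof (rule abelian_groupI)
    show "\<exists>g\<in>carrier R. g \<oplus>\<^bsub>R\<^esub> f = \<zero>\<^bsub>R\<^esub>" if "f \<in> carrier R" for f
      using uminus_in_R[OF that]
      by (intro bexI[of _ "\<lambda>p\<in>S. - f p"]) (auto simp: R_simps restrict_def)
    show "\<zero>\<^bsub>R\<^esub> \<oplus>\<^bsub>R\<^esub> f = f" if "f \<in> carrier R" for f
      unfolding R_simps by (rule R_eqI[OF add_in_R[OF const_in_R that] that]) auto
  qed (auto simp: R_simps add_in_R const_in_R fun_eq_iff algebra_simps)
  show "Group.comm_monoid R"
  proof (rule comm_monoidI)
    show "\<one>\<^bsub>R\<^esub> \<otimes>\<^bsub>R\<^esub> f = f" if "f \<in> carrier R" for f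
      unfolding R_simps by (rule R_eqI[OF mult_in_R[OF const_in_R that] that]) auto
  qed (auto simp: R_simps mult_in_R const_in_R fun_eq_iff algebra_simps)
  show "(f \<oplus>\<^bsub>R\<^esub> g) \<otimes>\<^bsub>R\<^esub> h = f \<otimes>\<^bsub>R\<^esub> h \<oplus>\<^bsub>R\<^esub> g \<otimes>\<^bsub>R\<^esub> h"
    if "f \<in> carrier R" "g \<in> carrier R" "h \<in> carrier R" for f g h
    by (auto simp: R_simps restrict_def algebra_simps)
qed

sublocale R: cring R by (rule cring_R)

lemma uminus_R: "f \<in> carrier R \<Longrightarrow> \<ominus>\<^bsub>R\<^esub> f = (\<lambda>p\<in>S. - f p)"
  by (rule R.minus_equality) (auto simp: R_simps intro: uminus_in_R)

lemma minus_R: "f \<in> carrier R \<Longrightarrow> g \<in> carrier R \<Longrightarrow> f \<ominus>\<^bsub>R\<^esub> g = (\<lambda>p\<in>S. f p - g p)"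
  by (auto simp: R.minus_eq uminus_R R_simps restrict_def)

lemma power_R: "f \<in> carrier R \<Longrightarrow> f [^]\<^bsub>R\<^esub> n = (\<lambda>p\<in>S. f p ^ n)" for n :: nat
  by (induction n) (auto simp: R_simps restrict_def)

lemma finsum_R:
  assumes "finite I" "\<And>i. i \<in> I \<Longrightarrow> f i \<in> carrier R"
  shows "(\<Oplus>\<^bsub>R\<^esub>i\<in>I. f i) = (\<lambda>p\<in>S. \<Sum>i\<in>I. f i p)"
  using assms
proof (induction I rule: finite_induct)
  case empty then show ?case by (simp add: R_simps)
next
  case (insert i I)
  then show ?case by (auto simp: R_simps restrict_def Pi_def)
qed

lemma finprod_R:
  assumes "finite I" "\<And>i. i \<in> I \<Longrightarrow> f i \<in> carrier R"
  shows "(\<Otimes>\<^bsub>R\<^esub>i\<in>I. f i) = (\<lambda>p\<in>S. \<Prod>i\<in>I. f i p)"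
  using assms
proof (induction I rule: finite_induct)
  case empty then show ?case by (simp add: R_simps)
next
  case (insert i I)
  then show ?case by (auto simp: R_simps restrict_def Pi_def)
qed

text \<open>The weight is a \<^const>\<open>zorder\<close> in one chosen chart. With \<open>w\<close> the coordinate of that chart, it is
  characterized by a limit at \<open>P\<close> that no longer mentions the chart.\<close>

lemma order_in_chart:
  obtains w where "(w \<longlongrightarrow> 0) (atin X P)" "eventually (\<lambda>p. w p \<noteq> 0) (atin X P)"
    "\<And>f. f \<in> carrier R \<Longrightarrow> f \<noteq> \<zero>\<^bsub>R\<^esub> \<Longrightarrow>
      \<exists>c. c \<noteq> 0 \<and> ((\<lambda>p. f p * w p powi (- wt \<A> P f)) \<longlongrightarrow> c) (atin X P)"
proof -
  obtain U\<^sub>0 \<phi>\<^sub>0 where "(U\<^sub>0, \<phi>\<^sub>0) \<in> \<A>" "P \<in> U\<^sub>0" using chart_at[OF P_in] .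
  then have "\<exists>c. c \<in> \<A> \<and> P \<in> fst c" by force
  then have some: "(SOME c. c \<in> \<A> \<and> P \<in> fst c) \<in> \<A> \<and> P \<in> fst (SOME c. c \<in> \<A> \<and> P \<in> fst c)"
    by (rule someI_ex)
  obtain U \<phi> where eq: "(SOME c. c \<in> \<A> \<and> P \<in> fst c) = (U, \<phi>)" by fastforce
  then have c: "(U, \<phi>) \<in> \<A>" "P \<in> U" using some by simp_all
  have wt: "wt \<A> P f = zorder (\<lambda>z. f (inv_into U \<phi> z)) (\<phi> P)" for f
    by (simp add: wt_def eq)
  define w where "w p = \<phi> p - \<phi> P" for p
  have "open (\<phi> ` U)" by (rule chart(2)[OF c(1)])
  then have ev: "eventually (\<lambda>z. z \<in> \<phi> ` U) (at (\<phi> P))"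
    using c(2) by (intro eventually_at_in_open') auto
  then have w: "eventually (\<lambda>z. z - \<phi> P = w (inv_into U \<phi> z)) (at (\<phi> P))"
    by eventually_elim (auto simp: w_def chart_inv[OF c(1)])
  show thesis
  proof
    have "((\<lambda>z. z - \<phi> P) \<longlongrightarrow> 0) (at (\<phi> P))" by (auto intro!: tendsto_eq_intros)
    then show "(w \<longlongrightarrow> 0) (atin X P)"
      unfolding tendsto_atin_chart[OF c] using tendsto_cong[OF w] by blast
    have "eventually (\<lambda>z. z \<noteq> \<phi> P) (at (\<phi> P))" by (simp add: eventually_at_filter)
    then show "eventually (\<lambda>p. w p \<noteq> 0) (atin X P)"
      unfolding atin_chart[OF c] eventually_filtermap using w by eventually_elim auto
  next
    fix f assume f: "f \<in> carrier R" "f \<noteq> \<zero>\<^bsub>R\<^esub>"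
    define g where "g z = f (inv_into U \<phi> z)" for z
    define n where "n = zorder g (\<phi> P)"
    have mero: "isolated_singularity_at g (\<phi> P)" "not_essential g (\<phi> P)"
      using meromorphic_in_chart[OF f(1) c] unfolding meromorphic_at_iff g_def by auto
    have freq: "\<exists>\<^sub>F z in at (\<phi> P). g z \<noteq> 0"
    proof (rule ccontr)
      assume "\<not> (\<exists>\<^sub>F z in at (\<phi> P). g z \<noteq> 0)"
      then have "eventually (\<lambda>z. g z = 0) (at (\<phi> P))" by (simp add: frequently_def)
      then have "(g \<longlongrightarrow> 0) (at (\<phi> P))" by (rule tendsto_eventually)
      then have "(f \<longlongrightarrow> 0) (atin X P)" unfolding tendsto_atin_chart[OF c] by (simp add: g_def[abs_def])
      then have "f = \<zero>\<^bsub>R\<^esub>"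
        by (intro R_eqI) (auto simp: f R_simps vanishes_at_P_imp_zero const_in_R)
      then show False using f(2) by blast
    qed
    let ?h = "zor_poly g (\<phi> P)"
    obtain \<epsilon> where \<epsilon>: "?h (\<phi> P) \<noteq> 0" "0 < \<epsilon>" "?h holomorphic_on cball (\<phi> P) \<epsilon>"
      "\<And>z. z \<in> cball (\<phi> P) \<epsilon> - {\<phi> P} \<Longrightarrow> g z = ?h z * (z - \<phi> P) powi n"
      using zorder_exist[OF mero freq] unfolding n_def by blast
    have "isCont ?h (\<phi> P)"
      using holomorphic_on_imp_continuous_on[OF \<epsilon>(3)] \<epsilon>(2) by (intro continuous_on_interior) auto
    then have "(?h \<longlongrightarrow> ?h (\<phi> P)) (at (\<phi> P))" by (simp add: isCont_def)
    moreover have "eventually (\<lambda>z. z \<in> ball (\<phi> P) \<epsilon> - {\<phi> P}) (at (\<phi> P))"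
      using \<epsilon>(2) by (intro eventually_at_in_open) auto
    then have "eventually (\<lambda>z. ?h z = g z * w (inv_into U \<phi> z) powi (- n)) (at (\<phi> P))"
      using w
    proof eventually_elim
      case (elim z)
      then have "g z = ?h z * (z - \<phi> P) powi n" "z - \<phi> P \<noteq> 0" using \<epsilon>(4)[of z] by auto
      then show ?case unfolding elim(2)[symmetric] by (simp add: power_int_minus field_simps)
    qed
    ultimately have "((\<lambda>z. g z * w (inv_into U \<phi> z) powi (- n)) \<longlongrightarrow> ?h (\<phi> P)) (at (\<phi> P))"
      by (rule Lim_transform_eventually)
    then have "((\<lambda>p. f p * w p powi (- n)) \<longlongrightarrow> ?h (\<phi> P)) (atin X P)"
      unfolding tendsto_atin_chart[OF c] g_def .
    then show "\<exists>c. c \<noteq> 0 \<and> ((\<lambda>p. f p * w p powi (- wt \<A> P f)) \<longlongrightarrow> c) (atin X P)"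
      using \<epsilon>(1) unfolding wt n_def g_def by blast
  qed
qed

end

section \<open>Polynomials modulo a cyclic relation\<close>

lemma map_poly_eval_mult:
  "map_poly (\<lambda>c. poly c (1 :: 'a :: comm_ring_1)) (p * q) =
     map_poly (\<lambda>c. poly c 1) p * map_poly (\<lambda>c. poly c 1) q"
  by (rule poly_eqI) (simp add: coeff_map_poly coeff_mult poly_sum)

lemma map_poly_eval_diff:
  "map_poly (\<lambda>c. poly c (1 :: 'a :: comm_ring_1)) (p - q) =
     map_poly (\<lambda>c. poly c 1) p - map_poly (\<lambda>c. poly c 1) q"
  by (rule poly_eqI) (simp add: coeff_map_poly)

lemma map_poly_eval_sum:
  "map_poly (\<lambda>c. poly c (1 :: 'a :: comm_ring_1)) (\<Sum>i\<in>I. p i) =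
     (\<Sum>i\<in>I. map_poly (\<lambda>c. poly c 1) (p i))"
  by (rule poly_eqI) (simp add: coeff_map_poly coeff_sum poly_sum)

lemma map_poly_eval_monom:
  "map_poly (\<lambda>c. poly c (1 :: 'a :: comm_ring_1)) (monom c n) = monom (poly c 1) n"
  by (rule poly_eqI) (simp add: coeff_map_poly)

lemma monom_mod_cyclic:
  fixes c :: "'a :: comm_ring_1"
  shows "(monom 1 r - 1) dvd (monom c n - monom c (n mod r))"
proof -
  have "monom c n = monom c (n mod r) * monom 1 r ^ (n div r)"
    by (simp add: monom_power mult_monom flip: mult.commute[of _ r])
  then have "monom c n - monom c (n mod r) = monom c (n mod r) * (monom 1 r ^ (n div r) - 1)"
    by (simp add: algebra_simps)
  also have "monom 1 r ^ (n div r) - 1 = (monom 1 r - 1) * (\<Sum>i<n div r. monom (1 :: 'a) r ^ i)"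
    by (rule power_diff_1_eq)
  finally show ?thesis by (simp add: mult.left_commute)
qed

text \<open>Put \<open>z = 1\<close>: the relation \<open>z' ^ r - z ^ r\<close> becomes \<open>z' ^ r - 1\<close>, modulo which an exponent of \<open>z'\<close>
  can be replaced by its residue modulo \<open>r\<close>. After this reduction the difference has degree below \<open>r\<close>,
  so it is zero and its coefficients can be compared.\<close>

lemma leading_class_sums:
  fixes c :: "nat \<Rightarrow> complex" and e w A :: "nat \<Rightarrow> nat"
  assumes r: "0 < r"
    and inj: "\<And>i j. i < r \<Longrightarrow> j < r \<Longrightarrow> e i mod r = e j mod r \<Longrightarrow> i = j"
    and dvd: "(monom 1 r - [:monom 1 r:]) dvd
      ((\<Sum>k<N. monom (monom (c k) (A k)) (w k)) - (\<Sum>i<r. monom (monom 1 (d - e i)) (e i)))"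
    and i: "i < r"
  shows "(\<Sum>k<N. if w k mod r = e i mod r then c k else 0) = 1"
proof -
  let ?\<phi> = "map_poly (\<lambda>c. poly c (1 :: complex))"
  define D where "D = monom (1 :: complex) r - 1"
  have D: "?\<phi> (monom 1 r - [:monom 1 r:]) = D"
    by (simp add: map_poly_eval_diff map_poly_eval_monom D_def map_poly_pCons poly_monom
        flip: monom_0)
  have deg: "degree D = r"
  proof -
    have "degree (monom (1 :: complex) r + (- 1)) = degree (monom (1 :: complex) r)"
      by (rule degree_add_eq_left) (simp add: degree_monom_eq r)
    then show ?thesis by (simp add: D_def degree_monom_eq)
  qed
  obtain q where "(\<Sum>k<N. monom (monom (c k) (A k)) (w k)) - (\<Sum>i<r. monom (monom 1 (d - e i)) (e i))
      = (monom 1 r - [:monom 1 r:]) * q"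
    using dvd by (elim dvdE)
  from arg_cong[OF this, of ?\<phi>]
  have "?\<phi> ((\<Sum>k<N. monom (monom (c k) (A k)) (w k)) - (\<Sum>i<r. monom (monom 1 (d - e i)) (e i)))
      = D * ?\<phi> q"
    by (simp only: map_poly_eval_mult D)
  then have "(\<Sum>k<N. monom (c k) (w k)) - (\<Sum>i<r. monom 1 (e i)) = D * ?\<phi> q"
    by (simp add: map_poly_eval_diff map_poly_eval_sum map_poly_eval_monom poly_monom)
  then have 1: "D dvd (\<Sum>k<N. monom (c k) (w k)) - (\<Sum>i<r. monom 1 (e i))" by simp
  have 2: "D dvd (\<Sum>k<N. monom (c k) (w k)) - (\<Sum>k<N. monom (c k) (w k mod r))"
    unfolding sum_subtractf[symmetric] D_def by (intro dvd_sum monom_mod_cyclic)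
  have 3: "D dvd (\<Sum>i<r. monom 1 (e i)) - (\<Sum>i<r. monom 1 (e i mod r))"
    unfolding sum_subtractf[symmetric] D_def by (intro dvd_sum monom_mod_cyclic)
  define p where "p = (\<Sum>k<N. monom (c k) (w k mod r)) - (\<Sum>i<r. monom 1 (e i mod r))"
  have "D dvd p" using dvd_diff[OF dvd_add[OF 1 3] 2] by (simp add: p_def algebra_simps)
  moreover have "degree p < r"
  proof -
    have monom_degree: "degree (monom b (k mod r)) < r" for b :: complex and k
      using degree_monom_le[of b "k mod r"] mod_less_divisor[OF r, of k] by (rule le_less_trans)
    have "degree (\<Sum>k<N. monom (c k) (w k mod r)) < r"
      by (rule degree_sum_less) (use r monom_degree in simp_all)
    moreover have "degree (\<Sum>i<r. monom (1 :: complex) (e i mod r)) < r"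
      by (rule degree_sum_less) (use r monom_degree in simp_all)
    ultimately show ?thesis unfolding p_def by (rule degree_diff_less)
  qed
  ultimately have "p = 0" using dvd_imp_degree_le[of D p] deg by force
  then have "0 = coeff p (e i mod r)" by simp
  also have "\<dots> = (\<Sum>k<N. if w k mod r = e i mod r then c k else 0)
      - (\<Sum>j<r. if e j mod r = e i mod r then 1 else 0)"
    by (simp add: p_def coeff_sum)
  also have "(\<Sum>j<r. if e j mod r = e i mod r then 1 else 0) = (\<Sum>j<r. if j = i then 1 else (0 :: complex))"
  proof (rule sum.cong)
    fix j assume "j \<in> {..<r}"
    then have "e j mod r = e i mod r \<longleftrightarrow> j = i" using inj[of j i] i by blast
    then show "(if e j mod r = e i mod r then 1 else 0) = (if j = i then 1 else (0 :: complex))" by simp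
  qed simp
  also have "\<dots> = 1" using i by simp
  finally show ?thesis by simp
qed

section \<open>Standard bases of numerical semigroups\<close>

lemma standard_basis_representative:
  assumes "standard_basis H r e" "h \<in> H"
  obtains i where "i < r" "e i mod r = h mod r" "e i \<le> h"
proof -
  define h0 where "h0 = (LEAST n. n \<in> H \<and> n mod r = h mod r)"
  have h0: "h0 \<in> H \<and> h0 mod r = h mod r"
    unfolding h0_def by (rule LeastI[of _ h]) (use assms(2) in simp)
  have least: "h0 \<le> n" if "n \<in> H" "n mod r = h mod r" for n
    unfolding h0_def by (rule Least_le) (use that in simp)
  have "h0 \<in> e ` {..<r}"
    using assms(1) h0 least unfolding standard_basis_def by auto
  then show thesis using that h0 least[OF assms(2)] by auto
qed

lemma standard_basis_inj:
  assumes "standard_basis H r e" "i < r" "j < r" "e i mod r = e j mod r"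
  shows "i = j"
proof -
  have min: "e k \<in> {h \<in> H. \<forall>h'\<in>H. h' mod r = h mod r \<longrightarrow> h \<le> h'}" if "k < r" for k
    using assms(1) that unfolding standard_basis_def by blast
  have "e i = e j"
    using min[OF assms(2)] min[OF assms(3)] assms(4) by (auto intro!: antisym)
  moreover have "inj_on e {..<r}"
    using assms(1) unfolding standard_basis_def by (intro strict_mono_on_imp_inj_on) blast
  ultimately show ?thesis using assms(2,3) by (auto dest: inj_onD)
qed

lemma eval2_altdef: "eval2 f a b = (\<Sum>i\<le>degree f. poly (coeff f i) a * b ^ i)"
  by (simp add: eval2_def poly_altdef[of f] poly_sum)

section \<open>Leading coefficients on a Weierstrass curve\<close>

locale weierstrass =
  fixes X :: "'p topology" and \<A> :: "'p atlas" and P :: 'p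
    and r m i_s i_r :: nat and e \<rho> :: "nat \<Rightarrow> nat" and f\<^sub>X :: "complex poly poly"
    and x :: "'p \<Rightarrow> complex" and y :: "nat \<Rightarrow> 'p \<Rightarrow> complex"
    and \<nu> :: "nat \<Rightarrow> nat \<Rightarrow> nat" and \<yy> :: "nat \<Rightarrow> 'p \<Rightarrow> complex"
  assumes curve: "weierstrass_curve X \<A> P r e m \<rho> f\<^sub>X i_s i_r x y"
    and basis: "\<forall>i<r. \<yy> i = y_monomial X P m y (\<nu> i) \<and> wt \<A> P (\<yy> i) = - int (e i)"
begin

sublocale pointed_surface X \<A> P
  using curve by unfold_locales (simp_all add: weierstrass_curve_def Let_def)

abbreviation "H \<equiv> weierstrass_semigroup X \<A> P"
abbreviation "s \<equiv> \<rho> 2"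
abbreviation "K \<equiv> base_ring X P x"
abbreviation "X_poly \<equiv> poly_in_x X P x"

definition t where "t p = x p ^ i_r / y 2 p ^ i_s"

text \<open>Pole order at most \<open>n\<close>, with \<open>c\<close> as coefficient of \<open>t powi (- n)\<close>. The value \<open>c = 0\<close> is allowed
  and expresses pole order below \<open>n\<close>, which makes the predicate additive. Natural exponents suffice
  because no nonzero element of \<open>R\<close> vanishes at \<open>P\<close>.\<close>

definition lead :: "nat \<Rightarrow> complex \<Rightarrow> ('p \<Rightarrow> complex) \<Rightarrow> bool" where
  "lead n c f \<longleftrightarrow> ((\<lambda>p. f p * t p ^ n) \<longlongrightarrow> c) (atin X P)"

lemma r_pos: "0 < r" and m_ge: "2 \<le> m" and std: "standard_basis H r e"
  and x_in: "x \<in> carrier R" and wt_x: "wt \<A> P x = - int r"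
  and y_in: "j \<in> {2..m} \<Longrightarrow> y j \<in> carrier R" and wt_y: "j \<in> {2..m} \<Longrightarrow> wt \<A> P (y j) = - int (\<rho> j)"
  and i_r_pos: "0 < i_r" and i_s_eq: "i_s * s = i_r * r + 1"
  and degree_f: "degree f\<^sub>X = r" and lead_f: "coeff f\<^sub>X r = 1"
  and degree_coeff: "i \<in> {1..r} \<Longrightarrow> r * degree (coeff f\<^sub>X (r - i)) \<le> i * s"
  and coeff_s: "coeff (coeff f\<^sub>X 0) s = -1"
  using curve by (auto simp: weierstrass_curve_def Let_def)

lemma coprime_s: "coprime s r"
  using curve by (auto simp: weierstrass_curve_def Let_def)

lemma s_pos: "0 < s"
  using i_s_eq by (intro gr0I) auto

lemma lead_y: "j \<in> {2..m} \<Longrightarrow> lead (\<rho> j) 1 (y j)"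
  using curve by (auto simp: weierstrass_curve_def Let_def lead_def t_def)

lemma y2: "y 2 \<in> carrier R" "wt \<A> P (y 2) = - int s" "lead s 1 (y 2)"
  using m_ge y_in[of 2] wt_y[of 2] lead_y[of 2] by auto

lemma curve_equation:
  assumes "p \<in> S" shows "(\<Sum>i\<le>r. poly (coeff f\<^sub>X i) (x p) * y 2 p ^ i) = 0"
proof -
  have "normalization_map S x (y 2) f\<^sub>X"
    using curve by (auto simp: weierstrass_curve_def Let_def)
  then have "(x p, y 2 p) \<in> plane_curve f\<^sub>X"
    using assms unfolding normalization_map_def by blast
  then show ?thesis by (simp add: plane_curve_def eval2_altdef degree_f)
qed

text \<open>The product \<open>y 2 * t ^ s\<close> tends to \<open>1\<close>. At a zero of \<open>x\<close> or \<open>y 2\<close> it is \<open>0\<close>, because \<open>t\<close> is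
  \<open>0\<close> there; for a zero of \<open>y 2\<close> this is the convention for division by zero.\<close>

lemma eventually_nonzero:
  "eventually (\<lambda>p. t p \<noteq> 0 \<and> x p \<noteq> 0 \<and> y 2 p \<noteq> 0) (atin X P)"
proof -
  have "eventually (\<lambda>p. y 2 p * t p ^ s \<noteq> 0) (atin X P)"
    using y2(3) unfolding lead_def by (rule tendsto_imp_eventually_ne) simp
  then show ?thesis
    by eventually_elim (use s_pos i_r_pos in \<open>auto simp: t_def\<close>)
qed

lemma nonzeroI:
  assumes "eventually (\<lambda>p. f p \<noteq> 0) (atin X P)" shows "f \<noteq> \<zero>\<^bsub>R\<^esub>"
proof
  assume zero: "f = \<zero>\<^bsub>R\<^esub>"
  from assms eventually_S have "eventually (\<lambda>p. False) (atin X P)"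
    by eventually_elim (simp add: zero R_simps)
  then show False using atin_P_nontrivial by (simp add: eventually_False)
qed

lemma x_nonzero: "x \<noteq> \<zero>\<^bsub>R\<^esub>" and y2_nonzero: "y 2 \<noteq> \<zero>\<^bsub>R\<^esub>"
  by (rule nonzeroI, use eventually_nonzero in eventually_elim, simp)+

text \<open>In terms of a chart coordinate \<open>w\<close>, the quotient \<open>t / w\<close> equals
  \<open>(x * w ^ r) ^ i_r / (y 2 * w ^ s) ^ i_s\<close>, because \<open>i_s * s - i_r * r = 1\<close>. Both bases have nonzero
  limits, so \<open>t\<close> can replace \<open>w\<close> as a local parameter.\<close>

lemma t_tendsto_0: "(t \<longlongrightarrow> 0) (atin X P)"
  and order_wrt_t: "f \<in> carrier R \<Longrightarrow> f \<noteq> \<zero>\<^bsub>R\<^esub> \<Longrightarrow>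
    \<exists>c. c \<noteq> 0 \<and> ((\<lambda>p. f p * t p powi (- wt \<A> P f)) \<longlongrightarrow> c) (atin X P)"
proof -
  obtain w where w: "(w \<longlongrightarrow> 0) (atin X P)" "eventually (\<lambda>p. w p \<noteq> 0) (atin X P)"
    "\<And>f. f \<in> carrier R \<Longrightarrow> f \<noteq> \<zero>\<^bsub>R\<^esub> \<Longrightarrow>
      \<exists>c. c \<noteq> 0 \<and> ((\<lambda>p. f p * w p powi (- wt \<A> P f)) \<longlongrightarrow> c) (atin X P)"
    by (rule order_in_chart) blast
  obtain a where a: "a \<noteq> 0" "((\<lambda>p. x p * w p ^ r) \<longlongrightarrow> a) (atin X P)"
    using w(3)[OF x_in x_nonzero] by (auto simp: wt_x)
  obtain b where b: "b \<noteq> 0" "((\<lambda>p. y 2 p * w p ^ s) \<longlongrightarrow> b) (atin X P)"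
    using w(3)[OF y2(1) y2_nonzero] by (auto simp: y2(2))
  define \<kappa> where "\<kappa> = a ^ i_r / b ^ i_s"
  have \<kappa>: "\<kappa> \<noteq> 0" using a b by (simp add: \<kappa>_def)
  have "((\<lambda>p. (x p * w p ^ r) ^ i_r / (y 2 p * w p ^ s) ^ i_s) \<longlongrightarrow> \<kappa>) (atin X P)"
    unfolding \<kappa>_def using a b by (intro tendsto_intros) auto
  moreover have "eventually (\<lambda>p. (x p * w p ^ r) ^ i_r / (y 2 p * w p ^ s) ^ i_s = t p / w p) (atin X P)"
    using w(2) eventually_nonzero
  proof eventually_elim
    case (elim p)
    have "(w p ^ s) ^ i_s = (w p ^ r) ^ i_r * w p"
      using i_s_eq by (simp add: power_mult[symmetric] mult.commute)
    then show ?case using elim by (simp add: t_def power_mult_distrib field_simps)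
  qed
  ultimately have tw: "((\<lambda>p. t p / w p) \<longlongrightarrow> \<kappa>) (atin X P)" by (rule Lim_transform_eventually)
  have "((\<lambda>p. t p / w p * w p) \<longlongrightarrow> \<kappa> * 0) (atin X P)" by (intro tendsto_mult tw w(1))
  moreover have "eventually (\<lambda>p. t p / w p * w p = t p) (atin X P)"
    using w(2) by eventually_elim simp
  ultimately show "(t \<longlongrightarrow> 0) (atin X P)" using Lim_transform_eventually by fastforce
  assume f: "f \<in> carrier R" "f \<noteq> \<zero>\<^bsub>R\<^esub>"
  let ?k = "- wt \<A> P f"
  obtain c where c: "c \<noteq> 0" "((\<lambda>p. f p * w p powi ?k) \<longlongrightarrow> c) (atin X P)" using w(3)[OF f] by blast
  have "((\<lambda>p. f p * w p powi ?k * (t p / w p) powi ?k) \<longlongrightarrow> c * \<kappa> powi ?k) (atin X P)"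
    by (intro tendsto_mult tendsto_power_int c tw \<kappa>)
  moreover have "eventually (\<lambda>p. f p * w p powi ?k * (t p / w p) powi ?k = f p * t p powi ?k) (atin X P)"
    using w(2) by eventually_elim (simp add: power_int_divide_distrib)
  ultimately have "((\<lambda>p. f p * t p powi ?k) \<longlongrightarrow> c * \<kappa> powi ?k) (atin X P)"
    by (rule Lim_transform_eventually)
  then show "\<exists>c. c \<noteq> 0 \<and> ((\<lambda>p. f p * t p powi ?k) \<longlongrightarrow> c) (atin X P)"
    using c(1) \<kappa> by (intro exI[of _ "c * \<kappa> powi ?k"]) simp
qed

lemma lead_cong:
  assumes "lead n c f" "\<And>p. p \<in> S \<Longrightarrow> f p = g p" shows "lead n c g"
  unfolding lead_def
proof (rule Lim_transform_eventually)
  show "((\<lambda>p. f p * t p ^ n) \<longlongrightarrow> c) (atin X P)" using assms(1) by (simp add: lead_def)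
  show "eventually (\<lambda>p. f p * t p ^ n = g p * t p ^ n) (atin X P)"
    using eventually_S by eventually_elim (simp add: assms(2))
qed

lemma lead_unique: "lead n c f \<Longrightarrow> lead n c' f \<Longrightarrow> c = c'"
  unfolding lead_def by (rule tendsto_unique[OF atin_P_nontrivial])

lemma lead_mono:
  assumes "lead n c f" "n < n'" shows "lead n' 0 f"
proof -
  have "((\<lambda>p. f p * t p ^ n * t p ^ (n' - n)) \<longlongrightarrow> c * 0 ^ (n' - n)) (atin X P)"
    using assms(1) unfolding lead_def by (intro tendsto_mult tendsto_power t_tendsto_0)
  moreover have "f p * t p ^ n * t p ^ (n' - n) = f p * t p ^ n'" for p
  proof -
    have "t p ^ n' = t p ^ n * t p ^ (n' - n)" using assms(2) by (simp flip: power_add)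
    then show ?thesis by (simp only: mult.assoc)
  qed
  moreover have "c * 0 ^ (n' - n) = 0" using assms(2) by simp
  ultimately show ?thesis by (simp add: lead_def)
qed

lemma lead_zero: "lead n 0 (\<lambda>p. 0)"
  by (simp add: lead_def)

lemma lead_const: "lead 0 c (\<lambda>p. c)"
  by (simp add: lead_def)

lemma lead_add: "lead n c f \<Longrightarrow> lead n c' g \<Longrightarrow> lead n (c + c') (\<lambda>p. f p + g p)"
  unfolding lead_def distrib_right by (rule tendsto_add)

lemma lead_diff: "lead n c f \<Longrightarrow> lead n c' g \<Longrightarrow> lead n (c - c') (\<lambda>p. f p - g p)"
  unfolding lead_def left_diff_distrib by (rule tendsto_diff)

lemma lead_mult:
  assumes "lead n c f" "lead k c' g" shows "lead (n + k) (c * c') (\<lambda>p. f p * g p)"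
proof -
  have "((\<lambda>p. (f p * t p ^ n) * (g p * t p ^ k)) \<longlongrightarrow> c * c') (atin X P)"
    using assms unfolding lead_def by (rule tendsto_mult)
  then show ?thesis by (simp add: lead_def power_add mult_ac)
qed

lemma lead_sum: "(\<And>i. i \<in> I \<Longrightarrow> lead n (c i) (f i)) \<Longrightarrow> lead n (\<Sum>i\<in>I. c i) (\<lambda>p. \<Sum>i\<in>I. f i p)"
  unfolding lead_def sum_distrib_right by (rule tendsto_sum)

lemma lead_power: "lead n c f \<Longrightarrow> lead (n * k) (c ^ k) (\<lambda>p. f p ^ k)"
proof (induction k)
  case 0 then show ?case using lead_const[of 1] by simp
next
  case (Suc k) then show ?case using lead_mult[of n c f "n * k"] by simp
qed

lemma lead_prod:
  "finite I \<Longrightarrow> (\<And>i. i \<in> I \<Longrightarrow> lead (n i) (c i) (f i)) \<Longrightarrow>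
     lead (\<Sum>i\<in>I. n i) (\<Prod>i\<in>I. c i) (\<lambda>p. \<Prod>i\<in>I. f i p)"
proof (induction I rule: finite_induct)
  case empty then show ?case using lead_const[of 1] by simp
next
  case (insert i I) then show ?case by (auto intro!: lead_mult)
qed

text \<open>A negative pole order would mean that \<open>f\<close> vanishes at \<open>P\<close>, which the maximum principle excludes.\<close>

lemma lead_exists:
  assumes f: "f \<in> carrier R" "f \<noteq> \<zero>\<^bsub>R\<^esub>"
  obtains n c where "c \<noteq> 0" "lead n c f" "wt \<A> P f = - int n"
proof -
  let ?k = "- wt \<A> P f"
  obtain c where c: "c \<noteq> 0" "((\<lambda>p. f p * t p powi ?k) \<longlongrightarrow> c) (atin X P)"
    using order_wrt_t[OF f] by blast
  have "0 \<le> ?k"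
  proof (rule ccontr)
    assume neg: "\<not> 0 \<le> ?k"
    have "((\<lambda>p. f p * t p powi ?k * t p ^ nat (- ?k)) \<longlongrightarrow> c * 0 ^ nat (- ?k)) (atin X P)"
      by (intro tendsto_mult tendsto_power t_tendsto_0 c)
    moreover have "eventually (\<lambda>p. f p * t p powi ?k * t p ^ nat (- ?k) = f p) (atin X P)"
      using eventually_nonzero
    proof eventually_elim
      case (elim p)
      have "t p powi ?k * t p ^ nat (- ?k) = t p powi ?k * t p powi (- ?k)"
        using neg by (simp add: power_int_def)
      also have "\<dots> = 1" using elim by (simp flip: power_int_add)
      finally show ?case by (simp add: mult.assoc)
    qed
    ultimately have "(f \<longlongrightarrow> 0) (atin X P)"
      using neg Lim_transform_eventually by (fastforce simp: zero_power)
    then have "f = \<zero>\<^bsub>R\<^esub>"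
      by (intro R_eqI) (auto simp: f R_simps vanishes_at_P_imp_zero const_in_R)
    then show False using f(2) by blast
  qed
  then obtain n where n: "?k = int n" by (rule nonneg_int_cases)
  have "lead n c f" using c(2) unfolding lead_def n by simp
  then show thesis using that[of c n] c(1) n by simp
qed

lemma lead_nonzero:
  assumes "lead n c f" "c \<noteq> 0" shows "f \<noteq> \<zero>\<^bsub>R\<^esub>"
proof
  assume "f = \<zero>\<^bsub>R\<^esub>"
  then have "lead n 0 f" using lead_cong[OF lead_zero, of f] by (simp add: R_simps)
  then show False using lead_unique assms by blast
qed

lemma lead_wt:
  assumes f: "f \<in> carrier R" and "lead n c f" "c \<noteq> 0" shows "wt \<A> P f = - int n"
proof -
  obtain n' c' where n': "c' \<noteq> 0" "lead n' c' f" "wt \<A> P f = - int n'"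
    using lead_exists[OF f lead_nonzero[OF assms(2,3)]] .
  have "n = n'"
    using lead_mono[OF assms(2), of n'] lead_mono[OF n'(2), of n] lead_unique assms(2,3) n'(1,2)
    by (metis linorder_neqE_nat)
  then show ?thesis using n' by simp
qed

lemma lead_0_imp_zero:
  assumes f: "f \<in> carrier R" "lead 0 0 f" shows "f = \<zero>\<^bsub>R\<^esub>"
proof (rule R_eqI)
  show "f p = \<zero>\<^bsub>R\<^esub> p" if "p \<in> S" for p
    using vanishes_at_P_imp_zero[OF f(1) _ that] f(2) that by (simp add: lead_def R_simps)
qed (use f const_in_R in \<open>auto simp: R_simps\<close>)

lemma lead_lower_weight:
  assumes f: "f \<in> carrier R" "lead n 0 f" shows "lower_weight X \<A> P (int n) f"
proof (cases "f = \<zero>\<^bsub>R\<^esub>")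
  case True then show ?thesis using f by (simp add: lower_weight_def)
next
  case False
  obtain n' c' where n': "c' \<noteq> 0" "lead n' c' f" "wt \<A> P f = - int n'"
    using lead_exists[OF f(1) False] .
  have "n' < n"
    using lead_mono[OF f(2), of n'] lead_unique f(2) n'(1,2) by (metis linorder_neqE_nat)
  then show ?thesis using f n' by (simp add: lower_weight_def)
qed

lemma in_H:
  assumes "f \<in> carrier R" "lead n c f" "c \<noteq> 0" shows "n \<in> H"
  using assms lead_wt lead_nonzero unfolding weierstrass_semigroup_def by blast

lemma sum_multiples:
  fixes c :: "nat \<Rightarrow> complex"
  assumes "\<And>k. n < k \<Longrightarrow> c k = 0"
  shows "(\<Sum>k\<le>n. if r * k = N then c k else 0) = (if r dvd N then c (N div r) else 0)"
proof (cases "r dvd N")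
  case True
  then obtain j where j: "N = r * j" by blast
  have "(\<Sum>k\<le>n. if r * k = N then c k else 0) = (\<Sum>k\<le>n. if k = j then c k else 0)"
    using r_pos by (simp add: j)
  then show ?thesis using r_pos assms[of j] by (auto simp: j not_le)
next
  case False
  then have "r * k \<noteq> N" for k by auto
  then show ?thesis using False by simp
qed

text \<open>The leading coefficient \<open>\<mu>\<close> of \<open>x\<close> is kept general here, because the lemma is needed in the proof
  that \<open>\<mu> = 1\<close>.\<close>

lemma lead_poly_gen:
  assumes x: "lead r \<mu> x" and q: "\<And>k. N < r * k \<Longrightarrow> coeff q k = 0"
  shows "lead N (if r dvd N then coeff q (N div r) * \<mu> ^ (N div r) else 0) (\<lambda>p. poly q (x p))"
proof -
  have monomial: "lead N (if r * k = N then coeff q k * \<mu> ^ k else 0) (\<lambda>p. coeff q k * x p ^ k)" for k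
  proof -
    have l: "lead (r * k) (coeff q k * \<mu> ^ k) (\<lambda>p. coeff q k * x p ^ k)"
      using lead_mult[OF lead_const lead_power[OF x]] by simp
    consider "r * k < N" | "r * k = N" | "N < r * k" by linarith
    then show ?thesis
    proof cases
      case 1 then show ?thesis using lead_mono[OF l] by simp
    next
      case 2 then show ?thesis using l by simp
    next
      case 3 then show ?thesis using q lead_zero by simp
    qed
  qed
  have "lead N (\<Sum>k\<le>degree q. if r * k = N then coeff q k * \<mu> ^ k else 0)
      (\<lambda>p. \<Sum>k\<le>degree q. coeff q k * x p ^ k)"
    by (intro lead_sum monomial)
  then show ?thesis
    by (subst (asm) sum_multiples) (simp_all add: coeff_eq_0 poly_altdef cong: if_cong)
qed

text \<open>Multiply \<open>f\<^sub>X (x, y 2) = 0\<close> by \<open>t ^ (r * s)\<close> and let the point tend to \<open>P\<close>. The coefficient of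
  \<open>y ^ i\<close> contributes in the limit only if \<open>r\<close> divides \<open>(r - i) * s\<close>, hence only for \<open>i = 0\<close> and
  \<open>i = r\<close>, because \<open>s\<close> is coprime to \<open>r\<close>. What remains is \<open>1 - \<mu> ^ s = 0\<close>. Together with
  \<open>x ^ i_r = t * y 2 ^ i_s\<close>, which gives \<open>\<mu> ^ i_r = 1\<close>, this forces \<open>\<mu> = 1\<close>.\<close>

lemma lead_x: "lead r 1 x"
proof -
  obtain n \<mu> where "\<mu> \<noteq> 0" "lead n \<mu> x" "wt \<A> P x = - int n" using lead_exists[OF x_in x_nonzero] .
  then have \<mu>: "\<mu> \<noteq> 0" "lead r \<mu> x" by (simp_all add: wt_x)
  have lead_term: "lead (r * s) (if i = 0 then - (\<mu> ^ s) else if i = r then 1 else 0)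
      (\<lambda>p. poly (coeff f\<^sub>X i) (x p) * y 2 p ^ i)" if i: "i \<le> r" for i
  proof -
    have bound: "coeff (coeff f\<^sub>X i) k = 0" if "(r - i) * s < r * k" for k
    proof (cases "i = r")
      case True
      then show ?thesis using that lead_f by (cases k) auto
    next
      case False
      then have "r * degree (coeff f\<^sub>X i) \<le> (r - i) * s" using degree_coeff[of "r - i"] i by simp
      then have "degree (coeff f\<^sub>X i) < k" using that r_pos by (meson le_less_trans nat_mult_less_cancel1)
      then show ?thesis by (rule coeff_eq_0)
    qed
    have "(r - i) * s + s * i = (r - i + i) * s" by (simp only: add_mult_distrib mult.commute[of s i])
    then have sum: "(r - i) * s + s * i = r * s" using i by simp
    have "lead ((r - i) * s + s * i)
        ((if r dvd (r - i) * s then coeff (coeff f\<^sub>X i) ((r - i) * s div r) * \<mu> ^ ((r - i) * s div r)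
          else 0) * 1 ^ i) (\<lambda>p. poly (coeff f\<^sub>X i) (x p) * y 2 p ^ i)"
      by (intro lead_mult lead_poly_gen lead_power \<mu>(2) y2(3) bound)
    moreover have "\<not> r dvd (r - i) * s" if "i \<noteq> 0" "i \<noteq> r"
    proof
      assume "r dvd (r - i) * s"
      then have "r dvd r - i"
        using coprime_s by (simp add: coprime_dvd_mult_left_iff coprime_commute)
      then show False using that i by (auto dest: dvd_imp_le)
    qed
    ultimately show ?thesis
      unfolding sum using lead_f coeff_s r_pos by (auto split: if_splits)
  qed
  have "lead (r * s) (\<Sum>i\<le>r. if i = 0 then - (\<mu> ^ s) else if i = r then 1 else 0)
      (\<lambda>p. \<Sum>i\<le>r. poly (coeff f\<^sub>X i) (x p) * y 2 p ^ i)"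
    by (rule lead_sum) (rule lead_term, simp)
  moreover have "(\<Sum>i\<le>r. if i = 0 then - (\<mu> ^ s) else if i = r then 1 else 0) = 1 - \<mu> ^ s"
  proof -
    have "(if i = 0 then - (\<mu> ^ s) else if i = r then 1 else 0) =
        (if i = 0 then - (\<mu> ^ s) else 0) + (if i = r then 1 else 0)" for i using r_pos by auto
    then show ?thesis by (simp add: sum.distrib)
  qed
  moreover have "lead (r * s) 0 (\<lambda>p. \<Sum>i\<le>r. poly (coeff f\<^sub>X i) (x p) * y 2 p ^ i)"
    by (rule lead_cong[OF lead_zero]) (simp add: curve_equation)
  ultimately have \<mu>s: "\<mu> ^ s = 1" using lead_unique by fastforce
  have "lead (r * i_r) (\<mu> ^ i_r) (\<lambda>p. x p ^ i_r)" by (intro lead_power \<mu>)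
  moreover have "lead (r * i_r) 1 (\<lambda>p. x p ^ i_r)"
    unfolding lead_def
  proof (rule Lim_transform_eventually)
    show "((\<lambda>p. y 2 p ^ i_s * t p ^ (s * i_s)) \<longlongrightarrow> 1) (atin X P)"
      using lead_power[OF y2(3), of i_s] by (simp add: lead_def)
    show "eventually (\<lambda>p. y 2 p ^ i_s * t p ^ (s * i_s) = x p ^ i_r * t p ^ (r * i_r)) (atin X P)"
      using eventually_nonzero
    proof eventually_elim
      case (elim p)
      have "s * i_s = Suc (r * i_r)" using i_s_eq by (simp add: mult.commute)
      moreover have "y 2 p ^ i_s * t p = x p ^ i_r" using elim by (simp add: t_def)
      ultimately show ?case by (simp add: mult.assoc[symmetric])
    qed
  qed
  ultimately have "\<mu> ^ i_r = 1" by (rule lead_unique)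
  then have "\<mu> ^ (i_r * r) = 1" by (simp add: power_mult)
  moreover have "\<mu> ^ (i_s * s) = 1" using \<mu>s by (simp add: mult.commute[of i_s] power_mult)
  ultimately have "\<mu> = 1" unfolding i_s_eq by (simp add: power_add)
  then show ?thesis using \<mu> by simp
qed

lemma lead_poly:
  "(\<And>k. N < r * k \<Longrightarrow> coeff q k = 0) \<Longrightarrow>
     lead N (if r dvd N then coeff q (N div r) else 0) (\<lambda>p. poly q (x p))"
  using lead_poly_gen[OF lead_x, of N q] by (simp only: power_one mult_1_right)

lemma X_poly_in: "X_poly q \<in> carrier R"
proof (induction q)
  case 0
  have "X_poly 0 = (\<lambda>p\<in>S. 0)" by (auto simp: poly_in_x_def)
  then show ?case using const_in_R[of 0] by (simp only:)
next
  case (pCons a q)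
  have "X_poly (pCons a q) = (\<lambda>p\<in>S. a) \<oplus>\<^bsub>R\<^esub> (x \<otimes>\<^bsub>R\<^esub> X_poly q)"
    by (auto simp: poly_in_x_def R_simps)
  then show ?case using pCons x_in const_in_R[of a] by simp
qed

lemma y_monomial_eq: "y_monomial X P m y \<alpha> = (\<Otimes>\<^bsub>R\<^esub>j\<in>{2..m}. y j [^]\<^bsub>R\<^esub> \<alpha> j)"
proof -
  have "(\<Otimes>\<^bsub>R\<^esub>j\<in>{2..m}. y j [^]\<^bsub>R\<^esub> \<alpha> j) = (\<lambda>p\<in>S. \<Prod>j\<in>{2..m}. (y j [^]\<^bsub>R\<^esub> \<alpha> j) p)"
    using y_in by (intro finprod_R) auto
  also have "\<dots> = y_monomial X P m y \<alpha>"
    unfolding y_monomial_def by (rule restrict_ext, rule prod.cong) (auto simp: power_R y_in)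
  finally show ?thesis by simp
qed

lemma y_monomial_in: "y_monomial X P m y \<alpha> \<in> carrier R"
  unfolding y_monomial_eq using y_in by (intro R.finprod_closed) auto

lemma lead_y_monomial: "lead (\<Sum>j=2..m. \<alpha> j * \<rho> j) 1 (y_monomial X P m y \<alpha>)"
proof -
  have "lead (\<Sum>j=2..m. \<rho> j * \<alpha> j) (\<Prod>j=2..m. 1 ^ \<alpha> j) (\<lambda>p. \<Prod>j=2..m. y j p ^ \<alpha> j)"
    by (intro lead_prod lead_power lead_y) auto
  then have "lead (\<Sum>j=2..m. \<alpha> j * \<rho> j) 1 (\<lambda>p. \<Prod>j=2..m. y j p ^ \<alpha> j)"
    by (simp add: mult.commute)
  then show ?thesis by (rule lead_cong) (simp add: y_monomial_def)
qed

lemma basis_in: "i < r \<Longrightarrow> \<yy> i \<in> carrier R"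
  using basis y_monomial_in by auto

lemma lead_basis: "i < r \<Longrightarrow> lead (e i) 1 (\<yy> i)"
proof -
  assume i: "i < r"
  have l: "lead (\<Sum>j=2..m. \<nu> i j * \<rho> j) 1 (\<yy> i)" using basis i lead_y_monomial by simp
  have "wt \<A> P (\<yy> i) = - int (e i)" using basis i by blast
  then have "int (e i) = int (\<Sum>j=2..m. \<nu> i j * \<rho> j)"
    using lead_wt[OF basis_in[OF i] l one_neq_zero] by linarith
  then have "e i = (\<Sum>j=2..m. \<nu> i j * \<rho> j)" by (simp only: of_nat_eq_iff)
  then show ?thesis using l by simp
qed

lemma e_0: "e 0 = 0"
proof -
  have "0 \<in> H" using in_H[OF const_in_R[of 1], of 0 1] lead_cong[OF lead_const[of 1]] by auto
  then obtain i where i: "i < r" "e i \<le> 0" using standard_basis_representative[OF std] by blast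
  moreover have "e 0 \<le> e i"
  proof (cases "i = 0")
    case False
    have "strict_mono_on {..<r} e" using std unfolding standard_basis_def by blast
    from strict_mono_onD[OF this, of 0 i] show ?thesis using False i(1) by simp
  qed simp
  ultimately show ?thesis by simp
qed

text \<open>The monomial \<open>\<yy> 0\<close> has pole order \<open>0\<close> and leading coefficient \<open>1\<close>, so \<open>\<yy> 0 - 1\<close> vanishes at \<open>P\<close>.\<close>

lemma basis_0: "\<yy> 0 = \<one>\<^bsub>R\<^esub>"
proof -
  have 1: "\<yy> 0 \<in> carrier R" using basis_in r_pos by simp
  have "lead 0 (1 - 1) (\<lambda>p. \<yy> 0 p - 1)"
    using lead_diff[OF lead_basis[OF r_pos, unfolded e_0] lead_const[of 1]] .
  then have "lead 0 (1 - 1) (\<yy> 0 \<ominus>\<^bsub>R\<^esub> \<one>\<^bsub>R\<^esub>)"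
    by (rule lead_cong) (use 1 in \<open>simp add: minus_R, simp add: R_simps\<close>)
  then have "lead 0 0 (\<yy> 0 \<ominus>\<^bsub>R\<^esub> \<one>\<^bsub>R\<^esub>)" by simp
  then have "\<yy> 0 \<ominus>\<^bsub>R\<^esub> \<one>\<^bsub>R\<^esub> = \<zero>\<^bsub>R\<^esub>" using 1 by (intro lead_0_imp_zero) auto
  then have zero: "(\<yy> 0 \<ominus>\<^bsub>R\<^esub> \<one>\<^bsub>R\<^esub>) p = \<zero>\<^bsub>R\<^esub> p" for p by simp
  show ?thesis
  proof (rule R_eqI)
    show "\<yy> 0 p = \<one>\<^bsub>R\<^esub> p" if "p \<in> S" for p
      using zero[of p] that 1 by (simp add: minus_R R_simps const_in_R)
  qed (use 1 in auto)
qed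

section \<open>Expansion over the polynomials in \<open>x\<close>\<close>

text \<open>Induction on the pole order \<open>n\<close>. If it is attained, then \<open>n\<close> lies in the semigroup and has the form
  \<open>e i + r * j\<close> for a unique \<open>i\<close>, and \<open>g - c * x ^ j * \<yy> i\<close> has smaller pole order. The last two
  clauses bound the degrees of the coefficients and identify the one that carries the leading
  term.\<close>

lemma basis_expansion:
  assumes "g \<in> carrier R" "lead n c g"
  obtains q where "\<And>u. u \<in> S \<Longrightarrow> g u = (\<Sum>i<r. poly (q i) (x u) * \<yy> i u)"
    "\<And>i k. i < r \<Longrightarrow> n < e i + r * k \<Longrightarrow> coeff (q i) k = 0"
    "\<And>i k. i < r \<Longrightarrow> n = e i + r * k \<Longrightarrow> coeff (q i) k = c"
proof -
  have "\<exists>q. (\<forall>u\<in>S. g u = (\<Sum>i<r. poly (q i) (x u) * \<yy> i u)) \<and>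
      (\<forall>i<r. \<forall>k. (n < e i + r * k \<longrightarrow> coeff (q i) k = 0) \<and>
        (n = e i + r * k \<longrightarrow> coeff (q i) k = c))"
    using assms
  proof (induction n arbitrary: c g rule: less_induct)
    case (less n)
    \<comment> \<open>The induction hypothesis, for functions whose pole order is below \<open>n\<close>. It will apply to \<open>g\<close>
      itself if \<open>c = 0\<close>, and otherwise to \<open>g\<close> without its leading term.\<close>
    have lower: "\<exists>q. (\<forall>u\<in>S. g u = (\<Sum>i<r. poly (q i) (x u) * \<yy> i u)) \<and>
      (\<forall>i<r. \<forall>k. n \<le> e i + r * k \<longrightarrow> coeff (q i) k = 0)"
      if g: "g \<in> carrier R" "lead n 0 g" for g
    proof (cases "g = \<zero>\<^bsub>R\<^esub>")
      case True
      then show ?thesis by (intro exI[of _ "\<lambda>_. 0"]) (simp add: R_simps)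
    next
      case False
      obtain n' c' where n': "c' \<noteq> 0" "lead n' c' g" using lead_exists[OF g(1) False] by metis
      have "n' < n"
        using lead_mono[OF g(2), of n'] lead_unique g(2) n' by (metis linorder_neqE_nat)
      from less.IH[OF this g(1) n'(2)] obtain q where
        q: "\<forall>u\<in>S. g u = (\<Sum>i<r. poly (q i) (x u) * \<yy> i u)"
          "\<forall>i<r. \<forall>k. n' < e i + r * k \<longrightarrow> coeff (q i) k = 0" by blast
      show ?thesis using q \<open>n' < n\<close> by (intro exI[of _ q]) auto
    qed
    show ?case
    proof (cases "c = 0")
      case True
      then show ?thesis using lower[of g] less.prems by (metis less_imp_le order_refl)
    next
      case False
      then have "n \<in> H" using in_H less.prems by blast
      then obtain i where i: "i < r" "e i mod r = n mod r" "e i \<le> n"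
        using standard_basis_representative[OF std] by blast
      define j where "j = (n - e i) div r"
      have "r dvd n - e i" using i mod_eq_dvd_iff_nat by metis
      then have n: "n = e i + r * j" using i by (simp add: j_def)
      define b where "b = X_poly (monom c j) \<otimes>\<^bsub>R\<^esub> \<yy> i"
      have b: "b \<in> carrier R" using X_poly_in basis_in[OF i(1)] by (simp add: b_def)
      have b_eq: "b u = c * x u ^ j * \<yy> i u" if "u \<in> S" for u
        using that by (simp add: b_def R_simps poly_in_x_def poly_monom)
      have "lead (0 + r * j + e i) (c * 1 ^ j * 1) (\<lambda>u. c * x u ^ j * \<yy> i u)"
        by (intro lead_mult lead_const lead_power lead_x lead_basis i)
      then have "lead n c (\<lambda>u. c * x u ^ j * \<yy> i u)" by (simp add: n add.commute)
      then have "lead n (c - c) (\<lambda>u. g u - c * x u ^ j * \<yy> i u)"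
        by (intro lead_diff less.prems)
      then have "lead n (c - c) (g \<ominus>\<^bsub>R\<^esub> b)"
        by (rule lead_cong) (use less.prems b in \<open>simp add: minus_R b_eq\<close>)
      then have "lead n 0 (g \<ominus>\<^bsub>R\<^esub> b)" by simp
      then obtain q where
        q: "\<forall>u\<in>S. (g \<ominus>\<^bsub>R\<^esub> b) u = (\<Sum>i<r. poly (q i) (x u) * \<yy> i u)"
          "\<forall>i<r. \<forall>k. n \<le> e i + r * k \<longrightarrow> coeff (q i) k = 0"
        using lower[of "g \<ominus>\<^bsub>R\<^esub> b"] less.prems b by auto
      define q' where "q' k = q k + (if k = i then monom c j else 0)" for k
      have "g u = (\<Sum>k<r. poly (q' k) (x u) * \<yy> k u)" if u: "u \<in> S" for u
      proof -
        have "poly (q' k) (x u) * \<yy> k u =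
            poly (q k) (x u) * \<yy> k u + (if k = i then c * x u ^ j * \<yy> i u else 0)" for k
          by (simp add: q'_def poly_monom algebra_simps)
        then have "(\<Sum>k<r. poly (q' k) (x u) * \<yy> k u) =
            (\<Sum>k<r. poly (q k) (x u) * \<yy> k u) + c * x u ^ j * \<yy> i u"
          using i(1) by (simp add: sum.distrib)
        also have "\<dots> = (g \<ominus>\<^bsub>R\<^esub> b) u + b u" using q(1) u by (simp add: b_eq)
        also have "\<dots> = g u" using u less.prems b by (simp add: minus_R)
        finally show ?thesis by simp
      qed
      moreover have "coeff (q' k) k' = (if n = e k + r * k' then c else 0)"
        if "k < r" "n \<le> e k + r * k'" for k k'
      proof (cases "k = i")
        case True
        then show ?thesis using q(2) that r_pos by (auto simp: q'_def n)
      next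
        case False
        have "n \<noteq> e k + r * k'"
        proof
          assume "n = e k + r * k'"
          then have "e k mod r = e i mod r" using i(2) by simp
          then show False using standard_basis_inj[OF std that(1) i(1)] False by blast
        qed
        then show ?thesis using q(2) that False by (simp add: q'_def)
      qed
      ultimately show ?thesis by (intro exI[of _ q']) auto
    qed
  qed
  then show thesis using that by blast
qed

end

context weierstrass
begin

section \<open>Expansions in the tensor square\<close>

lemma K_subset_R: "K \<subseteq> carrier R"
  using X_poly_in by (auto simp: base_ring_def)

sublocale RT: subset_algebra R K
  by unfold_locales (rule K_subset_R)

abbreviation "T \<equiv> tensor_square R K"
abbreviation pure (infixl "\<odot>" 75) where "f \<odot> g \<equiv> pure_tensor R K f g"

lemma lead_R_add:
  "lead n c f \<Longrightarrow> lead n c' g \<Longrightarrow> lead n (c + c') (f \<oplus>\<^bsub>R\<^esub> g)"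
  by (rule lead_cong[OF lead_add]) (simp_all add: R_simps)

lemma lead_R_diff:
  "f \<in> carrier R \<Longrightarrow> g \<in> carrier R \<Longrightarrow> lead n c f \<Longrightarrow> lead n c' g \<Longrightarrow> lead n (c - c') (f \<ominus>\<^bsub>R\<^esub> g)"
  by (rule lead_cong[OF lead_diff]) (simp_all add: minus_R)

lemma lead_R_mult:
  "lead n c f \<Longrightarrow> lead k c' g \<Longrightarrow> lead (n + k) (c * c') (f \<otimes>\<^bsub>R\<^esub> g)"
  by (rule lead_cong[OF lead_mult]) (simp_all add: R_simps)

lemma lead_X_poly:
  "(\<And>k. N < r * k \<Longrightarrow> coeff q k = 0) \<Longrightarrow>
     lead N (if r dvd N then coeff q (N div r) else 0) (X_poly q)"
  by (rule lead_cong[OF lead_poly]) (simp_all add: poly_in_x_def)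

lemma lead_X_monom: "lead (r * k) c (X_poly (monom c k))"
  using lead_X_poly[of "r * k" "monom c k"] r_pos by simp

lemma basis_sum:
  assumes "g \<in> carrier R" "\<And>u. u \<in> S \<Longrightarrow> g u = (\<Sum>i<r. poly (q i) (x u) * \<yy> i u)"
  shows "g = (\<Oplus>\<^bsub>R\<^esub>i\<in>{..<r}. X_poly (q i) \<otimes>\<^bsub>R\<^esub> \<yy> i)"
proof (rule R_eqI[OF assms(1)])
  have in_R: "X_poly (q i) \<otimes>\<^bsub>R\<^esub> \<yy> i \<in> carrier R" if "i \<in> {..<r}" for i
    using that X_poly_in basis_in by auto
  show "(\<Oplus>\<^bsub>R\<^esub>i\<in>{..<r}. X_poly (q i) \<otimes>\<^bsub>R\<^esub> \<yy> i) \<in> carrier R"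
    using in_R by (intro R.finsum_closed) auto
  show "g u = (\<Oplus>\<^bsub>R\<^esub>i\<in>{..<r}. X_poly (q i) \<otimes>\<^bsub>R\<^esub> \<yy> i) u" if "u \<in> S" for u
  proof -
    have "(\<Oplus>\<^bsub>R\<^esub>i\<in>{..<r}. X_poly (q i) \<otimes>\<^bsub>R\<^esub> \<yy> i) u =
        (\<Sum>i<r. (X_poly (q i) \<otimes>\<^bsub>R\<^esub> \<yy> i) u)"
      using that in_R by (subst finsum_R) auto
    then show ?thesis using that assms(2) by (simp add: R_simps poly_in_x_def)
  qed
qed

text \<open>Expansion along the basis in the second factor, where the coefficient of \<open>\<yy> i\<close> has pole order
  at most \<open>d - e i\<close> and \<open>\<kappa> i\<close> is its leading coefficient. The truncated difference matters only if
  \<open>e i > d\<close>, where \<open>expands_pure\<close> produces the coefficient \<open>0\<close>.\<close>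

definition expands :: "nat \<Rightarrow> (nat \<Rightarrow> complex) \<Rightarrow>
    (('p \<Rightarrow> complex) \<times> ('p \<Rightarrow> complex) \<Rightarrow>\<^sub>0 int) set \<Rightarrow> bool" where
  "expands d \<kappa> U \<longleftrightarrow> (\<exists>G. (\<forall>i<r. G i \<in> carrier R \<and> lead (d - e i) (\<kappa> i) (G i)) \<and>
     U = (\<Oplus>\<^bsub>T\<^esub>i\<in>{..<r}. G i \<odot> \<yy> i))"

lemma expands_zero: "expands d (\<lambda>i. 0) \<zero>\<^bsub>T\<^esub>"
proof -
  have "lead n 0 \<zero>\<^bsub>R\<^esub>" for n by (rule lead_cong[OF lead_zero]) (simp add: R_simps)
  moreover have "(\<Oplus>\<^bsub>T\<^esub>i\<in>{..<r}. \<zero>\<^bsub>R\<^esub> \<odot> \<yy> i) = \<zero>\<^bsub>T\<^esub>"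
    by (rule RT.T.add.finprod_one_eqI) (simp add: RT.pure_zero_left basis_in)
  ultimately show ?thesis unfolding expands_def by (intro exI[of _ "\<lambda>_. \<zero>\<^bsub>R\<^esub>"]) simp
qed

lemma expands_add:
  assumes "expands d \<kappa> U" "expands d \<kappa>' V"
  shows "expands d (\<lambda>i. \<kappa> i + \<kappa>' i) (U \<oplus>\<^bsub>T\<^esub> V)"
proof -
  obtain G where G: "\<And>i. i < r \<Longrightarrow> G i \<in> carrier R \<and> lead (d - e i) (\<kappa> i) (G i)"
    "U = (\<Oplus>\<^bsub>T\<^esub>i\<in>{..<r}. G i \<odot> \<yy> i)" using assms(1) unfolding expands_def by blast
  obtain G' where G': "\<And>i. i < r \<Longrightarrow> G' i \<in> carrier R \<and> lead (d - e i) (\<kappa>' i) (G' i)"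
    "V = (\<Oplus>\<^bsub>T\<^esub>i\<in>{..<r}. G' i \<odot> \<yy> i)" using assms(2) unfolding expands_def by blast
  have "U \<oplus>\<^bsub>T\<^esub> V = (\<Oplus>\<^bsub>T\<^esub>i\<in>{..<r}. G i \<odot> \<yy> i \<oplus>\<^bsub>T\<^esub> G' i \<odot> \<yy> i)"
    unfolding G G' by (rule RT.T.finsum_addf[symmetric]) (use G G' basis_in in auto)
  also have "\<dots> = (\<Oplus>\<^bsub>T\<^esub>i\<in>{..<r}. (G i \<oplus>\<^bsub>R\<^esub> G' i) \<odot> \<yy> i)"
    using G G' basis_in by (intro RT.T.finsum_cong') (auto simp: RT.pure_add_left)
  finally show ?thesis unfolding expands_def
    using G G' by (intro exI[of _ "\<lambda>i. G i \<oplus>\<^bsub>R\<^esub> G' i"]) (auto intro: lead_R_add)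
qed

lemma expands_closed:
  assumes "expands d \<kappa> U" shows "U \<in> carrier T"
  using assms basis_in unfolding expands_def by (auto intro!: RT.T.finsum_closed)

lemma expands_finsum:
  assumes "finite I" "\<And>k. k \<in> I \<Longrightarrow> expands d (\<kappa> k) (U k)"
  shows "expands d (\<lambda>i. \<Sum>k\<in>I. \<kappa> k i) (\<Oplus>\<^bsub>T\<^esub>k\<in>I. U k)"
  using assms
proof (induction I rule: finite_induct)
  case empty then show ?case using expands_zero by simp
next
  case (insert k I)
  have "U \<in> insert k I \<rightarrow> carrier T" using insert.prems expands_closed by auto
  then show ?case using insert by (simp add: expands_add)
qed

text \<open>Expand \<open>g\<close> and move its polynomial coefficients to the first factor. Only basis elements whose pole
  order is congruent to \<open>n\<close> can receive the leading term of \<open>g\<close>.\<close>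

lemma expands_pure:
  assumes f: "f \<in> carrier R" "lead a c f" and g: "g \<in> carrier R" "lead n c' g" and d: "a + n = d"
  shows "expands d (\<lambda>i. if e i \<le> n \<and> e i mod r = n mod r then c * c' else 0) (f \<odot> g)"
proof -
  obtain q where q: "\<And>u. u \<in> S \<Longrightarrow> g u = (\<Sum>i<r. poly (q i) (x u) * \<yy> i u)"
    "\<And>i k. i < r \<Longrightarrow> n < e i + r * k \<Longrightarrow> coeff (q i) k = 0"
    "\<And>i k. i < r \<Longrightarrow> n = e i + r * k \<Longrightarrow> coeff (q i) k = c'"
    using basis_expansion[OF g] by blast
  define G where "G i = X_poly (q i) \<otimes>\<^bsub>R\<^esub> f" for i
  have G: "G i \<in> carrier R" for i using f X_poly_in by (simp add: G_def)
  have K: "X_poly (q i) \<in> K" for i by (simp add: base_ring_def)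
  have "f \<odot> g = f \<odot> (\<Oplus>\<^bsub>R\<^esub>i\<in>{..<r}. X_poly (q i) \<otimes>\<^bsub>R\<^esub> \<yy> i)"
    using basis_sum[OF g(1) q(1)] by simp
  also have "\<dots> = (\<Oplus>\<^bsub>T\<^esub>i\<in>{..<r}. f \<odot> (X_poly (q i) \<otimes>\<^bsub>R\<^esub> \<yy> i))"
    using f X_poly_in basis_in by (intro RT.pure_finsum_right) auto
  also have "\<dots> = (\<Oplus>\<^bsub>T\<^esub>i\<in>{..<r}. G i \<odot> \<yy> i)"
    using f G basis_in unfolding G_def
    by (intro RT.T.finsum_cong') (auto simp: RT.pure_balanced K)
  finally have sum: "f \<odot> g = (\<Oplus>\<^bsub>T\<^esub>i\<in>{..<r}. G i \<odot> \<yy> i)" .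
  have "lead (d - e i) (if e i \<le> n \<and> e i mod r = n mod r then c * c' else 0) (G i)" if i: "i < r" for i
  proof (cases "e i \<le> n")
    case True
    have "lead (n - e i) (if r dvd n - e i then coeff (q i) ((n - e i) div r) else 0) (X_poly (q i))"
      by (rule lead_X_poly) (use q(2)[OF i] in auto)
    moreover have "(r dvd n - e i) = (e i mod r = n mod r)"
      using mod_eq_dvd_iff_nat[OF True, of r] by auto
    moreover have "coeff (q i) ((n - e i) div r) = c'" if "r dvd n - e i"
      by (rule q(3)[OF i]) (use that True in simp)
    ultimately have "lead (n - e i) (if e i mod r = n mod r then c' else 0) (X_poly (q i))"
      by (auto split: if_splits)
    from lead_R_mult[OF this f(2)] have
      "lead (n - e i + a) ((if e i mod r = n mod r then c' else 0) * c) (G i)" by (simp add: G_def)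
    moreover have "n - e i + a = d - e i" using True d by simp
    ultimately show ?thesis using True by (auto simp: mult.commute split: if_splits)
  next
    case False
    then have "q i = 0" using q(2)[OF i] by (intro poly_eqI) simp
    then have "lead (d - e i) 0 (G i)"
      by (intro lead_cong[OF lead_zero]) (simp add: G_def R_simps poly_in_x_def)
    then show ?thesis using False by simp
  qed
  then show ?thesis unfolding expands_def using G sum by blast
qed

text \<open>In a pure tensor \<open>f \<otimes> g\<close> of weight below \<open>d\<close>, where \<open>f\<close> has pole order \<open>a\<close>, the leading coefficient
  of \<open>g\<close> at the order \<open>d - a\<close> is \<open>0\<close>.\<close>

lemma expands_lower:
  assumes "tensor_lower_weight X \<A> P x (int d) U" shows "expands d (\<lambda>i. 0) U"
proof -
  obtain N f g where fg: "\<And>k. k < N \<Longrightarrow> f k \<in> carrier R \<and> f k \<noteq> \<zero>\<^bsub>R\<^esub> \<and> g k \<in> carrier R \<and>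
      g k \<noteq> \<zero>\<^bsub>R\<^esub> \<and> - wt \<A> P (f k) - wt \<A> P (g k) < int d"
    and U: "U = (\<Oplus>\<^bsub>T\<^esub>k\<in>{..<N::nat}. f k \<odot> g k)"
    using assms unfolding tensor_lower_weight_def Let_def curve_tensor_def curve_pure_def by blast
  have summand: "expands d (\<lambda>i. 0) (f k \<odot> g k)" if "k \<in> {..<N}" for k
  proof -
    have k: "k < N" using that by simp
    obtain a c where a: "lead a c (f k)" "wt \<A> P (f k) = - int a"
      using lead_exists fg[OF k] by metis
    obtain b c' where b: "lead b c' (g k)" "wt \<A> P (g k) = - int b"
      using lead_exists fg[OF k] by metis
    have ab: "a + b < d" using fg[OF k] a b by linarith
    have "lead (d - a) 0 (g k)" by (rule lead_mono[OF b(1)]) (use ab in simp)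
    then have "expands d (\<lambda>i. if e i \<le> d - a \<and> e i mod r = (d - a) mod r then c * 0 else 0) (f k \<odot> g k)"
      by (intro expands_pure) (use fg[OF k] a ab in auto)
    then show ?thesis by (simp cong: if_cong)
  qed
  have "expands d (\<lambda>i. \<Sum>k<N. 0) U" unfolding U by (rule expands_finsum[OF finite_lessThan summand])
  then show ?thesis by simp
qed

text \<open>The monomials of the leading part contribute the sums that \<open>leading_class_sums\<close> evaluates, the
  remainder contributes \<open>0\<close>.\<close>

lemma expands_leading_part:
  assumes U: "U \<in> carrier T"
    and leading: "has_leading_part X \<A> P r m \<rho> x y U d (\<Sum>i<r. monom (monom 1 (d - e i)) (e i))"
  shows "expands d (\<lambda>i. if i < r then 1 else 0) U"
proof -
  obtain N :: nat and c a \<alpha> \<beta> where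
    weight: "\<And>k. k < N \<Longrightarrow> r * a k + (\<Sum>j=2..m. \<alpha> k j * \<rho> j) + (\<Sum>j=2..m. \<beta> k j * \<rho> j) = d"
    and lower: "tensor_lower_weight X \<A> P x (int d) (U \<ominus>\<^bsub>T\<^esub> (\<Oplus>\<^bsub>T\<^esub>k\<in>{..<N}.
      (X_poly (monom (c k) (a k)) \<otimes>\<^bsub>R\<^esub> y_monomial X P m y (\<alpha> k)) \<odot> y_monomial X P m y (\<beta> k)))"
    and dvd: "(monom 1 r - [:monom 1 r:]) dvd
      ((\<Sum>k<N. monom (monom (c k) (r * a k + (\<Sum>j=2..m. \<alpha> k j * \<rho> j))) (\<Sum>j=2..m. \<beta> k j * \<rho> j))
        - (\<Sum>i<r. monom (monom 1 (d - e i)) (e i)))"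
    using leading unfolding has_leading_part_def Let_def curve_tensor_def curve_pure_def by blast
  define w where "w k = (\<Sum>j=2..m. \<beta> k j * \<rho> j)" for k
  define L where "L k = (X_poly (monom (c k) (a k)) \<otimes>\<^bsub>R\<^esub> y_monomial X P m y (\<alpha> k))
      \<odot> y_monomial X P m y (\<beta> k)" for k
  define \<kappa> where "\<kappa> k i = (if e i \<le> w k \<and> e i mod r = w k mod r then c k else 0)" for k i
  have L: "expands d (\<kappa> k) (L k)" if "k \<in> {..<N}" for k
  proof -
    let ?f = "X_poly (monom (c k) (a k)) \<otimes>\<^bsub>R\<^esub> y_monomial X P m y (\<alpha> k)"
    have "lead (r * a k + (\<Sum>j=2..m. \<alpha> k j * \<rho> j)) (c k * 1) ?f"
      by (intro lead_R_mult lead_X_monom lead_y_monomial)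
    moreover have "lead (w k) 1 (y_monomial X P m y (\<beta> k))"
      unfolding w_def by (rule lead_y_monomial)
    moreover have f: "?f \<in> carrier R" using X_poly_in y_monomial_in by simp
    moreover have "r * a k + (\<Sum>j=2..m. \<alpha> k j * \<rho> j) + w k = d"
      unfolding w_def using weight that by simp
    ultimately have "expands d (\<lambda>i. if e i \<le> w k \<and> e i mod r = w k mod r then c k * 1 * 1 else 0) (L k)"
      unfolding L_def by (intro expands_pure y_monomial_in)
    then show ?thesis unfolding \<kappa>_def by (simp only: mult_1_right)
  qed
  have sum1: "(\<Sum>k<N. \<kappa> k i) = 1" if i: "i < r" for i
  proof -
    have "(\<Sum>k<N. \<kappa> k i) = (\<Sum>k<N. if w k mod r = e i mod r then c k else 0)"
    proof (rule sum.cong)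
      fix k
      have "w k \<in> H" using in_H[OF y_monomial_in lead_y_monomial] unfolding w_def by simp
      have "e i \<le> w k" if "w k mod r = e i mod r"
      proof -
        obtain j where j: "j < r" "e j mod r = w k mod r" "e j \<le> w k"
          using standard_basis_representative[OF std \<open>w k \<in> H\<close>] .
        then show ?thesis using standard_basis_inj[OF std j(1) i] that by simp
      qed
      then show "\<kappa> k i = (if w k mod r = e i mod r then c k else 0)" by (auto simp: \<kappa>_def)
    qed simp
    also have "\<dots> = 1"
      by (rule leading_class_sums[OF r_pos standard_basis_inj[OF std] dvd[folded w_def] i])
    finally show ?thesis .
  qed
  have sumL: "expands d (\<lambda>i. \<Sum>k<N. \<kappa> k i) (\<Oplus>\<^bsub>T\<^esub>k\<in>{..<N}. L k)"
    by (rule expands_finsum) (use L in auto)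
  define V where "V = (\<Oplus>\<^bsub>T\<^esub>k\<in>{..<N}. L k)"
  have V: "V \<in> carrier T" using expands_closed[OF sumL] by (simp add: V_def)
  have "expands d (\<lambda>i. 0) (U \<ominus>\<^bsub>T\<^esub> V)" using expands_lower lower unfolding L_def V_def by simp
  from expands_add[OF this sumL[folded V_def]]
  have "expands d (\<lambda>i. \<Sum>k<N. \<kappa> k i) (U \<ominus>\<^bsub>T\<^esub> V \<oplus>\<^bsub>T\<^esub> V)" by simp
  moreover have "U \<ominus>\<^bsub>T\<^esub> V \<oplus>\<^bsub>T\<^esub> V = U"
    using U V by (simp add: RT.T.minus_eq RT.T.a_assoc RT.T.l_neg)
  ultimately have "expands d (\<lambda>i. \<Sum>k<N. \<kappa> k i) U" by simp
  then show ?thesis unfolding expands_def using sum1 by auto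
qed

text \<open>The definition asks for a list of pure tensors with nonzero factors, so vanishing summands are
  dropped and the others renumbered.\<close>

lemma tensor_lower_weightI:
  assumes I: "finite I"
    and fg: "\<And>i. i \<in> I \<Longrightarrow> f i \<in> carrier R \<and> g i \<in> carrier R"
    and lower: "\<And>i. i \<in> I \<Longrightarrow> f i \<noteq> \<zero>\<^bsub>R\<^esub> \<Longrightarrow> g i \<noteq> \<zero>\<^bsub>R\<^esub> \<Longrightarrow> - wt \<A> P (f i) - wt \<A> P (g i) < n"
  shows "tensor_lower_weight X \<A> P x n (\<Oplus>\<^bsub>T\<^esub>i\<in>I. f i \<odot> g i)"
proof -
  define J where "J = {i \<in> I. f i \<noteq> \<zero>\<^bsub>R\<^esub> \<and> g i \<noteq> \<zero>\<^bsub>R\<^esub>}"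
  have J: "finite J" "J \<subseteq> I" using I by (auto simp: J_def)
  obtain \<sigma> where \<sigma>: "bij_betw \<sigma> {0..<card J} J" using ex_bij_betw_nat_finite[OF J(1)] by blast
  have \<sigma>': "\<sigma> ` {..<card J} = J" "inj_on \<sigma> {..<card J}"
    using \<sigma> by (simp_all add: bij_betw_def lessThan_atLeast0)
  have "(\<Oplus>\<^bsub>T\<^esub>i\<in>I. f i \<odot> g i) = (\<Oplus>\<^bsub>T\<^esub>i\<in>J. f i \<odot> g i)"
    by (rule RT.T.add.finprod_mono_neutral_cong_right[OF I J(2)])
      (use fg J in \<open>auto simp: J_def RT.pure_zero_left RT.pure_zero_right\<close>)
  also have "\<dots> = (\<Oplus>\<^bsub>T\<^esub>i\<in>\<sigma> ` {..<card J}. f i \<odot> g i)" by (simp only: \<sigma>')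
  also have "\<dots> = (\<Oplus>\<^bsub>T\<^esub>k\<in>{..<card J}. f (\<sigma> k) \<odot> g (\<sigma> k))"
    by (rule RT.T.finsum_reindex) (use \<sigma>' fg J in auto)
  finally have eq: "(\<Oplus>\<^bsub>T\<^esub>i\<in>I. f i \<odot> g i) = (\<Oplus>\<^bsub>T\<^esub>k\<in>{..<card J}. f (\<sigma> k) \<odot> g (\<sigma> k))" .
  have "\<sigma> k \<in> J" if "k < card J" for k using \<sigma>'(1) that by blast
  then have "\<forall>k<card J. f (\<sigma> k) \<in> carrier R - {\<zero>\<^bsub>R\<^esub>} \<and> g (\<sigma> k) \<in> carrier R - {\<zero>\<^bsub>R\<^esub>} \<and>
      - wt \<A> P (f (\<sigma> k)) - wt \<A> P (g (\<sigma> k)) < n"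
    using fg lower by (auto simp: J_def)
  then show ?thesis
    unfolding tensor_lower_weight_def Let_def curve_tensor_def curve_pure_def eq
    by (intro exI[of _ "card J"] exI[of _ "\<lambda>k. f (\<sigma> k)"] exI[of _ "\<lambda>k. g (\<sigma> k)"] conjI refl)
qed

section \<open>Symmetry of the element \<open>h\<close>\<close>

lemma eval2_in_R:
  assumes "f \<in> carrier R"
  shows "(\<lambda>p\<in>S. eval2 G (x p) (f p)) = (\<Oplus>\<^bsub>R\<^esub>k\<in>{..degree G}. X_poly (coeff G k) \<otimes>\<^bsub>R\<^esub> f [^]\<^bsub>R\<^esub> k)"
    and "(\<lambda>p\<in>S. eval2 G (x p) (f p)) \<in> carrier R"
proof -
  have in_R: "X_poly (coeff G k) \<otimes>\<^bsub>R\<^esub> f [^]\<^bsub>R\<^esub> k \<in> carrier R" for k using assms X_poly_in by simp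
  have "(\<Oplus>\<^bsub>R\<^esub>k\<in>{..degree G}. X_poly (coeff G k) \<otimes>\<^bsub>R\<^esub> f [^]\<^bsub>R\<^esub> k) =
      (\<lambda>p\<in>S. \<Sum>k\<in>{..degree G}. (X_poly (coeff G k) \<otimes>\<^bsub>R\<^esub> f [^]\<^bsub>R\<^esub> k) p)"
    using in_R by (intro finsum_R) auto
  also have "\<dots> = (\<lambda>p\<in>S. eval2 G (x p) (f p))"
    by (rule restrict_ext) (simp add: R_simps poly_in_x_def power_R assms eval2_altdef)
  finally show eq: "(\<lambda>p\<in>S. eval2 G (x p) (f p)) =
      (\<Oplus>\<^bsub>R\<^esub>k\<in>{..degree G}. X_poly (coeff G k) \<otimes>\<^bsub>R\<^esub> f [^]\<^bsub>R\<^esub> k)" by simp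
  show "(\<lambda>p\<in>S. eval2 G (x p) (f p)) \<in> carrier R"
    unfolding eq using in_R by (intro R.finsum_closed) auto
qed

lemma divided_difference_eq:
  assumes "f \<in> carrier R"
  shows "divided_difference X \<A> P x G f =
    RT.tensor_divided_difference (degree G) (\<lambda>k. X_poly (coeff G k)) f"
proof -
  have "(\<lambda>p\<in>S. poly (coeff G k) (x p) * f p ^ i) = X_poly (coeff G k) \<otimes>\<^bsub>R\<^esub> f [^]\<^bsub>R\<^esub> i"
    "(\<lambda>p\<in>S. f p ^ i) = f [^]\<^bsub>R\<^esub> i" for k i :: nat
    using assms by (auto simp: R_simps power_R poly_in_x_def)
  then show ?thesis
    by (simp add: divided_difference_def RT.tensor_divided_difference_def curve_tensor_def curve_pure_def)
qed

text \<open>The functions \<open>y j\<close> and the polynomials in \<open>x\<close> generate \<open>R\<close>, so the product of the divided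
  differences annihilates \<open>u \<otimes> 1 - 1 \<otimes> u\<close> for every \<open>u\<close> in \<open>R\<close>.\<close>

lemma h_tilde_symmetric:
  assumes F: "minimal_equations X P m x y F" and h: "is_h_tilde X \<A> P r e m \<rho> x y F d h"
  shows "tensor_swap h = h"
proof -
  define dd where "dd j = RT.tensor_divided_difference (degree (F j)) (\<lambda>k. X_poly (coeff (F j) k)) (y j)" for j
  define q where "q = (\<Otimes>\<^bsub>T\<^esub>j\<in>{2..m}. dd j)"
  define D where "D = (\<Otimes>\<^bsub>R\<^esub>j\<in>{2..m}. y_derivative X P x (F j) (y j))"
  define a where "a = tensor_diagonal R h"
  have K: "X_poly q \<in> K" for q by (simp add: base_ring_def)
  have dd: "dd j \<in> carrier T" "tensor_swap (dd j) = dd j" if "j \<in> {2..m}" for j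
    unfolding dd_def
    by (rule RT.divided_difference_closed[OF K y_in[OF that]],
      rule RT.divided_difference_swap[OF K y_in[OF that]])
  have q: "q \<in> carrier T" unfolding q_def using dd by (intro RT.T.finprod_closed) auto
  have q_eq: "(\<Otimes>\<^bsub>T\<^esub>j\<in>{2..m}. divided_difference X \<A> P x (F j) (y j)) = q"
    unfolding q_def using dd by (intro RT.T.finprod_cong') (auto simp: dd_def divided_difference_eq y_in)
  have deriv: "y_derivative X P x (F j) (y j) \<in> carrier R" if "j \<in> {2..m}" for j
    using eval2_in_R(2)[OF y_in[OF that]] by (simp add: y_derivative_def)
  have D: "D \<in> carrier R" unfolding D_def using deriv by (intro R.finprod_closed) auto
  have D_eq: "(\<Otimes>\<^bsub>T\<^esub>j\<in>{2..m}. y_derivative X P x (F j) (y j) \<odot> \<one>\<^bsub>R\<^esub>) = D \<odot> \<one>\<^bsub>R\<^esub>"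
    unfolding D_def using deriv by (intro RT.pure_finprod_left[symmetric]) auto
  have "h \<in> carrier T"
    and quot: "total_quotient_eq T h (a \<odot> \<one>\<^bsub>R\<^esub>) q (D \<odot> \<one>\<^bsub>R\<^esub>)"
    using h unfolding is_h_tilde_def Let_def curve_tensor_def[symmetric] q_eq[symmetric] D_eq[symmetric] a_def
    by (simp_all add: curve_tensor_def curve_pure_def)
  have a: "a \<in> carrier R"
    using quot by (intro RT.pure_closed_left[of a "\<one>\<^bsub>R\<^esub>"]) (simp add: total_quotient_eq_def regular_element_def)
  have "RT.casimir (dd j) (y j)" if j: "j \<in> {2..m}" for j
    unfolding dd_def
  proof (rule RT.divided_difference_casimir)
    show "X_poly (coeff (F j) k) \<in> K" for k by (rule K)
    show "y j \<in> carrier R" by (rule y_in[OF j])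
    have "(\<lambda>p\<in>S. eval2 (F j) (x p) (y j p)) = \<zero>\<^bsub>R\<^esub>"
      unfolding R_simps by (rule restrict_ext) (use F j in \<open>simp add: minimal_equations_def\<close>)
    then show "(\<Oplus>\<^bsub>R\<^esub>k\<in>{..degree (F j)}. X_poly (coeff (F j) k) \<otimes>\<^bsub>R\<^esub> y j [^]\<^bsub>R\<^esub> k) = \<zero>\<^bsub>R\<^esub>"
      using eval2_in_R(1)[OF y_in[OF j]] by simp
  qed
  then have y_casimir: "RT.casimir q (y j)" if "j \<in> {2..m}" for j
    unfolding q_def using that dd by (intro RT.casimir_product) auto
  have casimir: "RT.casimir q u" if u: "u \<in> carrier R" for u
  proof -
    obtain b where "u = (\<Oplus>\<^bsub>R\<^esub>i\<in>{..<r}. X_poly (b i) \<otimes>\<^bsub>R\<^esub> \<yy> i)"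
    proof (cases "u = \<zero>\<^bsub>R\<^esub>")
      case True
      show thesis using that[of "\<lambda>_. 0"] basis_sum[OF u, of "\<lambda>_. 0"] True by (simp add: R_simps)
    next
      case False
      obtain n c where n: "lead n c u" using lead_exists[OF u False] .
      show thesis
      proof (rule basis_expansion[OF u n])
        fix b assume "\<And>v. v \<in> S \<Longrightarrow> u v = (\<Sum>i<r. poly (b i) (x v) * \<yy> i v)"
        then show thesis by (rule that[OF basis_sum[OF u]])
      qed
    qed
    moreover have "RT.casimir q (\<yy> i)" if "i < r" for i
    proof -
      have "\<yy> i = (\<Otimes>\<^bsub>R\<^esub>j\<in>{2..m}. y j [^]\<^bsub>R\<^esub> \<nu> i j)" using basis that by (simp add: y_monomial_eq)
      then show ?thesis using y_casimir q by (simp only:) (intro RT.casimir_finprod RT.casimir_pow, auto)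
    qed
    ultimately show ?thesis
      using q by (simp only:) (intro RT.casimir_finsum RT.casimir_mult RT.casimir_K[OF q K], auto)
  qed
  have "tensor_swap q = (\<Otimes>\<^bsub>T\<^esub>j\<in>{2..m}. tensor_swap (dd j))"
    unfolding q_def using dd by (subst RT.swap.hom_finprod) (auto simp: comp_def)
  also have "\<dots> = q"
    unfolding q_def using dd by (intro RT.T.finprod_cong') (auto simp: dd(2))
  finally have "tensor_swap q = q" .
  then show ?thesis
    using RT.casimir_symmetric[OF \<open>h \<in> carrier T\<close> q D a _ _ _ casimir] quot
    by (auto simp: total_quotient_eq_def)
qed

end

section \<open>The expansion of \<open>h\<close>\<close>

theorem proposition4p18:
  fixes X :: "'p topology" and \<A> :: "'p atlas" and P :: 'p
    and r m i_s i_r d l :: nat and e \<rho> \<delta> star :: "nat \<Rightarrow> nat"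
    and f\<^sub>X :: "complex poly poly" and F :: "nat \<Rightarrow> complex poly poly"
    and x :: "'p \<Rightarrow> complex" and y :: "nat \<Rightarrow> 'p \<Rightarrow> complex"
    and \<nu> :: "nat \<Rightarrow> nat \<Rightarrow> nat" and \<yy> :: "nat \<Rightarrow> 'p \<Rightarrow> complex"
    and h :: "(('p \<Rightarrow> complex) \<times> ('p \<Rightarrow> complex) \<Rightarrow>\<^sub>0 int) set"
    and R :: "('p \<Rightarrow> complex) ring"
    and T :: "(('p \<Rightarrow> complex) \<times> ('p \<Rightarrow> complex) \<Rightarrow>\<^sub>0 int) set ring"
  assumes curve: "weierstrass_curve X \<A> P r e m \<rho> f\<^sub>X i_s i_r x y"
    and R: "R = coordinate_ring X \<A> P"
    and T: "T = curve_tensor X \<A> P x"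
    and basis: "\<forall>i<r. \<yy> i = y_monomial X P m y (\<nu> i) \<and> wt \<A> P (\<yy> i) = - int (e i)"
    and F: "minimal_equations X P m x y F"
    and h: "is_h_tilde X \<A> P r e m \<rho> x y F d h"
    and l: "l < r" "d mod r = e l mod r"
    and star: "\<forall>i<r. star i < r \<and> (e (star i) + e i) mod r = e l mod r"
    and \<delta>: "\<forall>i<r. d - e i = e (star i) + \<delta> i * r"
  shows "\<exists>(\<Upsilon> :: nat \<Rightarrow> 'p \<Rightarrow> complex) (\<yy>' :: nat \<Rightarrow> 'p \<Rightarrow> complex)
            (b :: nat \<Rightarrow> nat \<Rightarrow> complex poly) (q :: nat \<Rightarrow> complex poly).
      \<yy> 0 = \<one>\<^bsub>R\<^esub> \<and> (\<forall>i<r. \<Upsilon> i \<in> carrier R) \<and>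
      h = (\<Oplus>\<^bsub>T\<^esub>i\<in>{..<r}. curve_pure X \<A> P x (\<Upsilon> i) (\<yy> i)) \<and>
      h = (\<Oplus>\<^bsub>T\<^esub>i\<in>{..<r}. curve_pure X \<A> P x (\<yy> i) (\<Upsilon> i)) \<and>
      tensor_lower_weight X \<A> P x (int d)
        (h \<ominus>\<^bsub>T\<^esub> (\<Oplus>\<^bsub>T\<^esub>i\<in>{..<r}. curve_pure X \<A> P x (\<yy>' i) (\<yy> i))) \<and>
      (\<forall>i<r. \<Upsilon> i = (\<Oplus>\<^bsub>R\<^esub>j\<in>{..<r}. poly_in_x X P x (b i j) \<otimes>\<^bsub>R\<^esub> \<yy> j)) \<and>
      (\<forall>i<r.
         lead_coeff (q i) = 1 \<and>
         wt \<A> P (poly_in_x X P x (q i)) = - int (\<delta> i * r) \<and>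
         \<yy>' i = poly_in_x X P x (q i) \<otimes>\<^bsub>R\<^esub> \<yy> (star i) \<and>
         wt \<A> P (\<yy>' i) = - (int d - int (e i)) \<and>
         lower_weight X \<A> P (- wt \<A> P (\<yy>' i)) (\<Upsilon> i \<ominus>\<^bsub>R\<^esub> \<yy>' i) \<and>
         lower_weight X \<A> P (- wt \<A> P (\<yy>' 0)) (\<yy>' 0 \<ominus>\<^bsub>R\<^esub> (\<yy>' i \<otimes>\<^bsub>R\<^esub> \<yy> i))) \<and>
      star 0 = l \<and> \<yy>' 0 = poly_in_x X P x (q 0) \<otimes>\<^bsub>R\<^esub> \<yy> l"
proof -
  interpret W: weierstrass X \<A> P r m i_s i_r e \<rho> f\<^sub>X x y \<nu> \<yy>
    using curve basis by unfold_locales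
  have T_eq: "T = W.T" by (simp add: T R curve_tensor_def)
  have h_T: "h \<in> carrier W.T" and e_le: "\<And>i. i < r \<Longrightarrow> e i \<le> d"
    and leading: "has_leading_part X \<A> P r m \<rho> x y h d (\<Sum>i<r. monom (monom 1 (d - e i)) (e i))"
    using h unfolding is_h_tilde_def Let_def by (auto simp: curve_tensor_def)
  obtain \<Upsilon> where \<Upsilon>: "\<And>i. i < r \<Longrightarrow> \<Upsilon> i \<in> carrier W.R"
      "\<And>i. i < r \<Longrightarrow> W.lead (d - e i) 1 (\<Upsilon> i)"
    and h_sum: "h = (\<Oplus>\<^bsub>W.T\<^esub>i\<in>{..<r}. pure_tensor W.R W.K (\<Upsilon> i) (\<yy> i))"
    using W.expands_leading_part[OF h_T leading] unfolding W.expands_def by auto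
  have "h = tensor_swap h" by (rule W.h_tilde_symmetric[OF F h, symmetric])
  also have "\<dots> = (\<Oplus>\<^bsub>W.T\<^esub>i\<in>{..<r}. tensor_swap (pure_tensor W.R W.K (\<Upsilon> i) (\<yy> i)))"
    unfolding h_sum by (subst W.RT.swap.hom_finsum) (use \<Upsilon> W.basis_in in \<open>auto simp: comp_def\<close>)
  finally have h_sum': "h = (\<Oplus>\<^bsub>W.T\<^esub>i\<in>{..<r}. pure_tensor W.R W.K (\<yy> i) (\<Upsilon> i))"
    by (simp add: W.RT.tensor_swap_pure)
  have "\<exists>b. \<Upsilon> i = (\<Oplus>\<^bsub>W.R\<^esub>j\<in>{..<r}. poly_in_x X P x (b j) \<otimes>\<^bsub>W.R\<^esub> \<yy> j)" if "i < r" for i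
  proof (rule W.basis_expansion[OF \<Upsilon>(1)[OF that] \<Upsilon>(2)[OF that]])
    fix b assume "\<And>u. u \<in> W.S \<Longrightarrow> \<Upsilon> i u = (\<Sum>j<r. poly (b j) (x u) * \<yy> j u)"
    from W.basis_sum[OF \<Upsilon>(1)[OF that] this] show ?thesis by blast
  qed
  then obtain b where b: "\<And>i. i < r \<Longrightarrow>
      \<Upsilon> i = (\<Oplus>\<^bsub>W.R\<^esub>j\<in>{..<r}. poly_in_x X P x (b i j) \<otimes>\<^bsub>W.R\<^esub> \<yy> j)"
    by metis
  \<comment> \<open>Only leading terms matter, so the monic polynomial of degree \<open>\<delta> i\<close> can be a power of \<open>x\<close>.\<close>
  define q where "q i = monom (1 :: complex) (\<delta> i)" for i
  define \<yy>' where "\<yy>' i = poly_in_x X P x (q i) \<otimes>\<^bsub>W.R\<^esub> \<yy> (star i)" for i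
  have star_less: "star i < r" if "i < r" for i using star that by blast
  have \<yy>'_in: "\<yy>' i \<in> carrier W.R" if "i < r" for i
    using W.X_poly_in W.basis_in star_less[OF that] by (simp add: \<yy>'_def)
  have lead_\<yy>': "W.lead (d - e i) 1 (\<yy>' i)" if i: "i < r" for i
  proof -
    have "W.lead (r * \<delta> i + e (star i)) (1 * 1) (\<yy>' i)"
      unfolding \<yy>'_def q_def
      by (intro W.lead_R_mult W.lead_X_monom W.lead_basis star_less i)
    moreover have "r * \<delta> i + e (star i) = d - e i" using \<delta> i by (simp add: mult.commute)
    ultimately show ?thesis by simp
  qed
  have wt_q: "wt \<A> P (poly_in_x X P x (q i)) = - int (\<delta> i * r)" for i
    using W.lead_wt[OF W.X_poly_in W.lead_X_monom[of "\<delta> i" 1]] by (simp add: q_def mult.commute)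
  have wt_\<yy>'_nat: "wt \<A> P (\<yy>' i) = - int (d - e i)" if "i < r" for i
    using W.lead_wt[OF \<yy>'_in[OF that] lead_\<yy>'[OF that]] by simp
  have wt_\<yy>': "wt \<A> P (\<yy>' i) = - (int d - int (e i))" if "i < r" for i
    using wt_\<yy>'_nat[OF that] e_le[OF that] by simp
  have diff_in: "\<Upsilon> i \<ominus>\<^bsub>W.R\<^esub> \<yy>' i \<in> carrier W.R" if "i < r" for i
    using \<Upsilon> \<yy>'_in that by simp
  have lower: "lower_weight X \<A> P (int (d - e i)) (\<Upsilon> i \<ominus>\<^bsub>W.R\<^esub> \<yy>' i)" if i: "i < r" for i
    using W.lead_R_diff[OF \<Upsilon>(1)[OF i] \<yy>'_in[OF i] \<Upsilon>(2)[OF i] lead_\<yy>'[OF i]] diff_in[OF i]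
    by (intro W.lead_lower_weight) simp_all
  have lower': "lower_weight X \<A> P (int d) (\<yy>' 0 \<ominus>\<^bsub>W.R\<^esub> (\<yy>' i \<otimes>\<^bsub>W.R\<^esub> \<yy> i))" if i: "i < r" for i
  proof -
    have in_R: "\<yy>' 0 \<in> carrier W.R" "\<yy>' i \<otimes>\<^bsub>W.R\<^esub> \<yy> i \<in> carrier W.R"
      using \<yy>'_in W.basis_in i W.r_pos by simp_all
    have "W.lead d 1 (\<yy>' 0)" using lead_\<yy>'[OF W.r_pos] by (simp add: W.e_0)
    moreover have "W.lead (d - e i + e i) (1 * 1) (\<yy>' i \<otimes>\<^bsub>W.R\<^esub> \<yy> i)"
      by (intro W.lead_R_mult lead_\<yy>' W.lead_basis i)
    ultimately have "W.lead d (1 - 1) (\<yy>' 0 \<ominus>\<^bsub>W.R\<^esub> (\<yy>' i \<otimes>\<^bsub>W.R\<^esub> \<yy> i))"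
      using e_le[OF i] by (intro W.lead_R_diff in_R) simp_all
    then show ?thesis using in_R by (intro W.lead_lower_weight) simp_all
  qed
  have tensor_lower: "tensor_lower_weight X \<A> P x (int d)
      (h \<ominus>\<^bsub>W.T\<^esub> (\<Oplus>\<^bsub>W.T\<^esub>i\<in>{..<r}. pure_tensor W.R W.K (\<yy>' i) (\<yy> i)))"
  proof -
    let ?U = "\<Oplus>\<^bsub>W.T\<^esub>i\<in>{..<r}. pure_tensor W.R W.K (\<Upsilon> i \<ominus>\<^bsub>W.R\<^esub> \<yy>' i) (\<yy> i)"
    let ?V = "\<Oplus>\<^bsub>W.T\<^esub>i\<in>{..<r}. pure_tensor W.R W.K (\<yy>' i) (\<yy> i)"
    have UV: "?U \<in> carrier W.T" "?V \<in> carrier W.T"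
      using diff_in \<yy>'_in W.basis_in by (auto intro!: W.RT.T.finsum_closed)
    have "?U \<oplus>\<^bsub>W.T\<^esub> ?V = (\<Oplus>\<^bsub>W.T\<^esub>i\<in>{..<r}. pure_tensor W.R W.K (\<Upsilon> i \<ominus>\<^bsub>W.R\<^esub> \<yy>' i) (\<yy> i)
        \<oplus>\<^bsub>W.T\<^esub> pure_tensor W.R W.K (\<yy>' i) (\<yy> i))"
      by (rule W.RT.T.finsum_addf[symmetric]) (use diff_in \<yy>'_in W.basis_in in auto)
    also have "\<dots> = h"
      unfolding h_sum
    proof (intro W.RT.T.finsum_cong')
      fix i assume "i \<in> {..<r}"
      then have i: "i < r" by simp
      have "\<Upsilon> i \<ominus>\<^bsub>W.R\<^esub> \<yy>' i \<oplus>\<^bsub>W.R\<^esub> \<yy>' i = \<Upsilon> i"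
        using \<Upsilon>(1)[OF i] \<yy>'_in[OF i] by (simp add: W.R.minus_eq W.R.a_assoc W.R.l_neg)
      then show "pure_tensor W.R W.K (\<Upsilon> i \<ominus>\<^bsub>W.R\<^esub> \<yy>' i) (\<yy> i) \<oplus>\<^bsub>W.T\<^esub> pure_tensor W.R W.K (\<yy>' i) (\<yy> i)
          = pure_tensor W.R W.K (\<Upsilon> i) (\<yy> i)"
        using diff_in[OF i] \<yy>'_in[OF i] W.basis_in[OF i] by (simp flip: W.RT.pure_add_left)
    qed (use \<Upsilon> W.basis_in in auto)
    finally have "h \<ominus>\<^bsub>W.T\<^esub> ?V = ?U \<oplus>\<^bsub>W.T\<^esub> ?V \<ominus>\<^bsub>W.T\<^esub> ?V" by simp
    also have "\<dots> = ?U" using UV by (simp add: W.RT.T.minus_eq W.RT.T.a_assoc W.RT.T.r_neg)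
    finally have eq: "h \<ominus>\<^bsub>W.T\<^esub> ?V = ?U" .
    show ?thesis unfolding eq
    proof (rule W.tensor_lower_weightI)
      fix i assume i: "i \<in> {..<r}" "\<Upsilon> i \<ominus>\<^bsub>W.R\<^esub> \<yy>' i \<noteq> \<zero>\<^bsub>W.R\<^esub>"
      then have "- wt \<A> P (\<Upsilon> i \<ominus>\<^bsub>W.R\<^esub> \<yy>' i) < int (d - e i)"
        using lower[of i] by (simp add: lower_weight_def)
      moreover have "wt \<A> P (\<yy> i) = - int (e i)" using i(1) basis by blast
      ultimately show "- wt \<A> P (\<Upsilon> i \<ominus>\<^bsub>W.R\<^esub> \<yy>' i) - wt \<A> P (\<yy> i) < int d"
        using i(1) e_le[of i] by simp
    qed (use diff_in W.basis_in in auto)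
  qed
  have star_0: "star 0 = l"
  proof (rule standard_basis_inj[OF W.std])
    show "star 0 < r" using star_less[OF W.r_pos] .
    show "e (star 0) mod r = e l mod r" using star W.r_pos W.e_0 by force
  qed (rule l(1))
  show ?thesis
    unfolding R T_eq curve_pure_def
  proof (rule exI[of _ \<Upsilon>], rule exI[of _ \<yy>'], rule exI[of _ b], rule exI[of _ q],
      intro conjI allI impI)
    show "\<yy>' 0 = poly_in_x X P x (q 0) \<otimes>\<^bsub>W.R\<^esub> \<yy> l" by (simp only: \<yy>'_def star_0)
    fix i assume i: "i < r"
    show "wt \<A> P (poly_in_x X P x (q i)) = - int (\<delta> i * r)" by (rule wt_q)
    show "lead_coeff (q i) = 1" by (simp add: q_def degree_monom_eq)
    show "\<yy>' i = poly_in_x X P x (q i) \<otimes>\<^bsub>W.R\<^esub> \<yy> (star i)" by (simp only: \<yy>'_def)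
    show "lower_weight X \<A> P (- wt \<A> P (\<yy>' i)) (\<Upsilon> i \<ominus>\<^bsub>W.R\<^esub> \<yy>' i)"
      using lower[OF i] by (simp only: wt_\<yy>'_nat[OF i] minus_minus)
    show "lower_weight X \<A> P (- wt \<A> P (\<yy>' 0)) (\<yy>' 0 \<ominus>\<^bsub>W.R\<^esub> (\<yy>' i \<otimes>\<^bsub>W.R\<^esub> \<yy> i))"
      using lower'[OF i] by (simp only: wt_\<yy>'_nat[OF W.r_pos] W.e_0 minus_minus diff_zero)
  qed (fact W.basis_0 \<Upsilon>(1) h_sum h_sum' tensor_lower b wt_\<yy>' star_0)+
qed

end
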